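(* Let $P(D)=\sum_{i,j=1}^n a_{ij}D_iD_j+\sum_{j=1}^n b_jD_j+c$ with $a_{ij}\in\widetilde{\mathbb{R}}$ and $b_j,c\in\widetilde{\mathbb{C}}$ be a second order G-elliptic operator, and let $\lambda_i,\beta_i,\gamma,\tilde\lambda_i$ be the generalized numbers associated with $P$ (as defined in the context). Assume that $\gamma$ is either equal to zero or invertible in $\widetilde{\mathbb{C}}$. Let $f\in\mathcal{G}^\infty(\mathbb{R}^n)$ and let $u\in\mathcal{G}(\mathbb{R}^n)$ be a solution of $P(D)u=f$. If $\beta_j/\lambda_j$ is of log-type for $j=1,\dots,n$ and $\tilde\lambda_i$ and $\tilde\lambda_i^{-1}$ are slow scale for $i=1,\dots,n$, then $u\in\mathcal{G}^\infty(\mathbb{R}^n)$.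
   Context: Colombeau algebra: for $\Omega\subset\mathbb{R}^n$ open, $\mathcal{E}_{\mathrm M}(\Omega)$ is the set of nets $(u_\varepsilon)_{\varepsilon\in(0,1]}$ in $C^\infty(\Omega)$ such that for every compact $K\subset\Omega$ and $\alpha\in\mathbb{N}_0^n$ there is $p\ge0$ with $\sup_{K}|\partial^\alpha u_\varepsilon|=O(\varepsilon^{-p})$ as $\varepsilon\to0$; $\mathcal{N}(\Omega)$ is the set of nets such that for all $K,\alpha$ and all $q\ge0$, $\sup_{K}|\partial^\alpha u_\varepsilon|=O(\varepsilon^{q})$. $\mathcal{G}(\Omega)=\mathcal{E}_{\mathrm M}(\Omega)/\mathcal{N}(\Omega)$, with operations on representatives. $\mathcal{G}^\infty(\Omega)$ consists of the elements having a representative such that for every compact $K$ there is $p\ge0$ such that for all $\alpha$, $\sup_{K}|\partial^\alpha u_\varepsilon|=O(\varepsilon^{-p})$. $\widetilde{\mathbb{C}}$ (resp. $\widetilde{\mathbb{R}}$): nets $(c_\varepsilon)_{\varepsilon\in(0,1]}$ of complex (resp. real) numbers with $|c_\varepsilon|=O(\varepsilon^{-p})$ for some $p$, modulo those with $|c_\varepsilon|=O(\varepsilon^q)$ for all $q$. An element $r\in\widetilde{\mathbb{R}}$ is nonnegative if it has a representative with $r_\varepsilon\ge0$ for all $\varepsilon$. For $\gamma\in\widetilde{\mathbb C}$, $|\gamma|$ is the class of $(|\gamma_\varepsilon|)_\varepsilon$. $D_j=-i\partial_j$. G-elliptic: the matrix $A=(a_{ij})_{i,j}$ over $\widetilde{\mathbb{R}}$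 is symmetric and positive definite, the latter meaning that all its eigenvalues $\lambda_1,\dots,\lambda_n\in\widetilde{\mathbb{R}}$ (obtained from the eigenvalues of symmetric representatives $A_\varepsilon$ at fixed $\varepsilon$) are nonnegative and invertible in $\widetilde{\mathbb{R}}$. There is an orthogonal matrix $Q$ with entries in $\widetilde{\mathbb{R}}$ such that $A=Q^T\Lambda Q$ with $\Lambda=\mathrm{diag}(\lambda_1,\dots,\lambda_n)$; fix such a $Q$. Define $\beta_i=\sum_{j=1}^nQ_{ij}b_j$, $\gamma=c-\sum_{j=1}^n\frac{\beta_j^2}{4\lambda_j}$, and $\tilde\lambda_i=\lambda_i$ if $\gamma=0$, $\tilde\lambda_i=\lambda_i/|\gamma|$ if $\gamma$ is invertible. A net $(r_\varepsilon)_\varepsilon$ is slow scale if $|r_\varepsilon|^t=O(1/\varepsilon)$ as $\varepsilon\to0$ for every $t\ge0$; it is of log-type if there are $\varepsilon_0>0$ and $C>0$ with $|r_\varepsilon|\le C\log\frac1\varepsilon$ for all $\varepsilon\in(0,\varepsilon_0)$. A generalized number is called slow scale, resp. of log-type, if its representatives are. *)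

theory Defs
  imports "HOL-Analysis.Analysis" "HOL-Library.Landau_Symbols"
begin

section \<open>Generalized numbers\<close>

text \<open>Nets indexed by \<open>(0,1]\<close> are total functions on \<^typ>\<open>real\<close>; their values outside
  \<open>(0,1]\<close> never matter. The filter \<^term>\<open>at_right (0::real)\<close> expresses \<open>\<epsilon> \<rightarrow> 0\<close> through positive
  values.\<close>

definition moderate_number :: "(real \<Rightarrow> 'a::real_normed_field) \<Rightarrow> bool" where
  "moderate_number c \<longleftrightarrow>
     (\<exists>p\<ge>0. (\<lambda>\<epsilon>. norm (c \<epsilon>)) \<in> O[at_right 0](\<lambda>\<epsilon>. \<epsilon> powr (- p)))"

definition negligible_number :: "(real \<Rightarrow> 'a::real_normed_field) \<Rightarrow> bool" where
  "negligible_number c \<longleftrightarrow>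
     (\<forall>q\<ge>0. (\<lambda>\<epsilon>. norm (c \<epsilon>)) \<in> O[at_right 0](\<lambda>\<epsilon>. \<epsilon> powr q))"

definition number_rel :: "(real \<Rightarrow> 'a::real_normed_field) \<Rightarrow> (real \<Rightarrow> 'a) \<Rightarrow> bool" where
  "number_rel c d \<longleftrightarrow>
     moderate_number c \<and> moderate_number d \<and> negligible_number (\<lambda>\<epsilon>. c \<epsilon> - d \<epsilon>)"

lemma bigo_powr_mono:
  assumes "a \<le> (b::real)"
  shows "(\<lambda>\<epsilon>. \<epsilon> powr b) \<in> O[at_right 0](\<lambda>\<epsilon>::real. \<epsilon> powr a)"
proof (rule bigoI[where c = 1])
  have "eventually (\<lambda>\<epsilon>::real. \<epsilon> \<in> {0<..<1}) (at_right 0)"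
    by (rule eventually_at_right_real) simp
  then show "eventually (\<lambda>\<epsilon>. norm (\<epsilon> powr b) \<le> 1 * norm (\<epsilon> powr a)) (at_right (0::real))"
    by eventually_elim (use assms in \<open>auto intro: powr_mono'\<close>)
qed

lemma bigo_powr_mult:
  assumes "f \<in> O[at_right 0](\<lambda>\<epsilon>::real. \<epsilon> powr a)" "g \<in> O[at_right 0](\<lambda>\<epsilon>. \<epsilon> powr b)"
  shows "(\<lambda>\<epsilon>. f \<epsilon> * g \<epsilon> :: real) \<in> O[at_right 0](\<lambda>\<epsilon>. \<epsilon> powr (a + b))"
  using landau_o.big_mult[OF assms] by (simp add: powr_add)

lemma bigo_le_sum:
  fixes h f g :: "real \<Rightarrow> real"
  assumes "f \<in> O[F](k)" "g \<in> O[F](k)" "eventually (\<lambda>\<epsilon>. \<bar>h \<epsilon>\<bar> \<le> f \<epsilon> + g \<epsilon>) F"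
  shows "h \<in> O[F](k)"
proof -
  have "(\<lambda>\<epsilon>. f \<epsilon> + g \<epsilon>) \<in> O[F](k)" using assms(1,2) by (rule sum_in_bigo)
  moreover have "h \<in> O[F](\<lambda>\<epsilon>. f \<epsilon> + g \<epsilon>)"
    using assms(3) by (intro bigoI[where c = 1]) (auto elim!: eventually_mono)
  ultimately show ?thesis using landau_o.big_trans by blast
qed

lemma negligible_imp_moderate_number: "negligible_number c \<Longrightarrow> moderate_number c"
  unfolding negligible_number_def moderate_number_def by (metis minus_zero order_refl)

lemma moderate_number_const: "moderate_number (\<lambda>_. c)"
  unfolding moderate_number_def
proof (intro exI[of _ 0] conjI)
  have *: "eventually (\<lambda>\<epsilon>::real. \<epsilon> \<in> {0<..<1}) (at_right 0)"
    by (rule eventually_at_right_real) simp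
  show "(\<lambda>\<epsilon>. norm c) \<in> O[at_right 0](\<lambda>\<epsilon>::real. \<epsilon> powr - 0)"
    by (rule bigoI[where c = "norm c"], rule eventually_mono[OF *]) auto
qed simp

lemma moderate_number_add:
  assumes "moderate_number c" "moderate_number d"
  shows "moderate_number (\<lambda>\<epsilon>. c \<epsilon> + d \<epsilon>)"
proof -
  from assms obtain p q where pq: "p \<ge> 0" "q \<ge> 0"
    "(\<lambda>\<epsilon>. norm (c \<epsilon>)) \<in> O[at_right 0](\<lambda>\<epsilon>. \<epsilon> powr (- p))"
    "(\<lambda>\<epsilon>. norm (d \<epsilon>)) \<in> O[at_right 0](\<lambda>\<epsilon>. \<epsilon> powr (- q))"
    unfolding moderate_number_def by blast
  have "(\<lambda>\<epsilon>. norm (c \<epsilon> + d \<epsilon>)) \<in> O[at_right 0](\<lambda>\<epsilon>. \<epsilon> powr (- max p q))"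
    by (rule bigo_le_sum[OF landau_o.big_trans[OF pq(3) bigo_powr_mono]
          landau_o.big_trans[OF pq(4) bigo_powr_mono]])
      (auto intro: always_eventually norm_triangle_ineq)
  moreover have "max p q \<ge> 0" using pq by simp
  ultimately show ?thesis unfolding moderate_number_def by blast
qed

lemma moderate_number_mult:
  assumes "moderate_number c" "moderate_number d"
  shows "moderate_number (\<lambda>\<epsilon>. c \<epsilon> * d \<epsilon>)"
proof -
  from assms obtain p q where pq: "p \<ge> 0" "q \<ge> 0"
    "(\<lambda>\<epsilon>. norm (c \<epsilon>)) \<in> O[at_right 0](\<lambda>\<epsilon>. \<epsilon> powr (- p))"
    "(\<lambda>\<epsilon>. norm (d \<epsilon>)) \<in> O[at_right 0](\<lambda>\<epsilon>. \<epsilon> powr (- q))"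
    unfolding moderate_number_def by blast
  show ?thesis unfolding moderate_number_def
    by (rule exI[of _ "p + q"]) (use bigo_powr_mult[OF pq(3,4)] pq in \<open>simp add: norm_mult\<close>)
qed

lemma moderate_number_uminus: "moderate_number (\<lambda>\<epsilon>. - c \<epsilon>) \<longleftrightarrow> moderate_number c"
  by (simp add: moderate_number_def)

lemma negligible_number_add:
  assumes "negligible_number c" "negligible_number d"
  shows "negligible_number (\<lambda>\<epsilon>. c \<epsilon> + d \<epsilon>)"
  unfolding negligible_number_def
proof (intro allI impI)
  fix q :: real assume "q \<ge> 0"
  with assms have *: "(\<lambda>\<epsilon>. norm (c \<epsilon>)) \<in> O[at_right 0](\<lambda>\<epsilon>. \<epsilon> powr q)"
    "(\<lambda>\<epsilon>. norm (d \<epsilon>)) \<in> O[at_right 0](\<lambda>\<epsilon>. \<epsilon> powr q)"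
    unfolding negligible_number_def by blast+
  show "(\<lambda>\<epsilon>. norm (c \<epsilon> + d \<epsilon>)) \<in> O[at_right 0](\<lambda>\<epsilon>. \<epsilon> powr q)"
    by (rule bigo_le_sum[OF *]) (simp add: norm_triangle_ineq)
qed

lemma negligible_number_uminus: "negligible_number (\<lambda>\<epsilon>. - c \<epsilon>) \<longleftrightarrow> negligible_number c"
  by (simp add: negligible_number_def)

lemma negligible_number_mult:
  assumes "negligible_number c" "moderate_number d"
  shows "negligible_number (\<lambda>\<epsilon>. c \<epsilon> * d \<epsilon>)"
  unfolding negligible_number_def
proof (intro allI impI)
  fix q :: real assume q: "q \<ge> 0"
  from assms(2) obtain p where p: "p \<ge> 0"
    "(\<lambda>\<epsilon>. norm (d \<epsilon>)) \<in> O[at_right 0](\<lambda>\<epsilon>. \<epsilon> powr (- p))"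
    unfolding moderate_number_def by blast
  have "(\<lambda>\<epsilon>. norm (c \<epsilon>)) \<in> O[at_right 0](\<lambda>\<epsilon>. \<epsilon> powr (q + p))"
    using assms(1) p q unfolding negligible_number_def by simp
  from bigo_powr_mult[OF this p(2)]
  show "(\<lambda>\<epsilon>. norm (c \<epsilon> * d \<epsilon>)) \<in> O[at_right 0](\<lambda>\<epsilon>. \<epsilon> powr q)"
    by (simp add: norm_mult)
qed

lemma negligible_number_zero: "negligible_number (\<lambda>_. 0)"
  by (simp add: negligible_number_def)

text \<open>\<open>real gnum\<close> and \<open>complex gnum\<close> are the rings of generalized real and complex numbers.\<close>

quotient_type (overloaded) 'a gnum = "real \<Rightarrow> 'a::real_normed_field" / partial: number_rel
proof (rule part_equivpI)
  show "\<exists>x::real \<Rightarrow> 'a. number_rel x x"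
    by (rule exI[of _ "\<lambda>_. 0"])
      (simp add: number_rel_def moderate_number_const negligible_number_zero)
  show "symp (number_rel :: (real \<Rightarrow> 'a) \<Rightarrow> _)"
  proof (rule sympI)
    fix c d :: "real \<Rightarrow> 'a" assume "number_rel c d"
    then show "number_rel d c"
      using negligible_number_uminus[of "\<lambda>\<epsilon>. c \<epsilon> - d \<epsilon>"] by (simp add: number_rel_def)
  qed
  show "transp (number_rel :: (real \<Rightarrow> 'a) \<Rightarrow> _)"
  proof (rule transpI)
    fix c d e :: "real \<Rightarrow> 'a" assume "number_rel c d" "number_rel d e"
    then show "number_rel c e"
      using negligible_number_add[of "\<lambda>\<epsilon>. c \<epsilon> - d \<epsilon>" "\<lambda>\<epsilon>. d \<epsilon> - e \<epsilon>"]
      by (simp add: number_rel_def)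
  qed
qed

definition represents :: "(real \<Rightarrow> 'a::real_normed_field) \<Rightarrow> 'a gnum \<Rightarrow> bool" where
  "represents r x \<longleftrightarrow> moderate_number r \<and> abs_gnum r = x"

instantiation gnum :: (real_normed_field) comm_ring_1
begin

lift_definition zero_gnum :: "'a gnum" is "\<lambda>_. 0"
  by (simp add: number_rel_def moderate_number_const negligible_number_zero)

lift_definition one_gnum :: "'a gnum" is "\<lambda>_. 1"
  by (simp add: number_rel_def moderate_number_const negligible_number_zero)

lift_definition uminus_gnum :: "'a gnum \<Rightarrow> 'a gnum" is "\<lambda>c \<epsilon>. - c \<epsilon>"
proof -
  fix c d :: "real \<Rightarrow> 'a" assume "number_rel c d"
  then show "number_rel (\<lambda>\<epsilon>. - c \<epsilon>) (\<lambda>\<epsilon>. - d \<epsilon>)"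
    using negligible_number_uminus[of "\<lambda>\<epsilon>. c \<epsilon> - d \<epsilon>"]
    by (simp add: number_rel_def moderate_number_uminus)
qed

lift_definition plus_gnum :: "'a gnum \<Rightarrow> 'a gnum \<Rightarrow> 'a gnum" is "\<lambda>c d \<epsilon>. c \<epsilon> + d \<epsilon>"
proof -
  fix c c' d d' :: "real \<Rightarrow> 'a" assume "number_rel c c'" "number_rel d d'"
  then show "number_rel (\<lambda>\<epsilon>. c \<epsilon> + d \<epsilon>) (\<lambda>\<epsilon>. c' \<epsilon> + d' \<epsilon>)"
    using negligible_number_add[of "\<lambda>\<epsilon>. c \<epsilon> - c' \<epsilon>" "\<lambda>\<epsilon>. d \<epsilon> - d' \<epsilon>"]
    by (simp add: number_rel_def moderate_number_add add_diff_add)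
qed

definition minus_gnum :: "'a gnum \<Rightarrow> 'a gnum \<Rightarrow> 'a gnum" where
  "minus_gnum x y = x + (- y)"

lift_definition times_gnum :: "'a gnum \<Rightarrow> 'a gnum \<Rightarrow> 'a gnum" is "\<lambda>c d \<epsilon>. c \<epsilon> * d \<epsilon>"
proof -
  fix c c' d d' :: "real \<Rightarrow> 'a" assume a: "number_rel c c'" "number_rel d d'"
  have "negligible_number (\<lambda>\<epsilon>. (c \<epsilon> - c' \<epsilon>) * d \<epsilon> + (d \<epsilon> - d' \<epsilon>) * c' \<epsilon>)"
    using a by (intro negligible_number_add negligible_number_mult) (auto simp: number_rel_def)
  moreover have "(\<lambda>\<epsilon>. (c \<epsilon> - c' \<epsilon>) * d \<epsilon> + (d \<epsilon> - d' \<epsilon>) * c' \<epsilon>) = (\<lambda>\<epsilon>. c \<epsilon> * d \<epsilon> - c' \<epsilon> * d' \<epsilon>)"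
    by (simp add: algebra_simps)
  ultimately show "number_rel (\<lambda>\<epsilon>. c \<epsilon> * d \<epsilon>) (\<lambda>\<epsilon>. c' \<epsilon> * d' \<epsilon>)"
    using a by (simp add: number_rel_def moderate_number_mult)
qed

instance
proof
  fix a b c :: "'a gnum"
  have [simp]: "number_rel f g" if "moderate_number f" "f = g" for f g :: "real \<Rightarrow> 'a"
    using that by (simp add: number_rel_def negligible_number_zero)
  note mod = moderate_number_add moderate_number_mult moderate_number_uminus moderate_number_const
  show "a + b + c = a + (b + c)"
    by transfer (simp add: mod algebra_simps number_rel_def)
  show "a + b = b + a"
    by transfer (simp add: mod algebra_simps number_rel_def)
  show "0 + a = a" by transfer (simp add: number_rel_def)
  show "- a + a = 0" by transfer (simp add: number_rel_def mod negligible_number_zero)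
  show "a - b = a + - b" by (simp add: minus_gnum_def)
  show "a * b * c = a * (b * c)"
    by transfer (simp add: mod algebra_simps number_rel_def)
  show "a * b = b * a"
    by transfer (simp add: mod algebra_simps number_rel_def)
  show "1 * a = a" by transfer (simp add: number_rel_def)
  show "(a + b) * c = a * c + b * c"
    by transfer (simp add: mod algebra_simps number_rel_def negligible_number_zero)
  show "(0::'a gnum) \<noteq> 1"
  proof
    assume "(0::'a gnum) = 1"
    then have "negligible_number (\<lambda>\<epsilon>. 0 - (1::'a))" by transfer (simp add: number_rel_def)
    then have "(\<lambda>\<epsilon>. norm (0 - (1::'a))) \<in> O[at_right 0](\<lambda>\<epsilon>. \<epsilon> powr 1)"
      unfolding negligible_number_def by (metis zero_le_one)
    then have "(\<lambda>\<epsilon>. 1 :: real) \<in> O[at_right 0](\<lambda>\<epsilon>. \<epsilon> powr 1)" by simp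
    then obtain C where C: "C > 0"
      "eventually (\<lambda>\<epsilon>::real. norm (1::real) \<le> C * norm (\<epsilon> powr 1)) (at_right 0)"
      by (rule landau_o.bigE)
    have "eventually (\<lambda>\<epsilon>::real. \<epsilon> \<in> {0<..<1 / (2 * C)}) (at_right 0)"
      using C by (intro eventually_at_right_real) simp
    with C(2) have "eventually (\<lambda>\<epsilon>::real. False) (at_right 0)"
      by eventually_elim (use C in \<open>auto simp: field_simps\<close>)
    then show False by simp
  qed
qed

end

text \<open>Division is only meaningful by invertible elements; \<open>inverse\<close> is set to \<open>0\<close> elsewhere.\<close>

instantiation gnum :: (real_normed_field) inverse
begin

definition inverse_gnum :: "'a gnum \<Rightarrow> 'a gnum" where
  "inverse_gnum x = (if x dvd 1 then (THE y. x * y = 1) else 0)"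

definition divide_gnum :: "'a gnum \<Rightarrow> 'a gnum \<Rightarrow> 'a gnum" where
  "divide_gnum x y = x * inverse y"

instance ..

end

lemma gnum_mult_inverse:
  fixes x :: "'a::real_normed_field gnum"
  assumes "x dvd 1"
  shows "x * inverse x = 1"
proof -
  obtain y where y: "x * y = 1" using assms by (metis dvdE)
  have "(THE y. x * y = 1) = y"
  proof (rule the_equality[of "\<lambda>y. x * y = 1", OF y])
    fix z assume "x * z = 1"
    then show "z = y" using y by (metis mult.assoc mult.commute mult_1)
  qed
  then show ?thesis using assms y by (simp add: inverse_gnum_def)
qed

lift_definition gabs :: "'a::real_normed_field gnum \<Rightarrow> real gnum" is "\<lambda>c \<epsilon>. norm (c \<epsilon>)"
proof -
  fix c d :: "real \<Rightarrow> 'a" assume a: "number_rel c d"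
  have "negligible_number (\<lambda>\<epsilon>. norm (c \<epsilon>) - norm (d \<epsilon>))"
    unfolding negligible_number_def
  proof (intro allI impI)
    fix q :: real assume "q \<ge> 0"
    then have *: "(\<lambda>\<epsilon>. norm (c \<epsilon> - d \<epsilon>)) \<in> O[at_right 0](\<lambda>\<epsilon>. \<epsilon> powr q)"
      using a by (simp add: number_rel_def negligible_number_def)
    show "(\<lambda>\<epsilon>. norm (norm (c \<epsilon>) - norm (d \<epsilon>))) \<in> O[at_right 0](\<lambda>\<epsilon>. \<epsilon> powr q)"
      by (rule landau_o.big_mono[THEN landau_o.big_trans, OF _ *])
        (simp add: norm_triangle_ineq3)
  qed
  with a show "number_rel (\<lambda>\<epsilon>. norm (c \<epsilon>)) (\<lambda>\<epsilon>. norm (d \<epsilon>))"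
    by (simp add: number_rel_def moderate_number_def)
qed

lift_definition gcomplex :: "real gnum \<Rightarrow> complex gnum" is "\<lambda>c \<epsilon>. complex_of_real (c \<epsilon>)"
  by (simp add: number_rel_def moderate_number_def negligible_number_def
      flip: of_real_diff)

definition gnonneg :: "real gnum \<Rightarrow> bool" where
  "gnonneg x \<longleftrightarrow> (\<exists>r. represents r x \<and> (\<forall>\<epsilon>\<in>{0<..1}. r \<epsilon> \<ge> 0))"

definition slow_scale_net :: "(real \<Rightarrow> 'a::real_normed_field) \<Rightarrow> bool" where
  "slow_scale_net r \<longleftrightarrow>
     (\<forall>t\<ge>0. (\<lambda>\<epsilon>. norm (r \<epsilon>) powr t) \<in> O[at_right 0](\<lambda>\<epsilon>. 1 / \<epsilon>))"

definition log_type_net :: "(real \<Rightarrow> 'a::real_normed_field) \<Rightarrow> bool" where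
  "log_type_net r \<longleftrightarrow>
     (\<exists>\<epsilon>\<^sub>0>0. \<exists>C>0. \<forall>\<epsilon>\<in>{0<..<\<epsilon>\<^sub>0}. norm (r \<epsilon>) \<le> C * ln (1 / \<epsilon>))"

definition slow_scale :: "'a::real_normed_field gnum \<Rightarrow> bool" where
  "slow_scale x \<longleftrightarrow> (\<forall>r. represents r x \<longrightarrow> slow_scale_net r)"

definition log_type :: "'a::real_normed_field gnum \<Rightarrow> bool" where
  "log_type x \<longleftrightarrow> (\<forall>r. represents r x \<longrightarrow> log_type_net r)"


section \<open>The Colombeau algebra on \<open>\<real>\<^sup>n\<close>\<close>

definition partial_deriv :: "'n \<Rightarrow> (real^'n \<Rightarrow> complex) \<Rightarrow> real^'n \<Rightarrow> complex" where
  "partial_deriv i g x = frechet_derivative g (at x) (axis i 1)"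

text \<open>Multi-indices are encoded as lists of directions: \<open>\<partial>\<^sup>\<alpha>\<close> is \<open>partials is\<close> for any list
  \<open>is\<close> containing each \<open>i\<close> exactly \<open>\<alpha>\<^sub>i\<close> times. The order is irrelevant on smooth functions, so
  quantifying over lists amounts to quantifying over \<open>\<alpha>\<close>.\<close>

primrec partials :: "'n list \<Rightarrow> (real^'n \<Rightarrow> complex) \<Rightarrow> real^'n \<Rightarrow> complex" where
  "partials [] g = g"
| "partials (i # is) g = partials is (partial_deriv i g)"

definition smooth :: "(real^'n \<Rightarrow> complex) \<Rightarrow> bool" where
  "smooth g \<longleftrightarrow> (\<forall>is. partials is g differentiable_on UNIV)"

definition sup_norm :: "'b set \<Rightarrow> ('b \<Rightarrow> complex) \<Rightarrow> real" where
  "sup_norm K g = (SUP x\<in>K. norm (g x))"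

definition smooth_net :: "(real \<Rightarrow> real^'n \<Rightarrow> complex) \<Rightarrow> bool" where
  "smooth_net u \<longleftrightarrow> (\<forall>\<epsilon>\<in>{0<..1}. smooth (u \<epsilon>))"

text \<open>The empty compact set is left out because the supremum of the empty set of reals is
  unspecified.\<close>

definition moderate_net :: "(real \<Rightarrow> real^'n \<Rightarrow> complex) \<Rightarrow> bool" where
  "moderate_net u \<longleftrightarrow> smooth_net u \<and>
     (\<forall>K is. compact K \<and> K \<noteq> {} \<longrightarrow>
       (\<exists>p\<ge>0. (\<lambda>\<epsilon>. sup_norm K (partials is (u \<epsilon>))) \<in> O[at_right 0](\<lambda>\<epsilon>. \<epsilon> powr (- p))))"

definition negligible_net :: "(real \<Rightarrow> real^'n \<Rightarrow> complex) \<Rightarrow> bool" where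
  "negligible_net u \<longleftrightarrow> smooth_net u \<and>
     (\<forall>K is. compact K \<and> K \<noteq> {} \<longrightarrow>
       (\<forall>q\<ge>0. (\<lambda>\<epsilon>. sup_norm K (partials is (u \<epsilon>))) \<in> O[at_right 0](\<lambda>\<epsilon>. \<epsilon> powr q)))"

text \<open>Unlike \<^const>\<open>moderate_net\<close>, the exponent is chosen before the order of differentiation.\<close>

definition regular_net :: "(real \<Rightarrow> real^'n \<Rightarrow> complex) \<Rightarrow> bool" where
  "regular_net u \<longleftrightarrow> smooth_net u \<and>
     (\<forall>K. compact K \<and> K \<noteq> {} \<longrightarrow>
       (\<exists>p\<ge>0. \<forall>is. (\<lambda>\<epsilon>. sup_norm K (partials is (u \<epsilon>))) \<in> O[at_right 0](\<lambda>\<epsilon>. \<epsilon> powr (- p))))"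

definition net_rel ::
  "(real \<Rightarrow> real^'n \<Rightarrow> complex) \<Rightarrow> (real \<Rightarrow> real^'n \<Rightarrow> complex) \<Rightarrow> bool" where
  "net_rel u v \<longleftrightarrow> moderate_net u \<and> moderate_net v \<and> negligible_net (\<lambda>\<epsilon> x. u \<epsilon> x - v \<epsilon> x)"

lemma smooth_partial_deriv: "smooth g \<Longrightarrow> smooth (partial_deriv i g)"
  unfolding smooth_def by (metis partials.simps(2))

lemma smooth_imp_differentiable: "smooth g \<Longrightarrow> g differentiable (at x)"
  unfolding smooth_def differentiable_on_def by (metis UNIV_I partials.simps(1))

lemma partial_deriv_add:
  assumes "smooth f" "smooth g"
  shows "partial_deriv i (\<lambda>x. f x + g x) = (\<lambda>x. partial_deriv i f x + partial_deriv i g x)"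
proof
  fix x
  have "(f has_derivative frechet_derivative f (at x)) (at x)"
       "(g has_derivative frechet_derivative g (at x)) (at x)"
    using assms smooth_imp_differentiable frechet_derivative_works by blast+
  from has_derivative_add[OF this] show
    "partial_deriv i (\<lambda>x. f x + g x) x = partial_deriv i f x + partial_deriv i g x"
    unfolding partial_deriv_def using frechet_derivative_at by metis
qed

lemma partial_deriv_scale:
  assumes "smooth f"
  shows "partial_deriv i (\<lambda>x. c * f x) = (\<lambda>x. c * partial_deriv i f x)"
proof
  fix x
  have "(f has_derivative frechet_derivative f (at x)) (at x)"
    using assms smooth_imp_differentiable frechet_derivative_works by blast
  from has_derivative_mult_right[OF this, of c] show
    "partial_deriv i (\<lambda>x. c * f x) x = c * partial_deriv i f x"
    unfolding partial_deriv_def using frechet_derivative_at by metis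
qed

lemma partials_add:
  "smooth f \<Longrightarrow> smooth g \<Longrightarrow>
    partials is (\<lambda>x. f x + g x) = (\<lambda>x. partials is f x + partials is g x)"
  by (induction "is" arbitrary: f g) (auto simp: partial_deriv_add smooth_partial_deriv)

lemma partials_scale:
  "smooth f \<Longrightarrow> partials is (\<lambda>x. c * f x) = (\<lambda>x. c * partials is f x)"
  by (induction "is" arbitrary: f) (auto simp: partial_deriv_scale smooth_partial_deriv)

lemma smooth_add: "smooth f \<Longrightarrow> smooth g \<Longrightarrow> smooth (\<lambda>x. f x + g x)"
  unfolding smooth_def[of "\<lambda>x. f x + g x"]
  by (auto simp: partials_add) (auto simp: smooth_def intro!: differentiable_on_add)

lemma smooth_scale: "smooth f \<Longrightarrow> smooth (\<lambda>x. c * f x)"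
  unfolding smooth_def[of "\<lambda>x. c * f x"]
  by (auto simp: partials_scale) (auto simp: smooth_def intro!: differentiable_on_mult)

lemma smooth_zero: "smooth (\<lambda>_::real^'n. 0)"
proof -
  have "partials is (\<lambda>_. 0) = (\<lambda>_::real^'n. 0)" for "is" :: "'n list"
    by (induction "is") (simp_all add: partial_deriv_def[abs_def])
  then show ?thesis by (simp add: smooth_def)
qed

lemma partials_zero: "partials is (\<lambda>_. 0) = (\<lambda>_. 0)"
  using partials_scale[OF smooth_zero, of "is" 0] by simp

lemma smooth_bdd_above:
  assumes "smooth f" "compact K"
  shows "bdd_above ((\<lambda>x. norm (partials is f x)) ` K)"
proof -
  have "continuous_on K (partials is f)"
    using assms unfolding smooth_def
    by (meson differentiable_imp_continuous_on continuous_on_subset subset_UNIV)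
  then have "compact ((\<lambda>x. norm (partials is f x)) ` K)"
    by (intro compact_continuous_image continuous_on_norm assms)
  then show ?thesis by (simp add: compact_imp_bounded bounded_imp_bdd_above)
qed

lemma sup_norm_nonneg:
  assumes "smooth f" "compact K" "K \<noteq> {}"
  shows "sup_norm K (partials is f) \<ge> 0"
proof -
  obtain x where "x \<in> K" using assms by blast
  then have "norm (partials is f x) \<le> sup_norm K (partials is f)"
    unfolding sup_norm_def by (intro cSUP_upper smooth_bdd_above assms)
  then show ?thesis using norm_ge_zero order_trans by blast
qed

lemma sup_norm_add:
  assumes "smooth f" "smooth g" "compact K" "K \<noteq> {}"
  shows "sup_norm K (partials is (\<lambda>x. f x + g x))
    \<le> sup_norm K (partials is f) + sup_norm K (partials is g)"
  unfolding sup_norm_def partials_add[OF assms(1,2)]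
  by (intro cSUP_least assms order_trans[OF norm_triangle_ineq] add_mono cSUP_upper
      smooth_bdd_above)

lemma sup_norm_scale:
  assumes "smooth f" "compact K" "K \<noteq> {}"
  shows "sup_norm K (partials is (\<lambda>x. c * f x)) \<le> norm c * sup_norm K (partials is f)"
  unfolding sup_norm_def partials_scale[OF assms(1)] norm_mult
  by (intro cSUP_least assms mult_left_mono cSUP_upper smooth_bdd_above) simp_all

lemma eventually_01: "eventually (\<lambda>\<epsilon>::real. \<epsilon> \<in> {0<..1}) (at_right 0)"
  using eventually_at_right_real[of 0 "1::real"] by (auto elim: eventually_mono)

lemma bigo_sup_norm_add:
  assumes "smooth_net u" "smooth_net v" "compact K" "K \<noteq> {}"
    "(\<lambda>\<epsilon>. sup_norm K (partials is (u \<epsilon>))) \<in> O[at_right 0](k)"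
    "(\<lambda>\<epsilon>. sup_norm K (partials is (v \<epsilon>))) \<in> O[at_right 0](k)"
  shows "(\<lambda>\<epsilon>. sup_norm K (partials is (\<lambda>x. u \<epsilon> x + v \<epsilon> x))) \<in> O[at_right 0](k)"
proof (rule bigo_le_sum[OF assms(5,6)])
  show "\<forall>\<^sub>F \<epsilon> in at_right 0. \<bar>sup_norm K (partials is (\<lambda>x. u \<epsilon> x + v \<epsilon> x))\<bar>
     \<le> sup_norm K (partials is (u \<epsilon>)) + sup_norm K (partials is (v \<epsilon>))"
    using eventually_01
  proof eventually_elim
    case (elim \<epsilon>)
    then have "smooth (u \<epsilon>)" "smooth (v \<epsilon>)" using assms by (auto simp: smooth_net_def)
    then show ?case
      using sup_norm_add[of "u \<epsilon>" "v \<epsilon>" K "is"] assms(3,4)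
        sup_norm_nonneg[OF smooth_add, of "u \<epsilon>" "v \<epsilon>" K "is"] by simp
  qed
qed

lemma bigo_sup_norm_scale:
  assumes "smooth_net u" "compact K" "K \<noteq> {}"
    "(\<lambda>\<epsilon>. norm (c \<epsilon>)) \<in> O[at_right 0](\<lambda>\<epsilon>. \<epsilon> powr a)"
    "(\<lambda>\<epsilon>. sup_norm K (partials is (u \<epsilon>))) \<in> O[at_right 0](\<lambda>\<epsilon>. \<epsilon> powr b)"
  shows "(\<lambda>\<epsilon>. sup_norm K (partials is (\<lambda>x. c \<epsilon> * u \<epsilon> x))) \<in> O[at_right 0](\<lambda>\<epsilon>. \<epsilon> powr (a + b))"
proof (rule landau_o.big_mono[THEN landau_o.big_trans, OF _ bigo_powr_mult[OF assms(4,5)]])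
  show "\<forall>\<^sub>F \<epsilon> in at_right 0. norm (sup_norm K (partials is (\<lambda>x. c \<epsilon> * u \<epsilon> x)))
     \<le> norm (norm (c \<epsilon>) * sup_norm K (partials is (u \<epsilon>)))"
    using eventually_01
  proof eventually_elim
    case (elim \<epsilon>)
    then have "smooth (u \<epsilon>)" using assms by (auto simp: smooth_net_def)
    then show ?case
      using sup_norm_scale[of "u \<epsilon>" K "is" "c \<epsilon>"] assms(2,3)
        sup_norm_nonneg[OF smooth_scale, of "u \<epsilon>" K "is"] by simp
  qed
qed

lemma smooth_net_add: "smooth_net u \<Longrightarrow> smooth_net v \<Longrightarrow> smooth_net (\<lambda>\<epsilon> x. u \<epsilon> x + v \<epsilon> x)"
  by (simp add: smooth_net_def smooth_add)

lemma smooth_net_scale: "smooth_net u \<Longrightarrow> smooth_net (\<lambda>\<epsilon> x. c \<epsilon> * u \<epsilon> x)"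
  by (simp add: smooth_net_def smooth_scale)

lemma moderate_add:
  assumes "moderate_net u" "moderate_net v"
  shows "moderate_net (\<lambda>\<epsilon> x. u \<epsilon> x + v \<epsilon> x)"
  unfolding moderate_net_def
proof (intro conjI allI impI)
  show "smooth_net (\<lambda>\<epsilon> x. u \<epsilon> x + v \<epsilon> x)"
    using assms by (simp add: moderate_net_def smooth_net_add)
  fix K :: "(real^'a) set" and "is" assume K: "compact K \<and> K \<noteq> {}"
  from assms K obtain p q where pq: "p \<ge> 0" "q \<ge> 0"
    "(\<lambda>\<epsilon>. sup_norm K (partials is (u \<epsilon>))) \<in> O[at_right 0](\<lambda>\<epsilon>. \<epsilon> powr (- p))"
    "(\<lambda>\<epsilon>. sup_norm K (partials is (v \<epsilon>))) \<in> O[at_right 0](\<lambda>\<epsilon>. \<epsilon> powr (- q))"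
    unfolding moderate_net_def by blast
  have "(\<lambda>\<epsilon>. sup_norm K (partials is (\<lambda>x. u \<epsilon> x + v \<epsilon> x)))
      \<in> O[at_right 0](\<lambda>\<epsilon>. \<epsilon> powr (- max p q))"
    using assms K
    by (intro bigo_sup_norm_add landau_o.big_trans[OF pq(3) bigo_powr_mono]
        landau_o.big_trans[OF pq(4) bigo_powr_mono]) (auto simp: moderate_net_def)
  moreover have "max p q \<ge> 0" using pq by simp
  ultimately show "\<exists>p\<ge>0. (\<lambda>\<epsilon>. sup_norm K (partials is (\<lambda>x. u \<epsilon> x + v \<epsilon> x)))
      \<in> O[at_right 0](\<lambda>\<epsilon>. \<epsilon> powr (- p))" by blast
qed

lemma moderate_scale:
  assumes "moderate_number c" "moderate_net u"
  shows "moderate_net (\<lambda>\<epsilon> x. c \<epsilon> * u \<epsilon> x)"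
  unfolding moderate_net_def
proof (intro conjI allI impI)
  show "smooth_net (\<lambda>\<epsilon> x. c \<epsilon> * u \<epsilon> x)"
    using assms by (simp add: moderate_net_def smooth_net_scale)
  fix K :: "(real^'a) set" and "is" assume K: "compact K \<and> K \<noteq> {}"
  from assms K obtain p q where pq: "p \<ge> 0" "q \<ge> 0"
    "(\<lambda>\<epsilon>. norm (c \<epsilon>)) \<in> O[at_right 0](\<lambda>\<epsilon>. \<epsilon> powr (- p))"
    "(\<lambda>\<epsilon>. sup_norm K (partials is (u \<epsilon>))) \<in> O[at_right 0](\<lambda>\<epsilon>. \<epsilon> powr (- q))"
    unfolding moderate_net_def moderate_number_def by blast
  have "(\<lambda>\<epsilon>. sup_norm K (partials is (\<lambda>x. c \<epsilon> * u \<epsilon> x))) \<in> O[at_right 0](\<lambda>\<epsilon>. \<epsilon> powr (- p + - q))"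
    using assms K by (intro bigo_sup_norm_scale pq) (auto simp: moderate_net_def)
  moreover have eq: "- p + - q = - (p + q)" by simp
  ultimately have "(\<lambda>\<epsilon>. sup_norm K (partials is (\<lambda>x. c \<epsilon> * u \<epsilon> x)))
      \<in> O[at_right 0](\<lambda>\<epsilon>. \<epsilon> powr (- (p + q)))" unfolding eq by blast
  moreover have "p + q \<ge> 0" using pq by simp
  ultimately show "\<exists>p\<ge>0. (\<lambda>\<epsilon>. sup_norm K (partials is (\<lambda>x. c \<epsilon> * u \<epsilon> x)))
      \<in> O[at_right 0](\<lambda>\<epsilon>. \<epsilon> powr (- p))" by blast
qed

lemma negligible_add:
  assumes "negligible_net u" "negligible_net v"
  shows "negligible_net (\<lambda>\<epsilon> x. u \<epsilon> x + v \<epsilon> x)"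
  using assms unfolding negligible_net_def by (auto simp: smooth_net_add intro!: bigo_sup_norm_add)

lemma negligible_scale:
  assumes "moderate_number c" "negligible_net u"
  shows "negligible_net (\<lambda>\<epsilon> x. c \<epsilon> * u \<epsilon> x)"
  unfolding negligible_net_def
proof (intro conjI allI impI)
  show "smooth_net (\<lambda>\<epsilon> x. c \<epsilon> * u \<epsilon> x)"
    using assms by (simp add: negligible_net_def smooth_net_scale)
  fix K :: "(real^'a) set" and "is" and q :: real
  assume K: "compact K \<and> K \<noteq> {}" and q: "q \<ge> 0"
  from assms obtain p where p: "p \<ge> 0" "(\<lambda>\<epsilon>. norm (c \<epsilon>)) \<in> O[at_right 0](\<lambda>\<epsilon>. \<epsilon> powr (- p))"
    unfolding moderate_number_def by blast
  have "(\<lambda>\<epsilon>. sup_norm K (partials is (\<lambda>x. c \<epsilon> * u \<epsilon> x)))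
      \<in> O[at_right 0](\<lambda>\<epsilon>. \<epsilon> powr (- p + (p + q)))"
    using assms K q p by (intro bigo_sup_norm_scale p) (auto simp: negligible_net_def)
  then show "(\<lambda>\<epsilon>. sup_norm K (partials is (\<lambda>x. c \<epsilon> * u \<epsilon> x))) \<in> O[at_right 0](\<lambda>\<epsilon>. \<epsilon> powr q)"
    by simp
qed

lemma negligible_scale_number:
  assumes "negligible_number c" "moderate_net u"
  shows "negligible_net (\<lambda>\<epsilon> x. c \<epsilon> * u \<epsilon> x)"
  unfolding negligible_net_def
proof (intro conjI allI impI)
  show "smooth_net (\<lambda>\<epsilon> x. c \<epsilon> * u \<epsilon> x)"
    using assms by (simp add: moderate_net_def smooth_net_scale)
  fix K :: "(real^'a) set" and "is" and q :: real
  assume K: "compact K \<and> K \<noteq> {}" and q: "q \<ge> 0"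
  from assms K obtain p where p: "p \<ge> 0"
    "(\<lambda>\<epsilon>. sup_norm K (partials is (u \<epsilon>))) \<in> O[at_right 0](\<lambda>\<epsilon>. \<epsilon> powr (- p))"
    unfolding moderate_net_def by blast
  have "(\<lambda>\<epsilon>. sup_norm K (partials is (\<lambda>x. c \<epsilon> * u \<epsilon> x)))
      \<in> O[at_right 0](\<lambda>\<epsilon>. \<epsilon> powr ((p + q) + - p))"
    using assms K q p
    by (intro bigo_sup_norm_scale p) (auto simp: negligible_number_def moderate_net_def)
  then show "(\<lambda>\<epsilon>. sup_norm K (partials is (\<lambda>x. c \<epsilon> * u \<epsilon> x))) \<in> O[at_right 0](\<lambda>\<epsilon>. \<epsilon> powr q)"
    by simp
qed

lemma negligible_zero: "negligible_net (\<lambda>_ _. 0)"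
  by (auto simp: negligible_net_def smooth_net_def smooth_zero partials_zero sup_norm_def)

lemma negligible_imp_moderate:
  assumes "negligible_net u"
  shows "moderate_net u"
  unfolding moderate_net_def
proof (intro conjI allI impI)
  show "smooth_net u" using assms by (simp add: negligible_net_def)
  fix K :: "(real^'a) set" and "is" assume "compact K \<and> K \<noteq> {}"
  then have "(\<lambda>\<epsilon>. sup_norm K (partials is (u \<epsilon>))) \<in> O[at_right 0](\<lambda>\<epsilon>. \<epsilon> powr (- 0))"
    using assms unfolding negligible_net_def by (metis minus_zero order_refl)
  then show "\<exists>p\<ge>0. (\<lambda>\<epsilon>. sup_norm K (partials is (u \<epsilon>))) \<in> O[at_right 0](\<lambda>\<epsilon>. \<epsilon> powr (- p))"
    by blast
qed

lemmas moderate_zero = negligible_imp_moderate[OF negligible_zero]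

lemma moderate_uminus: "moderate_net u \<Longrightarrow> moderate_net (\<lambda>\<epsilon> x. - u \<epsilon> x)"
  using moderate_scale[OF moderate_number_const[of "-1"]] by simp

lemma negligible_uminus: "negligible_net u \<Longrightarrow> negligible_net (\<lambda>\<epsilon> x. - u \<epsilon> x)"
  using negligible_scale[OF moderate_number_const[of "-1"]] by simp

lemma smooth_net_partial_deriv:
  "smooth_net u \<Longrightarrow> smooth_net (\<lambda>\<epsilon>. partial_deriv i (u \<epsilon>))"
  by (simp add: smooth_net_def smooth_partial_deriv)

lemma moderate_partial_deriv:
  assumes "moderate_net u"
  shows "moderate_net (\<lambda>\<epsilon>. partial_deriv i (u \<epsilon>))"
  unfolding moderate_net_def partials.simps(2)[symmetric]
  using assms smooth_net_partial_deriv unfolding moderate_net_def by blast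

lemma negligible_partial_deriv:
  assumes "negligible_net u"
  shows "negligible_net (\<lambda>\<epsilon>. partial_deriv i (u \<epsilon>))"
  unfolding negligible_net_def partials.simps(2)[symmetric]
  using assms smooth_net_partial_deriv unfolding negligible_net_def by blast

lemma negligible_cong:
  assumes "negligible_net u" "\<And>\<epsilon>. \<epsilon> \<in> {0<..1} \<Longrightarrow> u \<epsilon> = v \<epsilon>"
  shows "negligible_net v"
  unfolding negligible_net_def
proof (intro conjI allI impI)
  show "smooth_net v" using assms by (simp add: negligible_net_def smooth_net_def)
  fix K :: "(real^'a) set" and "is" and q :: real
  assume "compact K \<and> K \<noteq> {}" "q \<ge> 0"
  then have "(\<lambda>\<epsilon>. sup_norm K (partials is (u \<epsilon>))) \<in> O[at_right 0](\<lambda>\<epsilon>. \<epsilon> powr q)"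
    using assms by (simp add: negligible_net_def)
  moreover have eq: "eventually (\<lambda>\<epsilon>. sup_norm K (partials is (u \<epsilon>)) = sup_norm K (partials is (v \<epsilon>)))
      (at_right 0)"
    using eventually_01 by eventually_elim (simp add: assms(2))
  ultimately show "(\<lambda>\<epsilon>. sup_norm K (partials is (v \<epsilon>))) \<in> O[at_right 0](\<lambda>\<epsilon>. \<epsilon> powr q)"
    using landau_o.big.in_cong[OF eq] by simp
qed

text \<open>\<open>'n colombeau\<close> is the Colombeau algebra on \<open>\<real>\<^sup>n\<close> with \<open>n = CARD('n)\<close>. Only its structure as a
  differential module over \<^typ>\<open>complex gnum\<close> is set up, which is what differential operators
  with constant generalized coefficients require.\<close>

quotient_type 'n colombeau = "real \<Rightarrow> real^('n::finite) \<Rightarrow> complex" / partial: net_rel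
proof (rule part_equivpI)
  show "\<exists>x::real \<Rightarrow> real^'n \<Rightarrow> complex. net_rel x x"
    by (rule exI[of _ "\<lambda>_ _. 0"]) (simp add: net_rel_def moderate_zero negligible_zero)
  show "symp (net_rel :: (real \<Rightarrow> real^'n \<Rightarrow> complex) \<Rightarrow> _)"
  proof (rule sympI)
    fix u v :: "real \<Rightarrow> real^'n \<Rightarrow> complex" assume "net_rel u v"
    then show "net_rel v u"
      using negligible_uminus[of "\<lambda>\<epsilon> x. u \<epsilon> x - v \<epsilon> x"] by (simp add: net_rel_def)
  qed
  show "transp (net_rel :: (real \<Rightarrow> real^'n \<Rightarrow> complex) \<Rightarrow> _)"
  proof (rule transpI)
    fix u v w :: "real \<Rightarrow> real^'n \<Rightarrow> complex" assume "net_rel u v" "net_rel v w"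
    then show "net_rel u w"
      using negligible_add[of "\<lambda>\<epsilon> x. u \<epsilon> x - v \<epsilon> x" "\<lambda>\<epsilon> x. v \<epsilon> x - w \<epsilon> x"]
      by (simp add: net_rel_def)
  qed
qed

instantiation colombeau :: (finite) ab_group_add
begin

lift_definition zero_colombeau :: "'a colombeau" is "\<lambda>_ _. 0"
  by (simp add: net_rel_def moderate_zero negligible_zero)

lift_definition uminus_colombeau :: "'a colombeau \<Rightarrow> 'a colombeau" is "\<lambda>u \<epsilon> x. - u \<epsilon> x"
proof -
  fix u v :: "real \<Rightarrow> real^'a \<Rightarrow> complex" assume "net_rel u v"
  then show "net_rel (\<lambda>\<epsilon> x. - u \<epsilon> x) (\<lambda>\<epsilon> x. - v \<epsilon> x)"
    using negligible_uminus[of "\<lambda>\<epsilon> x. u \<epsilon> x - v \<epsilon> x"] by (simp add: net_rel_def moderate_uminus)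
qed

lift_definition plus_colombeau :: "'a colombeau \<Rightarrow> 'a colombeau \<Rightarrow> 'a colombeau"
  is "\<lambda>u v \<epsilon> x. u \<epsilon> x + v \<epsilon> x"
proof -
  fix u u' v v' :: "real \<Rightarrow> real^'a \<Rightarrow> complex" assume "net_rel u u'" "net_rel v v'"
  then show "net_rel (\<lambda>\<epsilon> x. u \<epsilon> x + v \<epsilon> x) (\<lambda>\<epsilon> x. u' \<epsilon> x + v' \<epsilon> x)"
    using negligible_add[of "\<lambda>\<epsilon> x. u \<epsilon> x - u' \<epsilon> x" "\<lambda>\<epsilon> x. v \<epsilon> x - v' \<epsilon> x"]
    by (simp add: net_rel_def moderate_add add_diff_add)
qed

definition minus_colombeau :: "'a colombeau \<Rightarrow> 'a colombeau \<Rightarrow> 'a colombeau" where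
  "minus_colombeau u v = u + (- v)"

instance
proof
  fix a b c :: "'a colombeau"
  show "a + b + c = a + (b + c)"
    by transfer (simp add: net_rel_def moderate_add negligible_zero add.assoc)
  show "a + b = b + a"
    by transfer (simp add: net_rel_def moderate_add negligible_zero add.commute)
  show "0 + a = a" by transfer (simp add: net_rel_def)
  show "- a + a = 0" by transfer (simp add: net_rel_def moderate_zero negligible_zero)
  show "a - b = a + - b" by (simp add: minus_colombeau_def)
qed

end

lift_definition gscale :: "complex gnum \<Rightarrow> 'n::finite colombeau \<Rightarrow> 'n colombeau"
  is "\<lambda>c u \<epsilon> x. c \<epsilon> * u \<epsilon> x"
proof -
  fix c d :: "real \<Rightarrow> complex" and u v :: "real \<Rightarrow> real^'n \<Rightarrow> complex"
  assume a: "number_rel c d" "net_rel u v"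
  then have "negligible_net (\<lambda>\<epsilon> x. (c \<epsilon> - d \<epsilon>) * u \<epsilon> x + d \<epsilon> * (u \<epsilon> x - v \<epsilon> x))"
    unfolding number_rel_def net_rel_def
    by (intro negligible_add negligible_scale_number negligible_scale) auto
  moreover have "(\<lambda>\<epsilon> x. (c \<epsilon> - d \<epsilon>) * u \<epsilon> x + d \<epsilon> * (u \<epsilon> x - v \<epsilon> x))
      = (\<lambda>\<epsilon> x. c \<epsilon> * u \<epsilon> x - d \<epsilon> * v \<epsilon> x)" by (simp add: algebra_simps)
  ultimately show "net_rel (\<lambda>\<epsilon> x. c \<epsilon> * u \<epsilon> x) (\<lambda>\<epsilon> x. d \<epsilon> * v \<epsilon> x)"
    using a by (simp add: number_rel_def net_rel_def moderate_scale)
qed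

lift_definition gD :: "'n::finite \<Rightarrow> 'n colombeau \<Rightarrow> 'n colombeau"
  is "\<lambda>j u \<epsilon> x. - \<i> * partial_deriv j (u \<epsilon>) x"
proof -
  fix j and u v :: "real \<Rightarrow> real^'n \<Rightarrow> complex"
  assume a: "net_rel u v"
  note s = moderate_number_const[of "- \<i>"]
  have "negligible_net (\<lambda>\<epsilon>. partial_deriv j (\<lambda>x. u \<epsilon> x - v \<epsilon> x))"
    using a by (intro negligible_partial_deriv) (simp add: net_rel_def)
  from negligible_scale[OF s this]
  have "negligible_net (\<lambda>\<epsilon> x. - \<i> * partial_deriv j (u \<epsilon>) x - - \<i> * partial_deriv j (v \<epsilon>) x)"
  proof (rule negligible_cong)
    fix \<epsilon> :: real assume "\<epsilon> \<in> {0<..1}"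
    with a have uv: "smooth (u \<epsilon>)" "smooth (v \<epsilon>)"
      by (auto simp: net_rel_def moderate_net_def smooth_net_def)
    have "partial_deriv j (\<lambda>x. u \<epsilon> x + (- 1) * v \<epsilon> x)
        = (\<lambda>x. partial_deriv j (u \<epsilon>) x + (- 1) * partial_deriv j (v \<epsilon>) x)"
      using uv by (simp only: partial_deriv_add smooth_scale partial_deriv_scale)
    then show "(\<lambda>x. - \<i> * partial_deriv j (\<lambda>x. u \<epsilon> x - v \<epsilon> x) x)
        = (\<lambda>x. - \<i> * partial_deriv j (u \<epsilon>) x - - \<i> * partial_deriv j (v \<epsilon>) x)"
      by (simp add: algebra_simps)
  qed
  moreover have "moderate_net (\<lambda>\<epsilon> x. - \<i> * partial_deriv j (u \<epsilon>) x)"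
    "moderate_net (\<lambda>\<epsilon> x. - \<i> * partial_deriv j (v \<epsilon>) x)"
    using a by (auto intro!: moderate_scale[OF s] moderate_partial_deriv simp only: net_rel_def)
  ultimately show "net_rel (\<lambda>\<epsilon> x. - \<i> * partial_deriv j (u \<epsilon>) x)
      (\<lambda>\<epsilon> x. - \<i> * partial_deriv j (v \<epsilon>) x)"
    by (simp only: net_rel_def)
qed

definition G_infty :: "'n::finite colombeau set" where
  "G_infty = {abs_colombeau u | u. moderate_net u \<and> regular_net u}"


section \<open>Second order operators\<close>

text \<open>\<open>P(D)\<close> with \<open>A\<close> the matrix of the second order coefficients.\<close>

definition second_order_op ::
  "real gnum^'n^'n \<Rightarrow> complex gnum^'n \<Rightarrow> complex gnum \<Rightarrow> 'n::finite colombeau \<Rightarrow> 'n colombeau" where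
  "second_order_op A b c u =
     (\<Sum>i\<in>UNIV. \<Sum>j\<in>UNIV. gscale (gcomplex (A $ i $ j)) (gD i (gD j u)))
     + (\<Sum>j\<in>UNIV. gscale (b $ j) (gD j u)) + gscale c u"

text \<open>\<open>l\<close> enumerates the roots of the characteristic polynomial of \<open>M\<close> with multiplicity.\<close>

definition eigenvalues_of :: "real^'n^'n \<Rightarrow> real^'n \<Rightarrow> bool" where
  "eigenvalues_of M l \<longleftrightarrow> (\<forall>t. det (mat t - M) = (\<Prod>i\<in>UNIV. t - l $ i))"

text \<open>\<open>lam\<close> is obtained from the eigenvalues of symmetric representatives at fixed \<open>\<epsilon>\<close>. They may
  be enumerated in any order for each \<open>\<epsilon>\<close>.\<close>

definition gen_eigenvalues :: "real gnum^'n^'n \<Rightarrow> real gnum^'n \<Rightarrow> bool" where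
  "gen_eigenvalues A lam \<longleftrightarrow>
     (\<exists>(M :: real \<Rightarrow> real^'n^'n) (l :: real \<Rightarrow> real^'n).
        (\<forall>i j. represents (\<lambda>\<epsilon>. M \<epsilon> $ i $ j) (A $ i $ j)) \<and>
        (\<forall>\<epsilon>\<in>{0<..1}. transpose (M \<epsilon>) = M \<epsilon> \<and> eigenvalues_of (M \<epsilon>) (l \<epsilon>)) \<and>
        (\<forall>i. represents (\<lambda>\<epsilon>. l \<epsilon> $ i) (lam $ i)))"

definition G_elliptic :: "real gnum^'n^'n \<Rightarrow> bool" where
  "G_elliptic A \<longleftrightarrow> transpose A = A \<and>
     (\<forall>lam. gen_eigenvalues A lam \<longrightarrow> (\<forall>i. gnonneg (lam $ i) \<and> lam $ i dvd 1))"

definition diag :: "'a::zero^'n \<Rightarrow> 'a^'n^'n" where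
  "diag v = (\<chi> i j. if i = j then v $ i else 0)"

definition op_beta :: "real gnum^'n^'n \<Rightarrow> complex gnum^'n \<Rightarrow> complex gnum^'n" where
  "op_beta Q b = (\<chi> i. \<Sum>j\<in>UNIV. gcomplex (Q $ i $ j) * b $ j)"

definition op_gamma ::
  "real gnum^'n^'n \<Rightarrow> real gnum^'n \<Rightarrow> complex gnum^'n \<Rightarrow> complex gnum \<Rightarrow> complex gnum" where
  "op_gamma Q lam b c =
     c - (\<Sum>j\<in>UNIV. (op_beta Q b $ j)\<^sup>2 / (4 * gcomplex (lam $ j)))"

text \<open>Only used for \<open>\<gamma>\<close> zero or invertible.\<close>

definition lam_tilde :: "real gnum^'n \<Rightarrow> complex gnum \<Rightarrow> real gnum^'n" where
  "lam_tilde lam \<gamma> = (\<chi> i. if \<gamma> = 0 then lam $ i else lam $ i / gabs \<gamma>)"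

end

theory Submission
  imports Defs "HOL-Real_Asymp.Real_Asymp"
begin

text \<open>Write \<open>L = \<Sum>k. \<mu>\<^sub>k X\<^sub>k\<^sup>2\<close> for the principal part divided by \<open>|\<gamma>|\<close> (or by \<open>1\<close> if \<open>\<gamma> = 0\<close>), where
  \<open>X\<^sub>k\<close> is differentiation along the \<open>k\<close>-th row of \<open>Q\<close>. Log-type numbers are slow scale, and
  \<open>\<beta>\<^sub>k / |\<gamma>| = (\<beta>\<^sub>k / \<lambda>\<^sub>k) \<mu>\<^sub>k\<close>, so all coefficients of the normalized equation, as well as
  \<open>1 / \<mu>\<^sub>k\<close>, are slow scale. For fixed \<open>\<epsilon>\<close> the maximum principle, applied to Bernstein's function
  \<open>\<phi>\<^sup>2 |\<nabla>w|\<^sup>2 + M |w|\<^sup>2\<close> with \<open>\<phi> x = R\<^sup>2 - |x|\<^sup>2\<close>, bounds \<open>|\<nabla>w|\<close> on smaller balls by a fixed power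
  of the size of the coefficients times a bound for \<open>w\<close>, the right-hand side and its gradient. Every
  derivative of the solution satisfies the same equation with the corresponding derivative of the
  right-hand side, so the bound iterates. Each step costs only a slow scale factor, hence an
  arbitrarily small power of \<open>1 / \<epsilon>\<close>, and the exponent of the solution does not grow with the order
  of differentiation.\<close>

section \<open>Derivatives along lines\<close>

text \<open>For each partial derivative V of w, the second derivative test yields two copies of
  \<open>\<phi>^2 \<mu>\<^sub>k |X\<^sub>k V|^2\<close>. One absorbs the cross terms produced by the
  cutoff, the other the first order terms of the differentiated equation. Multiples of |\<nabla>w|^2
  are left over; M |w|^2 is added because L |w|^2 contains
  \<open>2 \<mu>\<^sub>k |X\<^sub>k w|^2\<close>, which pays for them. Dividing by |\<gamma>| serves
  the zeroth order term: it becomes \<gamma>/|\<gamma>| (or 0) plus a sum of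
  \<open>(\<beta>\<^sub>k / \<lambda>\<^sub>k)^2 \<mu>\<^sub>k / 4\<close>. An obstacle is that
  identities between generalized numbers hold for representatives only up to negligible errors; in
  particular a representative of Q is only nearly orthogonal. The normalized coefficients are
  therefore assembled from representatives of Q, the eigenvalues and the normalizing factor, so that
  the principal part is a weighted sum of squares exactly, for every \<epsilon>. Near orthogonality
  suffices to compare |\<nabla>w|^2 with the sum of \<open>|X\<^sub>k w|^2\<close>.\<close>

lemma second_derivative_at_local_max:
  fixes g :: "real \<Rightarrow> real"
  assumes g: "\<And>t. (g has_real_derivative g' t) (at t)"
    and g': "(g' has_real_derivative g'') (at a)"
    and max: "eventually (\<lambda>t. g t \<le> g a) (at a)"
  shows "g'' \<le> 0"
proof (rule ccontr)
  assume "\<not> g'' \<le> 0"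
  obtain d where d: "d > 0" "\<And>t. t \<noteq> a \<Longrightarrow> dist t a < d \<Longrightarrow> g t \<le> g a"
    using max unfolding eventually_at by auto
  have "g t \<le> g a" if "\<bar>a - t\<bar> < d" for t
    using d(2)[of t] that by (cases "t = a") (auto simp: dist_real_def)
  note d = d(1) this
  \<comment> \<open>A positive derivative of \<open>g'\<close> at its zero \<open>a\<close> makes
    \<open>g'\<close> positive just to the right of \<open>a\<close>, so \<open>g\<close> would
    increase there.\<close>
  have "g' a = 0" using DERIV_local_max[OF g] d by blast
  moreover obtain e where e: "e > 0" "\<And>h. h > 0 \<Longrightarrow> h < e \<Longrightarrow> g' a < g' (a + h)"
    using DERIV_pos_inc_right[OF g'] \<open>\<not> g'' \<le> 0\<close> by force
  moreover define h where "h = min d e / 2"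
  ultimately have h: "0 < h" "h < d" "h < e" using d by (auto simp: h_def min_def)
  obtain z where z: "a < z" "z < a + h" "g (a + h) - g a = h * g' z"
    using MVT2[of a "a + h" g g'] g h by auto
  have "g' z > 0" using e(2)[of "z - a"] z h \<open>g' a = 0\<close> by simp
  then have "h * g' z > 0" using h by simp
  then have "g (a + h) > g a" using z by simp
  then show False using d(2)[of "a + h"] h by simp
qed

section \<open>Directional derivatives and the symmetry of mixed derivatives\<close>

lemma smooth_sum: "(\<And>i. i \<in> I \<Longrightarrow> smooth (f i)) \<Longrightarrow> smooth (\<lambda>x. \<Sum>i\<in>I. f i x)"
  by (induction I rule: infinite_finite_induct) (auto simp: smooth_zero smooth_add)

lemma partial_deriv_zero: "partial_deriv i (\<lambda>_. 0) = (\<lambda>_. 0)"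
  using partials_zero[of "[i]"] by simp

lemma partial_deriv_sum:
  "(\<And>i. i \<in> I \<Longrightarrow> smooth (f i)) \<Longrightarrow>
    partial_deriv l (\<lambda>x. \<Sum>i\<in>I. f i x) = (\<lambda>x. \<Sum>i\<in>I. partial_deriv l (f i) x)"
  by (induction I rule: infinite_finite_induct)
    (auto simp: partial_deriv_zero partial_deriv_add smooth_sum)

text \<open>Written with partial derivatives so that smoothness passes through finite sums. The
  direction is not normalized: rows of a representative of an orthogonal matrix need not be unit
  vectors.\<close>

definition dir_deriv :: "real^'n \<Rightarrow> (real^'n::finite \<Rightarrow> complex) \<Rightarrow> real^'n \<Rightarrow> complex" where
  "dir_deriv q g x = (\<Sum>j\<in>UNIV. of_real (q $ j) * partial_deriv j g x)"

lemma smooth_dir_deriv: "smooth g \<Longrightarrow> smooth (dir_deriv q g)"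
  unfolding dir_deriv_def[abs_def] by (intro smooth_sum smooth_scale smooth_partial_deriv)

lemma dir_deriv_axis: "dir_deriv (axis i 1) g = partial_deriv i g"
proof
  fix x
  have "dir_deriv (axis i 1) g x = (\<Sum>j\<in>UNIV. if j = i then partial_deriv j g x else 0)"
    unfolding dir_deriv_def by (intro sum.cong) (auto simp: axis_def)
  then show "dir_deriv (axis i 1) g x = partial_deriv i g x" by simp
qed

lemma smooth_has_vector_derivative_line:
  fixes g :: "real^'n::finite \<Rightarrow> complex"
  assumes "smooth g"
  shows "((\<lambda>t. g (x + t *\<^sub>R q)) has_vector_derivative dir_deriv q g (x + t *\<^sub>R q)) (at t)"
proof -
  define D where "D = frechet_derivative g (at (x + t *\<^sub>R q))"
  have D: "(g has_derivative D) (at (x + t *\<^sub>R q))"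
    using assms smooth_imp_differentiable frechet_derivative_works unfolding D_def by blast
  then have lin: "linear D" by (rule has_derivative_linear)
  have "(\<Sum>j\<in>UNIV. (q $ j) *\<^sub>R axis j 1) = q"
    by (simp add: basis_expansion flip: scalar_mult_eq_scaleR)
  then have "D q = D (\<Sum>j\<in>UNIV. (q $ j) *\<^sub>R axis j 1)"
    by simp
  also have "\<dots> = dir_deriv q g (x + t *\<^sub>R q)"
    unfolding dir_deriv_def partial_deriv_def D_def[symmetric]
    by (simp only: linear_sum[OF lin] linear_scale[OF lin] o_def) (simp add: scaleR_conv_of_real)
  finally have Dq: "D q = dir_deriv q g (x + t *\<^sub>R q)" .
  have "((\<lambda>t. x + t *\<^sub>R q) has_derivative (\<lambda>t. t *\<^sub>R q)) (at t)"
    by (auto intro!: derivative_eq_intros)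
  from has_derivative_compose[OF this D]
  show ?thesis unfolding has_vector_derivative_def by (simp add: linear_scale[OF lin] Dq)
qed

text \<open>The mean value theorem is applied twice to the second difference, along \<open>p\<close>
  and then along \<open>q\<close>. It fails for complex values, hence the real functional
  \<open>T\<close>, later the real or the imaginary part.\<close>

lemma mixed_difference_mean_value:
  fixes g :: "real^'n::finite \<Rightarrow> complex" and x p q :: "real^'n"
  assumes g: "smooth g" and T: "bounded_linear (T :: complex \<Rightarrow> real)" and h: "h > 0"
  shows "\<exists>s\<in>{0..h}. \<exists>t\<in>{0..h}.
    T (g (x + h *\<^sub>R p + h *\<^sub>R q) - g (x + h *\<^sub>R p) - g (x + h *\<^sub>R q) + g x)
      = h\<^sup>2 * T (dir_deriv q (dir_deriv p g) (x + s *\<^sub>R p + t *\<^sub>R q))"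
proof -
  interpret T: bounded_linear T by (rule T)
  have D: "((\<lambda>t. T (G (y + t *\<^sub>R r))) has_real_derivative T (dir_deriv r G (y + t *\<^sub>R r))) (at t)"
    if "smooth G" for G t r y
    using T.has_vector_derivative[OF smooth_has_vector_derivative_line[OF that]]
    by (simp add: has_real_derivative_iff_has_vector_derivative)
  define \<phi> where "\<phi> s = T (g ((x + h *\<^sub>R q) + s *\<^sub>R p)) - T (g (x + s *\<^sub>R p))" for s
  define \<phi>' where "\<phi>' s = T (dir_deriv p g ((x + h *\<^sub>R q) + s *\<^sub>R p)) - T (dir_deriv p g (x + s *\<^sub>R p))" for s
  have "(\<phi> has_real_derivative \<phi>' s) (at s)" for s
    unfolding \<phi>_def[abs_def] \<phi>'_def by (intro DERIV_diff D g)
  then obtain s where s: "0 < s" "s < h" "\<phi> h - \<phi> 0 = h * \<phi>' s"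
    using MVT2[of 0 h \<phi> \<phi>'] h by auto
  obtain t where t: "0 < t" "t < h"
    "T (dir_deriv p g ((x + s *\<^sub>R p) + h *\<^sub>R q)) - T (dir_deriv p g ((x + s *\<^sub>R p) + 0 *\<^sub>R q))
      = h * T (dir_deriv q (dir_deriv p g) ((x + s *\<^sub>R p) + t *\<^sub>R q))"
    using MVT2[OF h D[OF smooth_dir_deriv[OF g]], of p "x + s *\<^sub>R p" q] by auto
  have "\<phi>' s = h * T (dir_deriv q (dir_deriv p g) ((x + s *\<^sub>R p) + t *\<^sub>R q))"
    using t(3) by (simp add: \<phi>'_def algebra_simps)
  moreover have "T (g (x + h *\<^sub>R p + h *\<^sub>R q) - g (x + h *\<^sub>R p) - g (x + h *\<^sub>R q) + g x) = \<phi> h - \<phi> 0"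
    by (simp add: \<phi>_def T.diff T.add algebra_simps)
  ultimately show ?thesis using s t
    by (intro bexI[of _ s] bexI[of _ t]) (auto simp: power2_eq_square)
qed

lemma smooth_continuous: "smooth g \<Longrightarrow> continuous (at x) g"
  by (rule differentiable_imp_continuous_within[OF smooth_imp_differentiable])

text \<open>The second difference is symmetric in \<open>p\<close> and \<open>q\<close>. Divided by
  \<open>h\<^sup>2\<close> it equals \<open>T\<close> of either mixed derivative at points near
  \<open>x\<close>, and continuity at \<open>x\<close> identifies the two limits.\<close>

lemma dir_deriv_commute:
  fixes g :: "real^'n::finite \<Rightarrow> complex"
  assumes g: "smooth g"
  shows "dir_deriv q (dir_deriv p g) x = dir_deriv p (dir_deriv q g) x"
proof -
  \<comment> \<open>The intermediate points depend on \<open>h\<close> without any control except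
    that their parameters lie in \<open>{0..h}\<close>; this already forces them to converge to
    \<open>x\<close>.\<close>
  have lim: "((\<lambda>h. T (G (x + s h *\<^sub>R p + t h *\<^sub>R q))) \<longlongrightarrow> T (G x)) (at_right 0)"
    if "smooth G" "bounded_linear T" and st: "\<And>h. h > 0 \<Longrightarrow> s h \<in> {0..h} \<and> t h \<in> {0..h}"
    for G p q s t and T :: "complex \<Rightarrow> real"
  proof -
    have z: "(r \<longlongrightarrow> 0) (at_right 0)" if "\<And>h. h > 0 \<Longrightarrow> r h \<in> {0..h}" for r :: "real \<Rightarrow> real"
    proof (rule tendsto_sandwich[OF _ _ tendsto_const tendsto_ident_at])
      show "eventually (\<lambda>h. 0 \<le> r h) (at_right 0)" "eventually (\<lambda>h. r h \<le> h) (at_right 0)"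
        using that by (auto intro: eventually_mono[OF eventually_at_right_less])
    qed
    have "((\<lambda>h. x + s h *\<^sub>R p + t h *\<^sub>R q) \<longlongrightarrow> x + 0 *\<^sub>R p + 0 *\<^sub>R q) (at_right 0)"
      using st by (intro tendsto_intros z) auto
    then have "((\<lambda>h. G (x + s h *\<^sub>R p + t h *\<^sub>R q)) \<longlongrightarrow> G x) (at_right 0)"
      using isCont_tendsto_compose[OF smooth_continuous[OF \<open>smooth G\<close>]] by simp
    then show ?thesis by (rule bounded_linear.tendsto[OF \<open>bounded_linear T\<close>])
  qed
  have "T (dir_deriv q (dir_deriv p g) x) = T (dir_deriv p (dir_deriv q g) x)"
    if T: "bounded_linear T" for T :: "complex \<Rightarrow> real"
  proof -
    have ex: "\<exists>r. \<forall>h>0. fst (r h) \<in> {0..h} \<and> snd (r h) \<in> {0..h} \<and>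
      T (g (x + h *\<^sub>R a + h *\<^sub>R b) - g (x + h *\<^sub>R a) - g (x + h *\<^sub>R b) + g x)
      = h\<^sup>2 * T (dir_deriv b (dir_deriv a g) (x + fst (r h) *\<^sub>R a + snd (r h) *\<^sub>R b))"
      (is "\<exists>r. \<forall>h>0. ?P h (r h)") for a b
    proof (rule choice, rule allI)
      fix h
      show "\<exists>r. h > 0 \<longrightarrow> ?P h r"
      proof (cases "h > 0")
        case True
        then obtain s t where "?P h (s, t)"
          using mixed_difference_mean_value[OF g T True, of x a b] by auto
        then show ?thesis by blast
      qed simp
    qed
    obtain r where 1: "\<forall>h>0. fst (r h) \<in> {0..h} \<and> snd (r h) \<in> {0..h} \<and>
      T (g (x + h *\<^sub>R p + h *\<^sub>R q) - g (x + h *\<^sub>R p) - g (x + h *\<^sub>R q) + g x)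
      = h\<^sup>2 * T (dir_deriv q (dir_deriv p g) (x + fst (r h) *\<^sub>R p + snd (r h) *\<^sub>R q))"
      using ex by blast
    obtain r' where 2: "\<forall>h>0. fst (r' h) \<in> {0..h} \<and> snd (r' h) \<in> {0..h} \<and>
      T (g (x + h *\<^sub>R q + h *\<^sub>R p) - g (x + h *\<^sub>R q) - g (x + h *\<^sub>R p) + g x)
      = h\<^sup>2 * T (dir_deriv p (dir_deriv q g) (x + fst (r' h) *\<^sub>R q + snd (r' h) *\<^sub>R p))"
      using ex by blast
    define s t s' t' where "s h = fst (r h)" and "t h = snd (r h)"
      and "s' h = fst (r' h)" and "t' h = snd (r' h)" for h
    note 1 = 1[folded s_def t_def] and 2 = 2[folded s'_def t'_def]
    have eq: "T (dir_deriv q (dir_deriv p g) (x + s h *\<^sub>R p + t h *\<^sub>R q))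
        = T (dir_deriv p (dir_deriv q g) (x + s' h *\<^sub>R q + t' h *\<^sub>R p))" if "h > 0" for h
    proof -
      have "g (x + h *\<^sub>R q + h *\<^sub>R p) - g (x + h *\<^sub>R q) - g (x + h *\<^sub>R p) + g x
        = g (x + h *\<^sub>R p + h *\<^sub>R q) - g (x + h *\<^sub>R p) - g (x + h *\<^sub>R q) + g x"
        by (simp add: algebra_simps)
      then have "h\<^sup>2 * T (dir_deriv q (dir_deriv p g) (x + s h *\<^sub>R p + t h *\<^sub>R q))
        = h\<^sup>2 * T (dir_deriv p (dir_deriv q g) (x + s' h *\<^sub>R q + t' h *\<^sub>R p))"
        using 1[rule_format, OF that] 2[rule_format, OF that] by metis
      then show ?thesis using that by simp
    qed
    have "((\<lambda>h. T (dir_deriv p (dir_deriv q g) (x + s' h *\<^sub>R q + t' h *\<^sub>R p)))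
        \<longlongrightarrow> T (dir_deriv q (dir_deriv p g) x)) (at_right 0)"
    proof (rule Lim_transform_eventually)
      show "((\<lambda>h. T (dir_deriv q (dir_deriv p g) (x + s h *\<^sub>R p + t h *\<^sub>R q)))
        \<longlongrightarrow> T (dir_deriv q (dir_deriv p g) x)) (at_right 0)"
        using 1 by (intro lim T smooth_dir_deriv g) auto
      show "eventually (\<lambda>h. T (dir_deriv q (dir_deriv p g) (x + s h *\<^sub>R p + t h *\<^sub>R q))
        = T (dir_deriv p (dir_deriv q g) (x + s' h *\<^sub>R q + t' h *\<^sub>R p))) (at_right 0)"
        using eq by (rule eventually_mono[OF eventually_at_right_less])
    qed
    moreover have "((\<lambda>h. T (dir_deriv p (dir_deriv q g) (x + s' h *\<^sub>R q + t' h *\<^sub>R p)))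
        \<longlongrightarrow> T (dir_deriv p (dir_deriv q g) x)) (at_right 0)"
      using 2 by (intro lim T smooth_dir_deriv g) auto
    ultimately show ?thesis by (rule tendsto_unique[rotated]) simp
  qed
  from this[OF bounded_linear_Re] this[OF bounded_linear_Im] show ?thesis
    by (simp add: complex_eq_iff)
qed


section \<open>The Bernstein gradient estimate\<close>

lemma has_real_derivative_inner:
  fixes f g :: "real \<Rightarrow> 'a::real_inner"
  assumes "(f has_vector_derivative f') (at t)" "(g has_vector_derivative g') (at t)"
    "D = f t \<bullet> g' + f' \<bullet> g t"
  shows "((\<lambda>t. f t \<bullet> g t) has_real_derivative D) (at t)"
proof -
  have "((\<lambda>t. f t \<bullet> g t) has_derivative (\<lambda>h. f t \<bullet> (h *\<^sub>R g') + (h *\<^sub>R f') \<bullet> g t)) (at t)"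
    using has_derivative_inner[OF assms(1,2)[unfolded has_vector_derivative_def]] .
  then show ?thesis
    by (rule has_derivative_imp_has_field_derivative) (simp add: assms(3) algebra_simps)
qed

text \<open>The left-hand side is the second derivative of the Bernstein function along \<open>q\<close> at its
  maximum \<open>x\<close>.\<close>

lemma second_derivative_at_max:
  fixes w :: "real^'n::finite \<Rightarrow> complex" and q x :: "real^'n"
  assumes w: "smooth w" and x: "norm x < R"
    and max: "\<And>y. norm y \<le> R \<Longrightarrow>
      (\<Sum>j\<in>UNIV. (R\<^sup>2 - y \<bullet> y)\<^sup>2 * (partial_deriv j w y \<bullet> partial_deriv j w y)) + M * (w y \<bullet> w y)
      \<le> (\<Sum>j\<in>UNIV. (R\<^sup>2 - x \<bullet> x)\<^sup>2 * (partial_deriv j w x \<bullet> partial_deriv j w x)) + M * (w x \<bullet> w x)"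
    and p: "p = R\<^sup>2 - x \<bullet> x" "p' = - 2 * (q \<bullet> x)" "p'' = - 2 * (q \<bullet> q)"
    and V: "\<And>j. V j = partial_deriv j w x" "\<And>j. V' j = dir_deriv q (partial_deriv j w) x"
      "\<And>j. V'' j = dir_deriv q (dir_deriv q (partial_deriv j w)) x"
    and W: "W = w x" "W' = dir_deriv q w x" "W'' = dir_deriv q (dir_deriv q w) x"
  shows "(\<Sum>j\<in>UNIV. 2 * (p'\<^sup>2 + p * p'') * (V j \<bullet> V j) + 8 * p * p' * (V j \<bullet> V' j)
      + 2 * p\<^sup>2 * (V' j \<bullet> V' j + V j \<bullet> V'' j)) + 2 * M * (W' \<bullet> W' + W \<bullet> W'') \<le> 0"
proof -
  define P where "P t = R\<^sup>2 - (x + t *\<^sub>R q) \<bullet> (x + t *\<^sub>R q)" for t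
  define P' where "P' t = - 2 * (q \<bullet> (x + t *\<^sub>R q))" for t
  have line: "((\<lambda>t. x + t *\<^sub>R q) has_vector_derivative q) (at t)" for t
    by (auto intro!: derivative_eq_intros)
  have P: "(P has_real_derivative P' t) (at t)" for t
    unfolding P_def[abs_def] P'_def
    by (rule DERIV_cong[OF DERIV_diff[OF DERIV_const has_real_derivative_inner[OF line line refl]]])
      (simp add: inner_commute)
  have P': "(P' has_real_derivative p'') (at 0)"
    unfolding P'_def[abs_def] p
    by (rule DERIV_cong[OF DERIV_cmult[OF has_real_derivative_inner[OF has_vector_derivative_const line refl]]])
      simp
  define v where "v j t = partial_deriv j w (x + t *\<^sub>R q)" for j t
  define v' where "v' j t = dir_deriv q (partial_deriv j w) (x + t *\<^sub>R q)" for j t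
  define u where "u t = w (x + t *\<^sub>R q)" for t
  define u' where "u' t = dir_deriv q w (x + t *\<^sub>R q)" for t
  have v: "(v j has_vector_derivative v' j t) (at t)"
    and v': "(v' j has_vector_derivative V'' j) (at 0)" for j t
    using smooth_has_vector_derivative_line[OF smooth_partial_deriv[OF w, of j], of x q t]
      smooth_has_vector_derivative_line[OF smooth_dir_deriv[OF smooth_partial_deriv[OF w, of j], of q], of x q 0]
    unfolding v_def[abs_def] v'_def[abs_def] V by simp_all
  have u: "(u has_vector_derivative u' t) (at t)"
    and u': "(u' has_vector_derivative W'') (at 0)" for t
    using smooth_has_vector_derivative_line[OF w, of x q t]
      smooth_has_vector_derivative_line[OF smooth_dir_deriv[OF w, of q], of x q 0]
    unfolding u_def[abs_def] u'_def[abs_def] W by simp_all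
  \<comment> \<open>The Bernstein function on the line. Squared moduli are real inner products,
    which keeps the calculus real although \<open>w\<close> is complex-valued.\<close>
  define g where "g t = (\<Sum>j\<in>UNIV. (P t)\<^sup>2 * (v j t \<bullet> v j t)) + M * (u t \<bullet> u t)" for t
  define g' where "g' t = (\<Sum>j\<in>UNIV. 2 * P t * P' t * (v j t \<bullet> v j t) + (P t)\<^sup>2 * (2 * (v j t \<bullet> v' j t)))
    + M * (2 * (u t \<bullet> u' t))" for t
  have "(g has_real_derivative g' t) (at t)" for t
    unfolding g_def[abs_def] g'_def
  proof (intro DERIV_add DERIV_sum DERIV_cmult)
    show "((\<lambda>t. u t \<bullet> u t) has_real_derivative 2 * (u t \<bullet> u' t)) (at t)"
      by (rule has_real_derivative_inner[OF u u]) (simp add: inner_commute)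
    show "((\<lambda>t. (P t)\<^sup>2 * (v j t \<bullet> v j t)) has_real_derivative
        2 * P t * P' t * (v j t \<bullet> v j t) + (P t)\<^sup>2 * (2 * (v j t \<bullet> v' j t))) (at t)" for j
      by (rule DERIV_cong[OF DERIV_mult[OF DERIV_power[OF P] has_real_derivative_inner[OF v v refl]]])
        (simp add: inner_commute)
  qed
  moreover have "(g' has_real_derivative (\<Sum>j\<in>UNIV. 2 * (p'\<^sup>2 + p * p'') * (V j \<bullet> V j)
      + 8 * p * p' * (V j \<bullet> V' j) + 2 * p\<^sup>2 * (V' j \<bullet> V' j + V j \<bullet> V'' j))
      + 2 * M * (W' \<bullet> W' + W \<bullet> W'')) (at 0)"
  proof -
    have 0: "P 0 = p" "P' 0 = p'" "v j 0 = V j" "v' j 0 = V' j" "u 0 = W" "u' 0 = W'" for j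
      by (simp_all add: P_def P'_def v_def v'_def u_def u'_def p V W)
    show ?thesis
      unfolding g'_def[abs_def]
    proof (rule DERIV_add[OF DERIV_sum])
      have "((\<lambda>t. u t \<bullet> u' t) has_real_derivative W' \<bullet> W' + W \<bullet> W'') (at 0)"
        by (rule has_real_derivative_inner[OF u u']) (simp add: 0)
      from DERIV_cmult[OF DERIV_cmult[OF this, of 2], of M]
      show "((\<lambda>t. M * (2 * (u t \<bullet> u' t))) has_real_derivative 2 * M * (W' \<bullet> W' + W \<bullet> W'')) (at 0)"
        by (rule DERIV_cong) simp
      fix j
      have "((\<lambda>t. v j t \<bullet> v j t) has_real_derivative 2 * (V j \<bullet> V' j)) (at 0)"
        by (rule has_real_derivative_inner[OF v v]) (simp add: 0 inner_commute)
      from DERIV_mult[OF DERIV_mult[OF DERIV_cmult[OF P, of 2] P'] this]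
      have 1: "((\<lambda>t. 2 * P t * P' t * (v j t \<bullet> v j t)) has_real_derivative
          2 * (p'\<^sup>2 + p * p'') * (V j \<bullet> V j) + 4 * p * p' * (V j \<bullet> V' j)) (at 0)"
        by (rule DERIV_cong) (simp add: 0 power2_eq_square algebra_simps)
      have "((\<lambda>t. v j t \<bullet> v' j t) has_real_derivative V' j \<bullet> V' j + V j \<bullet> V'' j) (at 0)"
        by (rule has_real_derivative_inner[OF v v']) (simp add: 0)
      from DERIV_mult[OF DERIV_power[OF P, of 2] DERIV_cmult[OF this, of 2]]
      have 2: "((\<lambda>t. (P t)\<^sup>2 * (2 * (v j t \<bullet> v' j t))) has_real_derivative
          4 * p * p' * (V j \<bullet> V' j) + 2 * p\<^sup>2 * (V' j \<bullet> V' j + V j \<bullet> V'' j)) (at 0)"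
        by (rule DERIV_cong) (simp add: 0 algebra_simps)
      show "((\<lambda>t. 2 * P t * P' t * (v j t \<bullet> v j t) + (P t)\<^sup>2 * (2 * (v j t \<bullet> v' j t)))
        has_real_derivative 2 * (p'\<^sup>2 + p * p'') * (V j \<bullet> V j) + 8 * p * p' * (V j \<bullet> V' j)
          + 2 * p\<^sup>2 * (V' j \<bullet> V' j + V j \<bullet> V'' j)) (at 0)"
        by (rule DERIV_cong[OF DERIV_add[OF 1 2]]) simp
    qed
  qed
  \<comment> \<open>Since \<open>norm x < R\<close>, a short piece of the line around
    \<open>x\<close> stays where \<open>max\<close> applies.\<close>
  moreover have "eventually (\<lambda>t. g t \<le> g 0) (at 0)"
  proof -
    have "((\<lambda>t. norm (x + t *\<^sub>R q)) \<longlongrightarrow> norm (x + 0 *\<^sub>R q)) (at 0)"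
      by (intro tendsto_intros)
    then have "eventually (\<lambda>t. norm (x + t *\<^sub>R q) < R) (at 0)"
      by (rule order_tendstoD) (use x in simp)
    then show ?thesis
    proof eventually_elim
      case (elim t)
      then show ?case using max[of "x + t *\<^sub>R q"] by (simp add: g_def P_def v_def u_def)
    qed
  qed
  ultimately show ?thesis by (rule second_derivative_at_local_max)
qed

section \<open>Absorption of the cutoff and lower order terms\<close>

lemma two_mult_le_weighted_squares:
  fixes a b s t :: real
  assumes "s * s \<le> t * r" "t > 0" "r \<ge> 0" "s \<ge> 0" "a \<ge> 0" "b \<ge> 0"
  shows "2 * s * a * b \<le> t * a\<^sup>2 + r * b\<^sup>2"
proof -
  have "s \<le> sqrt t * sqrt r" using assms(1)
    by (simp add: real_le_rsqrt power2_eq_square flip: real_sqrt_mult)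
  then have "2 * s * (a * b) \<le> 2 * (sqrt t * sqrt r) * (a * b)"
    using assms by (intro mult_right_mono) auto
  also have "\<dots> \<le> t * a\<^sup>2 + r * b\<^sup>2"
    using sum_squares_bound[of "sqrt t * a" "sqrt r * b"] assms by (simp add: power_mult_distrib algebra_simps)
  finally show ?thesis by (simp add: algebra_simps)
qed

text \<open>The cross term is a product of \<open>p * V'\<close> and \<open>p' * V\<close>, because
  the cutoff enters squared. It is therefore split into one of the two available copies of
  \<open>p\<^sup>2 * (V' \<bullet> V')\<close> and a multiple of \<open>V \<bullet> V\<close> that
  does not degenerate with \<open>p\<close>.\<close>

lemma cutoff_term_lower_bound:
  fixes V V' :: "'a::real_inner"
  assumes p: "0 \<le> p" "p \<le> R\<^sup>2" "\<bar>p'\<bar> \<le> 2 * B * R" "\<bar>p''\<bar> \<le> 2 * B\<^sup>2"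
    and \<mu>: "0 \<le> \<mu>" "\<mu> \<le> S"
  shows "\<mu> * (p\<^sup>2 * (V' \<bullet> V')) - S * (60 * B\<^sup>2 * R\<^sup>2) * (V \<bullet> V)
    \<le> \<mu> * (2 * (p'\<^sup>2 + p * p'') * (V \<bullet> V) + 8 * p * p' * (V \<bullet> V') + 2 * p\<^sup>2 * (V' \<bullet> V'))"
proof -
  have "\<bar>p * p' * (V \<bullet> V')\<bar> \<le> \<bar>p\<bar> * \<bar>p'\<bar> * (norm V * norm V')"
    unfolding abs_mult by (intro mult_left_mono Cauchy_Schwarz_ineq2) auto
  moreover have "8 * (\<bar>p\<bar> * \<bar>p'\<bar> * (norm V * norm V')) \<le> p\<^sup>2 * (V' \<bullet> V') + 16 * p'\<^sup>2 * (V \<bullet> V)"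
    using sum_squares_bound[of "\<bar>p\<bar> * norm V'" "4 * \<bar>p'\<bar> * norm V"]
    by (simp add: power_mult_distrib dot_square_norm algebra_simps)
  ultimately have 1: "8 * p * p' * (V \<bullet> V') \<ge> - (p\<^sup>2 * (V' \<bullet> V')) - 16 * p'\<^sup>2 * (V \<bullet> V)"
    by (simp add: abs_le_iff)
  have "p'\<^sup>2 \<le> (2 * B * R)\<^sup>2" using p by (intro abs_le_square_iff[THEN iffD1]) auto
  moreover have "\<bar>p * p''\<bar> \<le> R\<^sup>2 * (2 * B\<^sup>2)"
    unfolding abs_mult using p by (intro mult_mono) auto
  \<comment> \<open>The constant is 60 = 14 * 4 + 2 * 2.\<close>
  ultimately have 2: "2 * (p'\<^sup>2 + p * p'') - 16 * p'\<^sup>2 \<ge> - (60 * B\<^sup>2 * R\<^sup>2)"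
    by (simp add: power_mult_distrib abs_le_iff mult.commute mult.left_commute)
  have "p\<^sup>2 * (V' \<bullet> V') - (60 * B\<^sup>2 * R\<^sup>2) * (V \<bullet> V)
      \<le> p\<^sup>2 * (V' \<bullet> V') + (2 * (p'\<^sup>2 + p * p'') - 16 * p'\<^sup>2) * (V \<bullet> V)"
    using mult_right_mono[OF 2, of "V \<bullet> V"] by simp
  also have "\<dots> \<le> 2 * (p'\<^sup>2 + p * p'') * (V \<bullet> V) + 8 * p * p' * (V \<bullet> V') + 2 * p\<^sup>2 * (V' \<bullet> V')"
    using 1 by (simp add: algebra_simps)
  finally have "\<mu> * (p\<^sup>2 * (V' \<bullet> V') - (60 * B\<^sup>2 * R\<^sup>2) * (V \<bullet> V))
    \<le> \<mu> * (2 * (p'\<^sup>2 + p * p'') * (V \<bullet> V) + 8 * p * p' * (V \<bullet> V') + 2 * p\<^sup>2 * (V' \<bullet> V'))"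
    using \<mu> by (intro mult_left_mono)
  moreover have "\<mu> * ((60 * B\<^sup>2 * R\<^sup>2) * (V \<bullet> V)) \<le> S * ((60 * B\<^sup>2 * R\<^sup>2) * (V \<bullet> V))"
    using \<mu> by (intro mult_right_mono) auto
  ultimately show ?thesis by (simp add: algebra_simps)
qed

text \<open>Here \<open>V\<close> is the solution or one of its derivatives. Each first order term
  costs \<open>S ^ 3\<close>, since a coefficient of size \<open>S\<close> is balanced against
  ellipticity \<open>1 / S\<close>. The term with \<open>c\<close> accounts for two further
  multiples of \<open>S ^ 3\<close>, the one with \<open>h\<close> for one, which explains the 3
  next to the dimension.\<close>

lemma lower_order_term_bound:
  fixes S T :: real and V h c :: complex and V' \<beta> :: "'n::finite \<Rightarrow> complex"
  assumes S: "S \<ge> 1" and \<mu>: "\<And>k. 1 / S \<le> \<mu> k" and \<beta>: "\<And>k. norm (\<beta> k) \<le> S"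
    and c: "norm c \<le> S" and h: "norm h \<le> T"
  shows "- (2 * (V \<bullet> ((\<Sum>k\<in>UNIV. \<beta> k * V' k) + c * V + h)))
    \<le> (\<Sum>k\<in>UNIV. \<mu> k * (V' k \<bullet> V' k)) + (real CARD('n) + 3) * S ^ 3 * (V \<bullet> V) + T\<^sup>2"
proof -
  have 1: "- (2 * (V \<bullet> (\<beta> k * V' k))) \<le> \<mu> k * (V' k \<bullet> V' k) + S ^ 3 * (V \<bullet> V)" for k
  proof -
    have "- (2 * (V \<bullet> (\<beta> k * V' k))) \<le> 2 * (norm V * norm (\<beta> k * V' k))"
      using Cauchy_Schwarz_ineq2[of V "\<beta> k * V' k"] by simp
    also have "\<dots> = 2 * norm (\<beta> k) * norm (V' k) * norm V" by (simp add: norm_mult)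
    also have "\<dots> \<le> 2 * S * norm (V' k) * norm V"
      using \<beta> by (intro mult_right_mono) auto
    \<comment> \<open>The weights \<open>1 / S\<close> and \<open>S ^ 3\<close> have product
      \<open>S\<^sup>2\<close>, and \<open>1 / S\<close> is the lower bound for
      \<open>\<mu> k\<close>.\<close>
    also have "\<dots> \<le> (1 / S) * (norm (V' k))\<^sup>2 + S ^ 3 * (norm V)\<^sup>2"
      using S by (intro two_mult_le_weighted_squares) (auto simp: power3_eq_cube)
    also have "\<dots> \<le> \<mu> k * (norm (V' k))\<^sup>2 + S ^ 3 * (norm V)\<^sup>2"
      by (intro add_mono mult_right_mono \<mu>) auto
    finally show ?thesis by (simp add: dot_square_norm)
  qed
  have S3: "S \<le> S ^ 3" "1 \<le> S ^ 3" using S by (auto intro: self_le_power)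
  have "- (2 * (V \<bullet> (c * V))) \<le> 2 * (norm V * norm (c * V))"
    using Cauchy_Schwarz_ineq2[of V "c * V"] by simp
  also have "\<dots> = 2 * norm c * (V \<bullet> V)" by (simp add: norm_mult dot_square_norm power2_eq_square)
  also have "\<dots> \<le> 2 * S ^ 3 * (V \<bullet> V)"
    using c S3 by (intro mult_right_mono) auto
  finally have 2: "- (2 * (V \<bullet> (c * V))) \<le> 2 * (S ^ 3 * (V \<bullet> V))" by (simp only: mult.assoc)
  have "- (2 * (V \<bullet> h)) \<le> 2 * (norm V * norm h)"
    using Cauchy_Schwarz_ineq2[of V h] by simp
  also have "\<dots> \<le> (norm V)\<^sup>2 + (norm h)\<^sup>2" using sum_squares_bound[of "norm V" "norm h"] by simp
  also have "\<dots> \<le> 1 * (V \<bullet> V) + T\<^sup>2"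
    using h by (simp add: dot_square_norm power_mono)
  also have "\<dots> \<le> S ^ 3 * (V \<bullet> V) + T\<^sup>2"
    using S3 by (intro add_right_mono mult_right_mono) auto
  finally have 3: "- (2 * (V \<bullet> h)) \<le> S ^ 3 * (V \<bullet> V) + T\<^sup>2" .
  have "- (2 * (V \<bullet> (\<Sum>k\<in>UNIV. \<beta> k * V' k))) = (\<Sum>k\<in>UNIV. - (2 * (V \<bullet> (\<beta> k * V' k))))"
    by (simp add: inner_sum_right sum_distrib_left sum_negf)
  also have "\<dots> \<le> (\<Sum>k\<in>UNIV. \<mu> k * (V' k \<bullet> V' k) + S ^ 3 * (V \<bullet> V))"
    by (rule sum_mono) (rule 1)
  also have "\<dots> = (\<Sum>k\<in>UNIV. \<mu> k * (V' k \<bullet> V' k)) + CARD('n) * (S ^ 3 * (V \<bullet> V))"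
    by (simp add: sum.distrib)
  finally have 4: "- (2 * (V \<bullet> (\<Sum>k\<in>UNIV. \<beta> k * V' k)))
    \<le> (\<Sum>k\<in>UNIV. \<mu> k * (V' k \<bullet> V' k)) + CARD('n) * (S ^ 3 * (V \<bullet> V))" .
  have "(real CARD('n) + 3) * S ^ 3 * (V \<bullet> V) = CARD('n) * (S ^ 3 * (V \<bullet> V)) + 3 * (S ^ 3 * (V \<bullet> V))"
    by (simp add: distrib_right)
  with 2 3 4 show ?thesis unfolding inner_add_right distrib_left by linarith
qed

section \<open>The differentiated equation and the estimate at a maximum\<close>

lemma partial_deriv_dir_deriv:
  assumes "smooth g"
  shows "partial_deriv j (dir_deriv q g) = dir_deriv q (partial_deriv j g)"
  using dir_deriv_commute[OF assms, of "axis j 1" q] by (auto simp: dir_deriv_axis)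

text \<open>The coefficients do not depend on \<open>x\<close>, so differentiation only changes the
  right-hand side. Both the Bernstein computation and the induction on the order of differentiation
  rest on this.\<close>

lemma partial_deriv_equation:
  fixes w h :: "real^'n::finite \<Rightarrow> complex" and q :: "'n \<Rightarrow> real^'n" and \<mu> :: "'n \<Rightarrow> real"
  assumes w: "smooth w" and h: "smooth h"
    and eq: "\<And>x. (\<Sum>k\<in>UNIV. \<mu> k *\<^sub>R dir_deriv (q k) (dir_deriv (q k) w) x)
      = (\<Sum>k\<in>UNIV. \<beta> k * dir_deriv (q k) w x) + c * w x + h x"
  shows "(\<Sum>k\<in>UNIV. \<mu> k *\<^sub>R dir_deriv (q k) (dir_deriv (q k) (partial_deriv j w)) x)
      = (\<Sum>k\<in>UNIV. \<beta> k * dir_deriv (q k) (partial_deriv j w) x) + c * partial_deriv j w x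
        + partial_deriv j h x"
proof -
  note s = smooth_dir_deriv w h smooth_scale smooth_sum smooth_add
  have "partial_deriv j (\<lambda>x. \<Sum>k\<in>UNIV. of_real (\<mu> k) * dir_deriv (q k) (dir_deriv (q k) w) x)
    = partial_deriv j (\<lambda>x. (\<Sum>k\<in>UNIV. \<beta> k * dir_deriv (q k) w x) + c * w x + h x)"
    using eq by (simp add: scaleR_conv_of_real)
  then show ?thesis
    by (simp add: partial_deriv_sum partial_deriv_add partial_deriv_scale s partial_deriv_dir_deriv
        scaleR_conv_of_real fun_eq_iff)
qed

text \<open>\<open>n\<close> is the dimension and \<open>B\<close> bounds the norms of the directions.\<close>

definition bernstein_weight :: "nat \<Rightarrow> real \<Rightarrow> real \<Rightarrow> real" where
  "bernstein_weight n B R = 60 * n * B\<^sup>2 * R\<^sup>2 + (R\<^sup>2)\<^sup>2 * (n + 3) + 1"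

text \<open>The first summand accounts for the gradient part of the Bernstein function at its
  maximum, the second for its part M |w|^2.\<close>

definition gradient_const :: "nat \<Rightarrow> real \<Rightarrow> real \<Rightarrow> real" where
  "gradient_const n B R =
     (R\<^sup>2)\<^sup>2 * (n * (R\<^sup>2)\<^sup>2 + 2 * bernstein_weight n B R * (n + 4)) + 2 * bernstein_weight n B R"

text \<open>Summing the inequalities for the directions \<open>q k\<close> with weights \<open>\<mu> k\<close> gives \<open>L\<close>. The choice
  \<open>M \<approx> S\<^sup>4\<close> lets the term \<open>M \<mu> |\<nabla>w|\<^sup>2\<close> absorb the multiples of \<open>S\<^sup>3 |\<nabla>w|\<^sup>2\<close> that come from the cutoff and the
  lower order terms.\<close>

lemma gradient_bound_at_max:
  fixes w h :: "real^'n::finite \<Rightarrow> complex" and q :: "'n \<Rightarrow> real^'n" and \<mu> :: "'n \<Rightarrow> real"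
    and S T B R M :: real
  assumes w: "smooth w" and h: "smooth h"
    and eq: "\<And>x. (\<Sum>k\<in>UNIV. \<mu> k *\<^sub>R dir_deriv (q k) (dir_deriv (q k) w) x)
      = (\<Sum>k\<in>UNIV. \<beta> k * dir_deriv (q k) w x) + c * w x + h x"
    and S: "S \<ge> 1" and \<mu>: "\<And>k. 1 / S \<le> \<mu> k" "\<And>k. \<mu> k \<le> S" and \<beta>: "\<And>k. norm (\<beta> k) \<le> S"
    and c: "norm c \<le> S" and q: "\<And>k. norm (q k) \<le> B"
    and frame: "\<And>z :: 'n \<Rightarrow> complex. (\<Sum>j\<in>UNIV. z j \<bullet> z j)
      \<le> 2 * (\<Sum>k\<in>UNIV. (\<Sum>j\<in>UNIV. of_real (q k $ j) * z j) \<bullet> (\<Sum>j\<in>UNIV. of_real (q k $ j) * z j))"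
    and T: "\<And>x. norm x \<le> R \<Longrightarrow> norm (w x) \<le> T" "\<And>x. norm x \<le> R \<Longrightarrow> norm (h x) \<le> T"
      "\<And>x j. norm x \<le> R \<Longrightarrow> norm (partial_deriv j h x) \<le> T"
    and M: "M = 2 * S ^ 4 * bernstein_weight CARD('n) B R"
    and x: "norm x < R"
    and max: "\<And>y. norm y \<le> R \<Longrightarrow>
      (\<Sum>j\<in>UNIV. (R\<^sup>2 - y \<bullet> y)\<^sup>2 * (partial_deriv j w y \<bullet> partial_deriv j w y)) + M * (w y \<bullet> w y)
      \<le> (\<Sum>j\<in>UNIV. (R\<^sup>2 - x \<bullet> x)\<^sup>2 * (partial_deriv j w x \<bullet> partial_deriv j w x)) + M * (w x \<bullet> w x)"
  shows "(\<Sum>j\<in>UNIV. partial_deriv j w x \<bullet> partial_deriv j w x)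
    \<le> (CARD('n) * (R\<^sup>2)\<^sup>2 + 2 * bernstein_weight CARD('n) B R * (CARD('n) + 4)) * S ^ 7 * T\<^sup>2"
proof -
  define n where "n = real CARD('n)"
  define K where "K = bernstein_weight CARD('n) B R"
  define V where "V j = partial_deriv j w x" for j
  define V' where "V' j k = dir_deriv (q k) (partial_deriv j w) x" for j k
  define V'' where "V'' j k = dir_deriv (q k) (dir_deriv (q k) (partial_deriv j w)) x" for j k
  define W where "W = w x"
  define W' where "W' k = dir_deriv (q k) w x" for k
  define W'' where "W'' k = dir_deriv (q k) (dir_deriv (q k) w) x" for k
  define p where "p = R\<^sup>2 - x \<bullet> x"
  define p' where "p' k = - 2 * (q k \<bullet> x)" for k
  define p'' where "p'' k = - 2 * (q k \<bullet> q k)" for k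
  define G where "G = (\<Sum>j\<in>UNIV. V j \<bullet> V j)"
  define E where "E j = (\<Sum>k\<in>UNIV. \<mu> k * (V' j k \<bullet> V' j k))" for j
  define E0 where "E0 = (\<Sum>k\<in>UNIV. \<mu> k * (W' k \<bullet> W' k))"
  define LV where "LV j = (\<Sum>k\<in>UNIV. \<mu> k *\<^sub>R V'' j k)" for j
  define LW where "LW = (\<Sum>k\<in>UNIV. \<mu> k *\<^sub>R W'' k)"
  define cut where "cut j k = 2 * ((p' k)\<^sup>2 + p * p'' k) * (V j \<bullet> V j) + 8 * p * p' k * (V j \<bullet> V' j k)
      + 2 * p\<^sup>2 * (V' j k \<bullet> V' j k)" for j k
  have R: "R > 0" using x norm_ge_zero[of x] by linarith
  have B: "B \<ge> 0" using q[of undefined] norm_ge_zero order_trans by blast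
  have \<mu>0: "\<mu> k \<ge> 0" for k using \<mu>(1)[of k] S by (smt (verit) divide_nonneg_nonneg)
  have n0: "n \<ge> 0" unfolding n_def by simp
  have K1: "K \<ge> 1" unfolding K_def bernstein_weight_def by simp
  have M0: "M \<ge> 0" using M S K1 by (simp add: K_def)
  have T0: "T \<ge> 0" using T(1)[of 0] R norm_ge_zero[of "w 0"] by (simp add: order_trans[of 0 "norm (w 0)"])
  have S3: "1 \<le> S ^ 3" "S \<le> S ^ 3" using S by (auto intro: self_le_power)
  have p: "0 \<le> p" "p \<le> R\<^sup>2"
    using x R by (auto simp: p_def dot_square_norm power_mono)
  have p2: "p\<^sup>2 \<le> (R\<^sup>2)\<^sup>2" using p by (intro power_mono)
  have p': "\<bar>p' k\<bar> \<le> 2 * B * R" for k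
  proof -
    have "\<bar>q k \<bullet> x\<bar> \<le> norm (q k) * norm x" by (rule Cauchy_Schwarz_ineq2)
    also have "\<dots> \<le> B * R" using q B x by (intro mult_mono) auto
    finally show ?thesis by (simp add: p'_def abs_mult)
  qed
  have p'': "\<bar>p'' k\<bar> \<le> 2 * B\<^sup>2" for k
    using q[of k] by (simp add: p''_def dot_square_norm abs_mult power_mono)

  have "(\<Sum>j\<in>UNIV. 2 * ((p' k)\<^sup>2 + p * p'' k) * (V j \<bullet> V j) + 8 * p * p' k * (V j \<bullet> V' j k)
      + 2 * p\<^sup>2 * (V' j k \<bullet> V' j k + V j \<bullet> V'' j k)) + 2 * M * (W' k \<bullet> W' k + W \<bullet> W'' k) \<le> 0" for k
    by (rule second_derivative_at_max[OF w x max])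
      (simp_all add: p_def p'_def p''_def V_def V'_def V''_def W_def W'_def W''_def)
  then have "\<mu> k * ((\<Sum>j\<in>UNIV. cut j k + 2 * p\<^sup>2 * (V j \<bullet> V'' j k)) + 2 * M * (W' k \<bullet> W' k + W \<bullet> W'' k)) \<le> 0" for k
    using \<mu>0 by (intro mult_nonneg_nonpos) (simp_all add: cut_def distrib_left add.assoc)
  then have "(\<Sum>k\<in>UNIV. \<mu> k * ((\<Sum>j\<in>UNIV. cut j k + 2 * p\<^sup>2 * (V j \<bullet> V'' j k))
    + 2 * M * (W' k \<bullet> W' k + W \<bullet> W'' k))) \<le> 0"
    by (intro sum_nonpos)
  moreover have "(\<Sum>k\<in>UNIV. \<mu> k * ((\<Sum>j\<in>UNIV. cut j k + 2 * p\<^sup>2 * (V j \<bullet> V'' j k))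
    + 2 * M * (W' k \<bullet> W' k + W \<bullet> W'' k)))
    = (\<Sum>j\<in>UNIV. (\<Sum>k\<in>UNIV. \<mu> k * cut j k) + p\<^sup>2 * (2 * (V j \<bullet> LV j))) + M * (2 * E0 + 2 * (W \<bullet> LW))"
  proof -
    have 1: "(\<Sum>k\<in>UNIV. \<mu> k * (\<Sum>j\<in>UNIV. cut j k + 2 * p\<^sup>2 * (V j \<bullet> V'' j k)))
      = (\<Sum>j\<in>UNIV. \<Sum>k\<in>UNIV. \<mu> k * (cut j k + 2 * p\<^sup>2 * (V j \<bullet> V'' j k)))"
      unfolding sum_distrib_left by (rule sum.swap)
    have 2: "(\<Sum>k\<in>UNIV. \<mu> k * (cut j k + 2 * p\<^sup>2 * (V j \<bullet> V'' j k)))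
      = (\<Sum>k\<in>UNIV. \<mu> k * cut j k) + p\<^sup>2 * (2 * (V j \<bullet> LV j))" for j
      unfolding LV_def inner_sum_right inner_scaleR_right sum_distrib_left sum.distrib[symmetric]
      by (rule sum.cong) (simp_all only: distrib_left mult_ac)
    have 3: "(\<Sum>k\<in>UNIV. \<mu> k * (2 * M * (W' k \<bullet> W' k + W \<bullet> W'' k))) = M * (2 * E0 + 2 * (W \<bullet> LW))"
      unfolding LW_def E0_def inner_sum_right inner_scaleR_right sum_distrib_left sum.distrib[symmetric]
      by (rule sum.cong) (simp_all only: distrib_left mult_ac)
    have 0: "(\<Sum>k\<in>UNIV. \<mu> k * (a k + b k)) = (\<Sum>k\<in>UNIV. \<mu> k * a k) + (\<Sum>k\<in>UNIV. \<mu> k * b k)" for a b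
      by (simp only: distrib_left sum.distrib)
    show ?thesis by (rule trans[OF 0]) (simp only: 1 2 3)
  qed
  ultimately have main: "(\<Sum>j\<in>UNIV. (\<Sum>k\<in>UNIV. \<mu> k * cut j k) + p\<^sup>2 * (2 * (V j \<bullet> LV j)))
    + M * (2 * E0 + 2 * (W \<bullet> LW)) \<le> 0" by (simp only:)

  have LV: "LV j = (\<Sum>k\<in>UNIV. \<beta> k * V' j k) + c * V j + partial_deriv j h x" for j
    using partial_deriv_equation[OF w h eq] by (simp only: LV_def V''_def V'_def V_def)
  have LW: "LW = (\<Sum>k\<in>UNIV. \<beta> k * W' k) + c * W + h x"
    using eq by (simp only: LW_def W''_def W'_def W_def)
  have lowV: "- (2 * (V j \<bullet> LV j)) \<le> E j + (n + 3) * S ^ 3 * (V j \<bullet> V j) + T\<^sup>2" for j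
    unfolding LV E_def n_def by (rule lower_order_term_bound[OF S \<mu>(1) \<beta> c T(3)]) (use x in simp)
  have lowW: "- (2 * (W \<bullet> LW)) \<le> E0 + (n + 3) * S ^ 3 * (W \<bullet> W) + T\<^sup>2"
    unfolding LW E0_def n_def by (rule lower_order_term_bound[OF S \<mu>(1) \<beta> c T(2)]) (use x in simp)

  have cutsum: "p\<^sup>2 * E j - n * (S * (60 * B\<^sup>2 * R\<^sup>2) * (V j \<bullet> V j)) \<le> (\<Sum>k\<in>UNIV. \<mu> k * cut j k)" for j
  proof -
    have "(\<Sum>k\<in>UNIV. \<mu> k * (p\<^sup>2 * (V' j k \<bullet> V' j k)) - S * (60 * B\<^sup>2 * R\<^sup>2) * (V j \<bullet> V j))
        \<le> (\<Sum>k\<in>UNIV. \<mu> k * cut j k)"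
      unfolding cut_def by (intro sum_mono cutoff_term_lower_bound p p' p'' \<mu>0 \<mu>(2))
    then show ?thesis
      by (simp add: sum_subtractf E_def n_def sum_distrib_left mult.left_commute)
  qed
  \<comment> \<open>The \<open>p\<^sup>2 * E j\<close> left by \<open>cutsum\<close> is used up by
    \<open>lowV\<close>. The summand 1 of \<open>bernstein_weight\<close> provides the
    \<open>S ^ 3 * (V j \<bullet> V j)\<close> set apart on the left; it becomes the bound for
    \<open>G\<close> once \<open>ME\<close> cancels the negative term.\<close>
  have jterm: "- (S ^ 3 * K * (V j \<bullet> V j)) - (R\<^sup>2)\<^sup>2 * T\<^sup>2 + S ^ 3 * (V j \<bullet> V j)
      \<le> (\<Sum>k\<in>UNIV. \<mu> k * cut j k) + p\<^sup>2 * (2 * (V j \<bullet> LV j))" for j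
  proof -
    have "p\<^sup>2 * (- (2 * (V j \<bullet> LV j))) \<le> p\<^sup>2 * (E j + (n + 3) * S ^ 3 * (V j \<bullet> V j) + T\<^sup>2)"
      by (intro mult_left_mono lowV) simp
    then have 1: "- (p\<^sup>2 * (2 * (V j \<bullet> LV j))) \<le> p\<^sup>2 * E j + p\<^sup>2 * ((n + 3) * S ^ 3 * (V j \<bullet> V j)) + p\<^sup>2 * T\<^sup>2"
      by (simp only: distrib_left mult_minus_right)
    have 2: "p\<^sup>2 * ((n + 3) * S ^ 3 * (V j \<bullet> V j)) \<le> (R\<^sup>2)\<^sup>2 * ((n + 3) * S ^ 3 * (V j \<bullet> V j))"
      using S n0 by (intro mult_right_mono p2) auto
    have 3: "p\<^sup>2 * T\<^sup>2 \<le> (R\<^sup>2)\<^sup>2 * T\<^sup>2" by (intro mult_right_mono p2) auto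
    have 4: "n * (S * (60 * B\<^sup>2 * R\<^sup>2) * (V j \<bullet> V j)) \<le> n * (S ^ 3 * (60 * B\<^sup>2 * R\<^sup>2) * (V j \<bullet> V j))"
      using n0 S3 by (intro mult_left_mono mult_right_mono) auto
    have 5: "n * (S ^ 3 * (60 * B\<^sup>2 * R\<^sup>2) * (V j \<bullet> V j)) + (R\<^sup>2)\<^sup>2 * ((n + 3) * S ^ 3 * (V j \<bullet> V j))
      + S ^ 3 * (V j \<bullet> V j) = S ^ 3 * K * (V j \<bullet> V j)"
      unfolding K_def bernstein_weight_def n_def by (simp add: algebra_simps)
    show ?thesis using 1 2 3 4 5 cutsum[of j] by linarith
  qed
  have Wterm: "M * (E0 - (n + 4) * S ^ 3 * T\<^sup>2) \<le> M * (2 * E0 + 2 * (W \<bullet> LW))"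
  proof (rule mult_left_mono[OF _ M0])
    have "W \<bullet> W \<le> T\<^sup>2"
      using T(1)[of x] x by (simp add: W_def dot_square_norm power_mono)
    then have "(n + 3) * S ^ 3 * (W \<bullet> W) \<le> (n + 3) * S ^ 3 * T\<^sup>2"
      using S n0 by (intro mult_left_mono) auto
    moreover have "1 * T\<^sup>2 \<le> S ^ 3 * T\<^sup>2" by (intro mult_right_mono S3) auto
    ultimately have "(n + 3) * S ^ 3 * (W \<bullet> W) + T\<^sup>2 \<le> (n + 4) * S ^ 3 * T\<^sup>2"
      by (simp add: algebra_simps)
    then show "E0 - (n + 4) * S ^ 3 * T\<^sup>2 \<le> 2 * E0 + 2 * (W \<bullet> LW)" using lowW by linarith
  qed
  \<comment> \<open>The frame inequality costs a factor 2 and \<open>1 / S \<le> \<mu> k\<close> a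
    factor \<open>S\<close>. Together with the \<open>S ^ 3 * K * G\<close> to be cancelled, this
    dictates the value of \<open>M\<close>.\<close>
  have "G \<le> 2 * (\<Sum>k\<in>UNIV. W' k \<bullet> W' k)"
    using frame[of V] by (simp add: G_def W'_def dir_deriv_def V_def)
  moreover have "(\<Sum>k\<in>UNIV. W' k \<bullet> W' k) \<le> S * E0"
  proof -
    have "W' k \<bullet> W' k \<le> S * (\<mu> k * (W' k \<bullet> W' k))" for k
    proof -
      have "1 \<le> S * \<mu> k" using \<mu>(1)[of k] S by (simp add: field_simps)
      from mult_right_mono[OF this, of "W' k \<bullet> W' k"] show ?thesis by (simp add: mult.assoc)
    qed
    then show ?thesis unfolding E0_def sum_distrib_left by (intro sum_mono)
  qed
  ultimately have "G \<le> 2 * (S * E0)" by linarith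
  then have "S ^ 3 * K * G \<le> S ^ 3 * K * (2 * (S * E0))"
    using S K1 by (intro mult_left_mono) auto
  also have "\<dots> = M * E0" using M by (simp add: K_def eval_nat_numeral)
  finally have ME: "S ^ 3 * K * G \<le> M * E0" .
  have "(\<Sum>j\<in>UNIV. - (S ^ 3 * K * (V j \<bullet> V j)) - (R\<^sup>2)\<^sup>2 * T\<^sup>2 + S ^ 3 * (V j \<bullet> V j))
    \<le> (\<Sum>j\<in>UNIV. (\<Sum>k\<in>UNIV. \<mu> k * cut j k) + p\<^sup>2 * (2 * (V j \<bullet> LV j)))"
    by (rule sum_mono) (rule jterm)
  moreover have "(\<Sum>j\<in>UNIV. - (S ^ 3 * K * (V j \<bullet> V j)) - (R\<^sup>2)\<^sup>2 * T\<^sup>2 + S ^ 3 * (V j \<bullet> V j))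
    = - (S ^ 3 * K * G) - n * ((R\<^sup>2)\<^sup>2 * T\<^sup>2) + S ^ 3 * G"
    by (simp add: sum.distrib sum_subtractf sum_negf G_def n_def flip: sum_distrib_left)
  ultimately have "S ^ 3 * G \<le> n * ((R\<^sup>2)\<^sup>2 * T\<^sup>2) + M * ((n + 4) * S ^ 3 * T\<^sup>2)"
    using main Wterm ME unfolding right_diff_distrib by linarith
  moreover have "1 * G \<le> S ^ 3 * G"
    using S3 by (intro mult_right_mono) (auto simp: G_def intro: sum_nonneg)
  moreover have "n * ((R\<^sup>2)\<^sup>2 * T\<^sup>2) \<le> S ^ 7 * (n * ((R\<^sup>2)\<^sup>2 * T\<^sup>2))"
    using one_le_power[OF S, of 7] n0 mult_right_mono[of 1 "S ^ 7" "n * ((R\<^sup>2)\<^sup>2 * T\<^sup>2)"] by simp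
  \<comment> \<open>The source of the exponent 7: \<open>S ^ 4\<close> from \<open>M\<close> and
    \<open>S ^ 3\<close> from the lower order terms of the equation for \<open>w\<close>.\<close>
  moreover have "M * ((n + 4) * S ^ 3 * T\<^sup>2) = S ^ 7 * (2 * K * (n + 4) * T\<^sup>2)"
    using M by (simp add: K_def eval_nat_numeral)
  ultimately have "G \<le> S ^ 7 * (n * ((R\<^sup>2)\<^sup>2 * T\<^sup>2)) + S ^ 7 * (2 * K * (n + 4) * T\<^sup>2)"
    by linarith
  then show ?thesis
    by (simp add: G_def V_def n_def K_def algebra_simps)
qed

text \<open>A maximum on the sphere is harmless: the cutoff vanishes there and only M |w|^2 remains,
  which \<open>T\<close> controls. The resulting bound degenerates as \<open>y\<close> approaches
  the sphere, so it is useful on smaller balls only.\<close>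

theorem gradient_estimate:
  fixes w h :: "real^'n::finite \<Rightarrow> complex" and q :: "'n \<Rightarrow> real^'n" and \<mu> :: "'n \<Rightarrow> real"
    and S T B R :: real
  assumes w: "smooth w" and h: "smooth h"
    and eq: "\<And>x. (\<Sum>k\<in>UNIV. \<mu> k *\<^sub>R dir_deriv (q k) (dir_deriv (q k) w) x)
      = (\<Sum>k\<in>UNIV. \<beta> k * dir_deriv (q k) w x) + c * w x + h x"
    and S: "S \<ge> 1" and \<mu>: "\<And>k. 1 / S \<le> \<mu> k" "\<And>k. \<mu> k \<le> S" and \<beta>: "\<And>k. norm (\<beta> k) \<le> S"
    and c: "norm c \<le> S" and q: "\<And>k. norm (q k) \<le> B"
    and frame: "\<And>z :: 'n \<Rightarrow> complex. (\<Sum>j\<in>UNIV. z j \<bullet> z j)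
      \<le> 2 * (\<Sum>k\<in>UNIV. (\<Sum>j\<in>UNIV. of_real (q k $ j) * z j) \<bullet> (\<Sum>j\<in>UNIV. of_real (q k $ j) * z j))"
    and T: "\<And>x. norm x \<le> R \<Longrightarrow> norm (w x) \<le> T" "\<And>x. norm x \<le> R \<Longrightarrow> norm (h x) \<le> T"
      "\<And>x j. norm x \<le> R \<Longrightarrow> norm (partial_deriv j h x) \<le> T"
    and R: "R > 0" and y: "norm y \<le> R"
  shows "(R\<^sup>2 - y \<bullet> y)\<^sup>2 * (norm (partial_deriv i w y))\<^sup>2 \<le> gradient_const CARD('n) B R * S ^ 7 * T\<^sup>2"
proof -
  define K where "K = bernstein_weight CARD('n) B R"
  define M where "M = 2 * S ^ 4 * K"
  define D where "D = real CARD('n) * (R\<^sup>2)\<^sup>2 + 2 * K * (CARD('n) + 4)"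
  define F where "F z = (\<Sum>j\<in>UNIV. (R\<^sup>2 - z \<bullet> z)\<^sup>2 * (partial_deriv j w z \<bullet> partial_deriv j w z))
    + M * (w z \<bullet> w z)" for z
  have K: "K \<ge> 0" unfolding K_def bernstein_weight_def by simp
  have M: "M \<ge> 0" using S K by (simp add: M_def)
  have "continuous_on (cball 0 R) G" if "smooth G" for G :: "real^'n \<Rightarrow> complex"
    using smooth_continuous[OF that] by (simp add: continuous_at_imp_continuous_on)
  note cont = this[OF w] this[OF smooth_partial_deriv[OF w]]
  have "continuous_on (cball 0 R) F"
    unfolding F_def[abs_def] by (intro continuous_intros cont)
  then obtain x where x: "x \<in> cball 0 R" and max: "\<And>z. z \<in> cball 0 R \<Longrightarrow> F z \<le> F x"
    using continuous_attains_sup[of "cball (0::real^'n) R" F] R by auto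
  have "S ^ 4 \<le> S ^ 7" using S by (intro power_increasing) auto
  then have "M \<le> 2 * K * S ^ 7" unfolding M_def using K mult_left_mono[of "S ^ 4" "S ^ 7" "2 * K"]
    by (simp add: mult_ac)
  moreover have "w x \<bullet> w x \<le> T\<^sup>2"
    using T(1)[of x] x by (simp add: dot_square_norm power_mono)
  ultimately have Mw: "M * (w x \<bullet> w x) \<le> 2 * K * S ^ 7 * T\<^sup>2"
    using M K S by (intro mult_mono) auto
  have "F x \<le> (R\<^sup>2)\<^sup>2 * (D * S ^ 7 * T\<^sup>2) + 2 * K * S ^ 7 * T\<^sup>2"
  proof (cases "norm x = R")
    case True
    then have "F x = M * (w x \<bullet> w x)" by (simp add: F_def dot_square_norm)
    moreover have "0 \<le> (R\<^sup>2)\<^sup>2 * (D * S ^ 7 * T\<^sup>2)" using S K by (simp add: D_def)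
    ultimately show ?thesis using Mw by linarith
  next
    case False
    then have x': "norm x < R" using x by simp
    have "(\<Sum>j\<in>UNIV. partial_deriv j w x \<bullet> partial_deriv j w x) \<le> D * S ^ 7 * T\<^sup>2"
      unfolding D_def K_def
      by (rule gradient_bound_at_max[OF w h eq S \<mu> \<beta> c q frame T M_def[unfolded K_def] x'])
        (use max in \<open>simp_all add: F_def\<close>)
    moreover have "(R\<^sup>2 - x \<bullet> x)\<^sup>2 \<le> (R\<^sup>2)\<^sup>2"
      using x' by (intro power_mono) (auto simp: dot_square_norm power_mono)
    ultimately have "(R\<^sup>2 - x \<bullet> x)\<^sup>2 * (\<Sum>j\<in>UNIV. partial_deriv j w x \<bullet> partial_deriv j w x)
        \<le> (R\<^sup>2)\<^sup>2 * (D * S ^ 7 * T\<^sup>2)"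
      by (intro mult_mono) (auto intro: sum_nonneg)
    then show ?thesis using Mw by (simp add: F_def sum_distrib_left)
  qed
  also have "\<dots> = gradient_const CARD('n) B R * S ^ 7 * T\<^sup>2"
    by (simp add: gradient_const_def D_def K_def algebra_simps)
  finally have "F y \<le> gradient_const CARD('n) B R * S ^ 7 * T\<^sup>2"
    using max[of y] y by simp
  moreover have "(R\<^sup>2 - y \<bullet> y)\<^sup>2 * (partial_deriv i w y \<bullet> partial_deriv i w y)
    \<le> (\<Sum>j\<in>UNIV. (R\<^sup>2 - y \<bullet> y)\<^sup>2 * (partial_deriv j w y \<bullet> partial_deriv j w y))"
    by (rule member_le_sum) auto
  moreover have "M * (w y \<bullet> w y) \<ge> 0" using M by simp
  ultimately show ?thesis by (simp add: F_def dot_square_norm)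
qed


section \<open>Nets\<close>

text \<open>Both inequalities are strict on purpose. A gradient estimate shrinks the ball and raises
  the exponent by arbitrarily little, and such losses disappear in the open conditions
  \<open>r < R\<close> and \<open>s > p\<close>.\<close>

definition loc_bounded :: "real \<Rightarrow> real \<Rightarrow> (real \<Rightarrow> real^'n \<Rightarrow> complex) \<Rightarrow> bool" where
  "loc_bounded R p g \<longleftrightarrow> (\<forall>r<R. \<forall>s>p. eventually (\<lambda>\<epsilon>. \<forall>x. norm x \<le> r \<longrightarrow>
     norm (g \<epsilon> x) \<le> \<epsilon> powr (- s)) (at_right 0))"

lemma const_le_powr:
  assumes "a > 0"
  shows "eventually (\<lambda>\<epsilon>::real. C \<le> \<epsilon> powr (- a)) (at_right 0)"
  using assms by real_asymp

text \<open>Growth slower than every negative power of \<epsilon>: a form shared by slow scale and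
  log-type nets that is evidently stable under sums and products.\<close>

definition slow_net :: "(real \<Rightarrow> 'a::real_normed_vector) \<Rightarrow> bool" where
  "slow_net r \<longleftrightarrow> (\<forall>\<delta>>0. eventually (\<lambda>\<epsilon>. norm (r \<epsilon>) \<le> \<epsilon> powr (- \<delta>)) (at_right 0))"

text \<open>The point is that \<open>R\<close> and \<open>p\<close> are the same in the hypotheses
  and in the conclusion, so that the step can be repeated without limit.\<close>

lemma loc_bounded_partial_deriv:
  fixes u h :: "real \<Rightarrow> real^'n::finite \<Rightarrow> complex" and q :: "real \<Rightarrow> 'n \<Rightarrow> real^'n"
    and \<mu> :: "real \<Rightarrow> 'n \<Rightarrow> real"
  assumes u: "smooth_net u" and h: "smooth_net h"
    and eq: "\<And>\<epsilon> x. \<epsilon> \<in> {0<..1} \<Longrightarrow>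
      (\<Sum>k\<in>UNIV. \<mu> \<epsilon> k *\<^sub>R dir_deriv (q \<epsilon> k) (dir_deriv (q \<epsilon> k) (u \<epsilon>)) x)
      = (\<Sum>k\<in>UNIV. \<beta> \<epsilon> k * dir_deriv (q \<epsilon> k) (u \<epsilon>) x) + c \<epsilon> * u \<epsilon> x + h \<epsilon> x"
    and \<mu>: "\<And>k. slow_net (\<lambda>\<epsilon>. \<mu> \<epsilon> k)" "\<And>k. slow_net (\<lambda>\<epsilon>. inverse (\<mu> \<epsilon> k))"
      "eventually (\<lambda>\<epsilon>. \<forall>k. \<mu> \<epsilon> k > 0) (at_right 0)"
    and \<beta>: "\<And>k. slow_net (\<lambda>\<epsilon>. \<beta> \<epsilon> k)" and c: "slow_net c"
    and q: "eventually (\<lambda>\<epsilon>. \<forall>k. norm (q \<epsilon> k) \<le> B) (at_right 0)"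
    and frame: "eventually (\<lambda>\<epsilon>. \<forall>z :: 'n \<Rightarrow> complex. (\<Sum>j\<in>UNIV. z j \<bullet> z j)
      \<le> 2 * (\<Sum>k\<in>UNIV. (\<Sum>j\<in>UNIV. of_real (q \<epsilon> k $ j) * z j) \<bullet> (\<Sum>j\<in>UNIV. of_real (q \<epsilon> k $ j) * z j)))
      (at_right 0)"
    and bu: "loc_bounded R p u" and bh: "loc_bounded R p h"
    and bh': "\<And>j. loc_bounded R p (\<lambda>\<epsilon>. partial_deriv j (h \<epsilon>))"
  shows "loc_bounded R p (\<lambda>\<epsilon>. partial_deriv i (u \<epsilon>))"
  unfolding loc_bounded_def
proof (intro allI impI)
  fix r s assume r: "r < R" and s: "s > p"
  show "eventually (\<lambda>\<epsilon>. \<forall>x. norm x \<le> r \<longrightarrow> norm (partial_deriv i (u \<epsilon>) x) \<le> \<epsilon> powr (- s)) (at_right 0)"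
  proof (cases "r < 0")
    case True
    then show ?thesis by (auto intro!: always_eventually dest: order_trans[OF norm_ge_zero])
  next
    case False
    define r' where "r' = (r + R) / 2"
    have r': "r < r'" "r' < R" "r' > 0" using r False by (auto simp: r'_def)
    \<comment> \<open>The budget for the squared gradient: \<open>11 * \<delta>\<close> for the
      constant \<open>C / d\<close>, \<open>7 * \<delta>\<close> for \<open>S ^ 7\<close> and
      \<open>2 * p + 2 * \<delta>\<close> for \<open>T\<^sup>2\<close>. The total
      \<open>2 * p + 20 * \<delta>\<close> equals \<open>2 * s\<close>.\<close>
    define \<delta> where "\<delta> = (s - p) / 10"
    have \<delta>: "\<delta> > 0" "p + \<delta> > p" using s by (auto simp: \<delta>_def)
    define C where "C = gradient_const CARD('n) B r'"
    \<comment> \<open>The least value of the squared cutoff of the ball of radius \<open>r'\<close>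
      on the smaller ball of radius \<open>r\<close>.\<close>
    define d where "d = (r'\<^sup>2 - r\<^sup>2)\<^sup>2"
    have rr: "r\<^sup>2 < r'\<^sup>2" using r' False by (intro power_strict_mono) auto
    then have d: "d > 0" by (simp add: d_def)
    have ev\<mu>: "eventually (\<lambda>\<epsilon>. \<forall>k. norm (\<mu> \<epsilon> k) \<le> \<epsilon> powr (- \<delta>)) (at_right 0)"
      "eventually (\<lambda>\<epsilon>. \<forall>k. norm (inverse (\<mu> \<epsilon> k)) \<le> \<epsilon> powr (- \<delta>)) (at_right 0)"
      "eventually (\<lambda>\<epsilon>. \<forall>k. norm (\<beta> \<epsilon> k) \<le> \<epsilon> powr (- \<delta>)) (at_right 0)"
      "eventually (\<lambda>\<epsilon>. norm (c \<epsilon>) \<le> \<epsilon> powr (- \<delta>)) (at_right 0)"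
      using \<mu> \<beta> c \<delta> by (auto simp: slow_net_def intro!: eventually_all_finite)
    have evb: "eventually (\<lambda>\<epsilon>. \<forall>x. norm x \<le> r' \<longrightarrow> norm (u \<epsilon> x) \<le> \<epsilon> powr (- (p + \<delta>))) (at_right 0)"
      "eventually (\<lambda>\<epsilon>. \<forall>x. norm x \<le> r' \<longrightarrow> norm (h \<epsilon> x) \<le> \<epsilon> powr (- (p + \<delta>))) (at_right 0)"
      using bu bh r' \<delta> unfolding loc_bounded_def by blast+
    have evh: "eventually (\<lambda>\<epsilon>. \<forall>j x. norm x \<le> r' \<longrightarrow> norm (partial_deriv j (h \<epsilon>) x) \<le> \<epsilon> powr (- (p + \<delta>)))
      (at_right 0)"
      using bh' r' \<delta> unfolding loc_bounded_def by (intro eventually_all_finite) blast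
    have evC: "eventually (\<lambda>\<epsilon>. C / d \<le> \<epsilon> powr (- (11 * \<delta>))) (at_right 0)"
      by (rule const_le_powr) (use \<delta> in simp)
    show ?thesis
      using ev\<mu> \<mu>(3) q frame evb evh evC eventually_01
    proof eventually_elim
      case (elim \<epsilon>)
      have \<epsilon>: "\<epsilon> > 0" "\<epsilon> \<le> 1" using elim by auto
      show ?case
      proof (intro allI impI)
        fix x :: "real^'n" assume x: "norm x \<le> r"
        define S where "S = \<epsilon> powr (- \<delta>)"
        define T where "T = \<epsilon> powr (- (p + \<delta>))"
        have S: "S \<ge> 1" using powr_mono'[of "- \<delta>" 0 \<epsilon>] \<epsilon> \<delta> by (simp add: S_def)
        have "(r'\<^sup>2 - x \<bullet> x)\<^sup>2 * (norm (partial_deriv i (u \<epsilon>) x))\<^sup>2 \<le> C * S ^ 7 * T\<^sup>2"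
          unfolding C_def
        proof (rule gradient_estimate)
          show "smooth (u \<epsilon>)" "smooth (h \<epsilon>)" using u h elim(12) by (auto simp: smooth_net_def)
          show "(\<Sum>k\<in>UNIV. \<mu> \<epsilon> k *\<^sub>R dir_deriv (q \<epsilon> k) (dir_deriv (q \<epsilon> k) (u \<epsilon>)) x)
            = (\<Sum>k\<in>UNIV. \<beta> \<epsilon> k * dir_deriv (q \<epsilon> k) (u \<epsilon>) x) + c \<epsilon> * u \<epsilon> x + h \<epsilon> x" for x
            by (rule eq) (rule elim(12))
          show "1 / S \<le> \<mu> \<epsilon> k" "\<mu> \<epsilon> k \<le> S" for k
          proof -
            have "\<mu> \<epsilon> k > 0" "inverse (\<mu> \<epsilon> k) \<le> S" "\<bar>\<mu> \<epsilon> k\<bar> \<le> S"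
              using elim(1,2,5)[rule_format, of k] by (auto simp: S_def abs_if)
            then show "1 / S \<le> \<mu> \<epsilon> k" "\<mu> \<epsilon> k \<le> S" using S by (auto simp: field_simps)
          qed
        qed (use elim S r' x in \<open>auto simp: S_def T_def\<close>)
        moreover have "d \<le> (r'\<^sup>2 - x \<bullet> x)\<^sup>2"
          unfolding d_def using x rr False
          by (intro power_mono) (auto simp: dot_square_norm power_mono)
        ultimately have "d * (norm (partial_deriv i (u \<epsilon>) x))\<^sup>2 \<le> C * S ^ 7 * T\<^sup>2"
          by (meson mult_right_mono order_trans zero_le_power2)
        then have "(norm (partial_deriv i (u \<epsilon>) x))\<^sup>2 \<le> C / d * (S ^ 7 * T\<^sup>2)"
          using d by (simp add: field_simps)
        also have "\<dots> \<le> \<epsilon> powr (- (11 * \<delta>)) * (S ^ 7 * T\<^sup>2)"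
          using elim S by (intro mult_right_mono) auto
        also have "S ^ 7 = \<epsilon> powr (- (7 * \<delta>))"
          unfolding S_def using \<epsilon> by (simp add: powr_power)
        also have "T\<^sup>2 = \<epsilon> powr (- (2 * p + 2 * \<delta>))"
          unfolding T_def using \<epsilon> by (simp add: powr_power algebra_simps)
        also have "\<epsilon> powr (- (11 * \<delta>)) * (\<epsilon> powr (- (7 * \<delta>)) * \<epsilon> powr (- (2 * p + 2 * \<delta>)))
          = \<epsilon> powr (- (2 * s))"
          unfolding powr_add[symmetric] by (simp add: \<delta>_def field_simps)
        also have "\<dots> = (\<epsilon> powr (- s))\<^sup>2" using \<epsilon> by (simp add: powr_power)
        finally show "norm (partial_deriv i (u \<epsilon>) x) \<le> \<epsilon> powr (- s)"
          by (rule power2_le_imp_le) simp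
      qed
    qed
  qed
qed

text \<open>The induction generalizes over \<open>u\<close> and \<open>h\<close>, since a derivative
  of \<open>u\<close> solves the equation with the derivative of \<open>h\<close>. That one exponent
  \<open>p\<close> serves all derivatives of \<open>h\<close> is where regularity of the right-hand
  side enters.\<close>

lemma loc_bounded_partials:
  fixes u h :: "real \<Rightarrow> real^'n::finite \<Rightarrow> complex" and q :: "real \<Rightarrow> 'n \<Rightarrow> real^'n"
    and \<mu> :: "real \<Rightarrow> 'n \<Rightarrow> real"
  assumes coeffs: "\<And>k. slow_net (\<lambda>\<epsilon>. \<mu> \<epsilon> k)" "\<And>k. slow_net (\<lambda>\<epsilon>. inverse (\<mu> \<epsilon> k))"
      "eventually (\<lambda>\<epsilon>. \<forall>k. \<mu> \<epsilon> k > 0) (at_right 0)"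
      "\<And>k. slow_net (\<lambda>\<epsilon>. \<beta> \<epsilon> k)" "slow_net c"
      "eventually (\<lambda>\<epsilon>. \<forall>k. norm (q \<epsilon> k) \<le> B) (at_right 0)"
      "eventually (\<lambda>\<epsilon>. \<forall>z :: 'n \<Rightarrow> complex. (\<Sum>j\<in>UNIV. z j \<bullet> z j)
      \<le> 2 * (\<Sum>k\<in>UNIV. (\<Sum>j\<in>UNIV. of_real (q \<epsilon> k $ j) * z j) \<bullet> (\<Sum>j\<in>UNIV. of_real (q \<epsilon> k $ j) * z j)))
      (at_right 0)"
    and "smooth_net u" "smooth_net h"
    and "\<And>\<epsilon> x. \<epsilon> \<in> {0<..1} \<Longrightarrow>
      (\<Sum>k\<in>UNIV. \<mu> \<epsilon> k *\<^sub>R dir_deriv (q \<epsilon> k) (dir_deriv (q \<epsilon> k) (u \<epsilon>)) x)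
      = (\<Sum>k\<in>UNIV. \<beta> \<epsilon> k * dir_deriv (q \<epsilon> k) (u \<epsilon>) x) + c \<epsilon> * u \<epsilon> x + h \<epsilon> x"
    and "loc_bounded R p u" "\<And>is. loc_bounded R p (\<lambda>\<epsilon>. partials is (h \<epsilon>))"
  shows "loc_bounded R p (\<lambda>\<epsilon>. partials is (u \<epsilon>))"
  using assms(8-)
proof (induction "is" arbitrary: u h)
  case Nil
  then show ?case by simp
next
  case (Cons i "is")
  have h: "loc_bounded R p h" "\<And>j. loc_bounded R p (\<lambda>\<epsilon>. partial_deriv j (h \<epsilon>))"
    using Cons.prems(5)[of "[]"] Cons.prems(5)[of "[_]"] by simp_all
  have "loc_bounded R p (\<lambda>\<epsilon>. partials is (partial_deriv i (u \<epsilon>)))"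
  proof (rule Cons.IH)
    show "smooth_net (\<lambda>\<epsilon>. partial_deriv i (u \<epsilon>))" "smooth_net (\<lambda>\<epsilon>. partial_deriv i (h \<epsilon>))"
      by (intro smooth_net_partial_deriv Cons.prems)+
    show "(\<Sum>k\<in>UNIV. \<mu> \<epsilon> k *\<^sub>R dir_deriv (q \<epsilon> k) (dir_deriv (q \<epsilon> k) (partial_deriv i (u \<epsilon>))) x)
      = (\<Sum>k\<in>UNIV. \<beta> \<epsilon> k * dir_deriv (q \<epsilon> k) (partial_deriv i (u \<epsilon>)) x)
        + c \<epsilon> * partial_deriv i (u \<epsilon>) x + partial_deriv i (h \<epsilon>) x" if "\<epsilon> \<in> {0<..1}" for \<epsilon> x
      using Cons.prems(1,2) that
      by (intro partial_deriv_equation Cons.prems(3)) (auto simp: smooth_net_def)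
    show "loc_bounded R p (\<lambda>\<epsilon>. partial_deriv i (u \<epsilon>))"
      by (rule loc_bounded_partial_deriv[OF Cons.prems(1,2,3) coeffs Cons.prems(4) h])
    show "loc_bounded R p (\<lambda>\<epsilon>. partials js (partial_deriv i (h \<epsilon>)))" for js
      using Cons.prems(5)[of "i # js"] by simp
  qed
  then show ?case by simp
qed

text \<open>The gap \<open>s - p\<close> swallows the constant hidden in the O-bound.\<close>

lemma eventually_le_powr_of_bigo:
  assumes f: "f \<in> O[at_right 0](\<lambda>\<epsilon>. \<epsilon> powr (- p))" and s: "s > p"
  shows "eventually (\<lambda>\<epsilon>. norm (f \<epsilon> :: real) \<le> \<epsilon> powr (- s)) (at_right 0)"
proof -
  obtain C where C: "C > 0" "eventually (\<lambda>\<epsilon>. norm (f \<epsilon>) \<le> C * norm (\<epsilon> powr (- p))) (at_right 0)"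
    using f by (rule landau_o.bigE)
  have "eventually (\<lambda>\<epsilon>::real. C \<le> \<epsilon> powr (- (s - p))) (at_right 0)"
    by (rule const_le_powr) (use s in simp)
  with C(2) show ?thesis
  proof eventually_elim
    case (elim \<epsilon>)
    have "C * \<epsilon> powr (- p) \<le> \<epsilon> powr (- (s - p)) * \<epsilon> powr (- p)"
      using elim by (intro mult_right_mono) auto
    also have "\<dots> = \<epsilon> powr (- s)" by (simp flip: powr_add)
    finally show ?case using elim by simp
  qed
qed

lemma norm_le_sup_norm:
  assumes "smooth g" "compact K" "x \<in> K"
  shows "norm (partials is g x) \<le> sup_norm K (partials is g)"
  unfolding sup_norm_def using assms by (intro cSUP_upper smooth_bdd_above)

lemma loc_bounded_of_sup_norm:
  fixes g :: "real \<Rightarrow> real^'n::finite \<Rightarrow> complex"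
  assumes g: "smooth_net g"
    and bound: "(\<lambda>\<epsilon>. sup_norm (cball 0 R) (partials is (g \<epsilon>))) \<in> O[at_right 0](\<lambda>\<epsilon>. \<epsilon> powr (- p))"
    and p: "p \<le> p'"
  shows "loc_bounded R p' (\<lambda>\<epsilon>. partials is (g \<epsilon>))"
  unfolding loc_bounded_def
proof (intro allI impI)
  fix r s assume r: "r < R" and s: "s > p'"
  have "eventually (\<lambda>\<epsilon>. norm (sup_norm (cball 0 R) (partials is (g \<epsilon>))) \<le> \<epsilon> powr (- s)) (at_right 0)"
    using eventually_le_powr_of_bigo[OF bound] s p by simp
  with eventually_01
  show "eventually (\<lambda>\<epsilon>. \<forall>x. norm x \<le> r \<longrightarrow> norm (partials is (g \<epsilon>) x) \<le> \<epsilon> powr (- s)) (at_right 0)"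
  proof eventually_elim
    case (elim \<epsilon>)
    show ?case
    proof (intro allI impI)
      fix x :: "real^'n" assume "norm x \<le> r"
      then have "norm (partials is (g \<epsilon>) x) \<le> sup_norm (cball 0 R) (partials is (g \<epsilon>))"
        using g elim r by (intro norm_le_sup_norm) (auto simp: smooth_net_def)
      then show "norm (partials is (g \<epsilon>) x) \<le> \<epsilon> powr (- s)" using elim by simp
    qed
  qed
qed

text \<open>The exponent is fixed by the growth of \<open>u\<close> itself and by the exponent
  common to all derivatives of \<open>h\<close>, hence before any order of differentiation of
  \<open>u\<close> is chosen.\<close>

theorem regular_net_of_elliptic_equation:
  fixes u h :: "real \<Rightarrow> real^'n::finite \<Rightarrow> complex" and q :: "real \<Rightarrow> 'n \<Rightarrow> real^'n"
    and \<mu> :: "real \<Rightarrow> 'n \<Rightarrow> real"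
  assumes coeffs: "\<And>k. slow_net (\<lambda>\<epsilon>. \<mu> \<epsilon> k)" "\<And>k. slow_net (\<lambda>\<epsilon>. inverse (\<mu> \<epsilon> k))"
      "eventually (\<lambda>\<epsilon>. \<forall>k. \<mu> \<epsilon> k > 0) (at_right 0)"
      "\<And>k. slow_net (\<lambda>\<epsilon>. \<beta> \<epsilon> k)" "slow_net c"
      "eventually (\<lambda>\<epsilon>. \<forall>k. norm (q \<epsilon> k) \<le> B) (at_right 0)"
      "eventually (\<lambda>\<epsilon>. \<forall>z :: 'n \<Rightarrow> complex. (\<Sum>j\<in>UNIV. z j \<bullet> z j)
      \<le> 2 * (\<Sum>k\<in>UNIV. (\<Sum>j\<in>UNIV. of_real (q \<epsilon> k $ j) * z j) \<bullet> (\<Sum>j\<in>UNIV. of_real (q \<epsilon> k $ j) * z j)))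
      (at_right 0)"
    and u: "moderate_net u" and h: "regular_net h"
    and eq: "\<And>\<epsilon> x. \<epsilon> \<in> {0<..1} \<Longrightarrow>
      (\<Sum>k\<in>UNIV. \<mu> \<epsilon> k *\<^sub>R dir_deriv (q \<epsilon> k) (dir_deriv (q \<epsilon> k) (u \<epsilon>)) x)
      = (\<Sum>k\<in>UNIV. \<beta> \<epsilon> k * dir_deriv (q \<epsilon> k) (u \<epsilon>) x) + c \<epsilon> * u \<epsilon> x + h \<epsilon> x"
  shows "regular_net u"
  unfolding regular_net_def
proof (intro conjI allI impI)
  show su: "smooth_net u" using u by (simp add: moderate_net_def)
  have sh: "smooth_net h" using h by (simp add: regular_net_def)
  fix K :: "(real^'n) set" assume K: "compact K \<and> K \<noteq> {}"
  then obtain r where r: "r > 0" "\<And>x. x \<in> K \<Longrightarrow> norm x \<le> r"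
    using compact_imp_bounded bounded_pos by metis
  \<comment> \<open>The radius \<open>r + 1\<close> leaves room for the strict inequality
    \<open>r < R\<close> in \<open>loc_bounded\<close>.\<close>
  have ball: "compact (cball (0::real^'n) (r + 1)) \<and> cball (0::real^'n) (r + 1) \<noteq> {}"
    using r by simp
  obtain p1 where p1: "p1 \<ge> 0"
    "(\<lambda>\<epsilon>. sup_norm (cball 0 (r + 1)) (partials [] (u \<epsilon>))) \<in> O[at_right 0](\<lambda>\<epsilon>. \<epsilon> powr (- p1))"
    using u ball unfolding moderate_net_def by blast
  obtain p2 where p2: "p2 \<ge> 0"
    "\<And>is. (\<lambda>\<epsilon>. sup_norm (cball 0 (r + 1)) (partials is (h \<epsilon>))) \<in> O[at_right 0](\<lambda>\<epsilon>. \<epsilon> powr (- p2))"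
    using h ball unfolding regular_net_def by blast
  define p where "p = max p1 p2"
  have bu: "loc_bounded (r + 1) p u"
    using loc_bounded_of_sup_norm[OF su p1(2), of p] by (simp add: p_def)
  have bh: "loc_bounded (r + 1) p (\<lambda>\<epsilon>. partials is (h \<epsilon>))" for "is"
    using loc_bounded_of_sup_norm[OF sh p2(2), of p] by (simp add: p_def)
  have loc: "loc_bounded (r + 1) p (\<lambda>\<epsilon>. partials is (u \<epsilon>))" for "is"
    by (rule loc_bounded_partials[OF coeffs su sh eq bu bh])
  show "\<exists>p\<ge>0. \<forall>is. (\<lambda>\<epsilon>. sup_norm K (partials is (u \<epsilon>))) \<in> O[at_right 0](\<lambda>\<epsilon>. \<epsilon> powr (- p))"
  \<comment> \<open>\<open>loc_bounded\<close> gives every exponent greater than \<open>p\<close>,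
    but not \<open>p\<close> itself.\<close>
  proof (intro exI[of _ "p + 1"] conjI allI)
    show "0 \<le> p + 1" using p1 by (simp add: p_def)
    fix "is"
    have "eventually (\<lambda>\<epsilon>. \<forall>x. norm x \<le> r \<longrightarrow> norm (partials is (u \<epsilon>) x) \<le> \<epsilon> powr (- (p + 1))) (at_right 0)"
      by (rule loc[unfolded loc_bounded_def, rule_format]) simp_all
    with eventually_01
    have "eventually (\<lambda>\<epsilon>. norm (sup_norm K (partials is (u \<epsilon>))) \<le> 1 * norm (\<epsilon> powr (- (p + 1)))) (at_right 0)"
    proof eventually_elim
      case (elim \<epsilon>)
      then have "sup_norm K (partials is (u \<epsilon>)) \<ge> 0"
        using su K by (intro sup_norm_nonneg) (auto simp: smooth_net_def)
      moreover have "sup_norm K (partials is (u \<epsilon>)) \<le> \<epsilon> powr (- (p + 1))"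
        unfolding sup_norm_def using K r elim by (intro cSUP_least) auto
      ultimately show ?case by simp
    qed
    then show "(\<lambda>\<epsilon>. sup_norm K (partials is (u \<epsilon>))) \<in> O[at_right 0](\<lambda>\<epsilon>. \<epsilon> powr (- (p + 1)))"
      by (rule bigoI)
  qed
qed

section \<open>Algebra of slow nets\<close>

lemma slow_netD: "slow_net r \<Longrightarrow> \<delta> > 0 \<Longrightarrow> eventually (\<lambda>\<epsilon>. norm (r \<epsilon>) \<le> \<epsilon> powr (- \<delta>)) (at_right 0)"
  by (simp add: slow_net_def)

lemma slow_net_mono:
  assumes "slow_net r" "eventually (\<lambda>\<epsilon>. norm (s \<epsilon>) \<le> norm (r \<epsilon>)) (at_right 0)"
  shows "slow_net s"
  unfolding slow_net_def
proof (intro allI impI)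
  fix \<delta> :: real assume "\<delta> > 0"
  from slow_netD[OF assms(1) this] assms(2)
  show "eventually (\<lambda>\<epsilon>. norm (s \<epsilon>) \<le> \<epsilon> powr (- \<delta>)) (at_right 0)"
    by eventually_elim simp
qed

lemma slow_net_const: "slow_net (\<lambda>_. a)"
  unfolding slow_net_def by (auto intro: const_le_powr)

lemma slow_net_mult:
  fixes r s :: "real \<Rightarrow> 'a::real_normed_algebra"
  assumes "slow_net r" "slow_net s"
  shows "slow_net (\<lambda>\<epsilon>. r \<epsilon> * s \<epsilon>)"
  unfolding slow_net_def
proof (intro allI impI)
  fix \<delta> :: real assume "\<delta> > 0"
  then have "\<delta> / 2 > 0" by simp
  from slow_netD[OF assms(1) this] slow_netD[OF assms(2) this]
  show "eventually (\<lambda>\<epsilon>. norm (r \<epsilon> * s \<epsilon>) \<le> \<epsilon> powr (- \<delta>)) (at_right 0)"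
  proof eventually_elim
    case (elim \<epsilon>)
    have "norm (r \<epsilon> * s \<epsilon>) \<le> norm (r \<epsilon>) * norm (s \<epsilon>)" by (rule norm_mult_ineq)
    also have "\<dots> \<le> \<epsilon> powr (- (\<delta> / 2)) * \<epsilon> powr (- (\<delta> / 2))"
      using elim by (intro mult_mono) auto
    also have "\<dots> = \<epsilon> powr (- \<delta>)" by (simp flip: powr_add)
    finally show ?case .
  qed
qed

lemma slow_net_add:
  assumes "slow_net r" "slow_net s"
  shows "slow_net (\<lambda>\<epsilon>. r \<epsilon> + s \<epsilon>)"
  unfolding slow_net_def
proof (intro allI impI)
  fix \<delta> :: real assume "\<delta> > 0"
  then have \<delta>: "\<delta> / 2 > 0" by simp
  from slow_netD[OF assms(1) \<delta>] slow_netD[OF assms(2) \<delta>] const_le_powr[OF \<delta>, of 2]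
  show "eventually (\<lambda>\<epsilon>. norm (r \<epsilon> + s \<epsilon>) \<le> \<epsilon> powr (- \<delta>)) (at_right 0)"
  proof eventually_elim
    case (elim \<epsilon>)
    have "norm (r \<epsilon> + s \<epsilon>) \<le> 2 * \<epsilon> powr (- (\<delta> / 2))"
      using elim norm_triangle_ineq[of "r \<epsilon>" "s \<epsilon>"] by simp
    also have "\<dots> \<le> \<epsilon> powr (- (\<delta> / 2)) * \<epsilon> powr (- (\<delta> / 2))"
      using elim by (intro mult_right_mono) auto
    also have "\<dots> = \<epsilon> powr (- \<delta>)" by (simp flip: powr_add)
    finally show ?case .
  qed
qed

lemma slow_net_sum: "(\<And>i. i \<in> I \<Longrightarrow> slow_net (r i)) \<Longrightarrow> slow_net (\<lambda>\<epsilon>. \<Sum>i\<in>I. r i \<epsilon>)"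
  by (induction I rule: infinite_finite_induct) (auto intro: slow_net_const slow_net_add)

lemma slow_scale_imp_slow_net:
  assumes "slow_scale_net r"
  shows "slow_net r"
  unfolding slow_net_def
proof (intro allI impI)
  fix \<delta> :: real assume \<delta>: "\<delta> > 0"
  \<comment> \<open>The \<open>t\<close>-th power of the norm is \<open>O(1 / \<epsilon>)\<close>,
    so it is eventually at most \<open>\<epsilon> powr (- 2)\<close>, where the exponent 2 > 1
    absorbs the constant. The \<open>t\<close>-th root then has exponent
    \<open>- 2 / t = - \<delta>\<close>.\<close>
  define t where "t = 2 / \<delta>"
  have t: "t > 0" using \<delta> by (simp add: t_def)
  have "(\<lambda>\<epsilon>. norm (r \<epsilon>) powr t) \<in> O[at_right 0](\<lambda>\<epsilon>. 1 / \<epsilon>)"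
    using assms t by (simp add: slow_scale_net_def)
  also have "(\<lambda>\<epsilon>::real. 1 / \<epsilon>) \<in> O[at_right 0](\<lambda>\<epsilon>. \<epsilon> powr (- 1))"
    using eventually_01
    by (intro bigoI[of _ 1]) (auto elim!: eventually_mono simp: powr_minus divide_simps)
  finally have "eventually (\<lambda>\<epsilon>. norm (norm (r \<epsilon>) powr t) \<le> \<epsilon> powr (- 2)) (at_right 0)"
    by (rule eventually_le_powr_of_bigo) simp
  with eventually_01 show "eventually (\<lambda>\<epsilon>. norm (r \<epsilon>) \<le> \<epsilon> powr (- \<delta>)) (at_right 0)"
  proof eventually_elim
    case (elim \<epsilon>)
    have "norm (r \<epsilon>) = (norm (r \<epsilon>) powr t) powr (1 / t)"
      using t by (simp add: powr_powr)
    also have "\<dots> \<le> (\<epsilon> powr (- 2)) powr (1 / t)"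
      using elim t by (intro powr_mono2) auto
    also have "\<dots> = \<epsilon> powr (- \<delta>)" by (simp add: powr_powr t_def)
    finally show ?case .
  qed
qed

lemma log_type_imp_slow_net:
  assumes "log_type_net r"
  shows "slow_net r"
  unfolding slow_net_def
proof (intro allI impI)
  fix \<delta> :: real assume \<delta>: "\<delta> > 0"
  obtain e C where e: "e > 0" "C > 0" "\<And>\<epsilon>. \<epsilon> \<in> {0<..<e} \<Longrightarrow> norm (r \<epsilon>) \<le> C * ln (1 / \<epsilon>)"
    using assms unfolding log_type_net_def by blast
  have "eventually (\<lambda>\<epsilon>. \<epsilon> \<in> {0<..<e}) (at_right 0)"
    by (rule eventually_at_right_real) (rule e)
  moreover have "eventually (\<lambda>\<epsilon>. C * ln (1 / \<epsilon>) \<le> \<epsilon> powr (- \<delta>)) (at_right 0)"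
    using \<delta> e(2) by real_asymp
  ultimately show "eventually (\<lambda>\<epsilon>. norm (r \<epsilon>) \<le> \<epsilon> powr (- \<delta>)) (at_right 0)"
    by eventually_elim (use e(3) order_trans in blast)
qed

text \<open>Errors of at most \<open>1 / (2 * CARD('n))\<close> in the entries of the Gram matrix
  change the quadratic form by at most half of the sum of the \<open>z j \<bullet> z j\<close>. The
  other half survives, hence the factor 2.\<close>

lemma sum_sq_le_frame:
  fixes Q :: "real^'n::finite^'n" and z :: "'n \<Rightarrow> complex"
  assumes gram: "\<And>i j. \<bar>(\<Sum>k\<in>UNIV. Q $ k $ i * Q $ k $ j) - (if i = j then 1 else 0)\<bar> \<le> 1 / (2 * CARD('n))"
  shows "(\<Sum>j\<in>UNIV. z j \<bullet> z j) \<le> 2 * (\<Sum>k\<in>UNIV.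
    (\<Sum>j\<in>UNIV. of_real (Q $ k $ j) * z j) \<bullet> (\<Sum>j\<in>UNIV. of_real (Q $ k $ j) * z j))"
proof -
  define n where "n = real CARD('n)"
  have n: "n > 0" unfolding n_def by simp
  define e where "e i j = (\<Sum>k\<in>UNIV. Q $ k $ i * Q $ k $ j) - (if i = j then 1 else 0)" for i j
  have "(\<Sum>k\<in>UNIV. (\<Sum>j\<in>UNIV. of_real (Q $ k $ j) * z j) \<bullet> (\<Sum>j\<in>UNIV. of_real (Q $ k $ j) * z j))
    = (\<Sum>k\<in>UNIV. \<Sum>i\<in>UNIV. \<Sum>j\<in>UNIV. Q $ k $ i * Q $ k $ j * (z i \<bullet> z j))"
    by (simp add: inner_sum_left inner_sum_right sum_distrib_left mult.assoc mult.left_commute inner_commute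
        flip: scaleR_conv_of_real)
  also have "\<dots> = (\<Sum>i\<in>UNIV. \<Sum>k\<in>UNIV. \<Sum>j\<in>UNIV. Q $ k $ i * Q $ k $ j * (z i \<bullet> z j))"
    by (rule sum.swap)
  also have "\<dots> = (\<Sum>i\<in>UNIV. \<Sum>j\<in>UNIV. \<Sum>k\<in>UNIV. Q $ k $ i * Q $ k $ j * (z i \<bullet> z j))"
    by (intro sum.cong sum.swap refl)
  also have "\<dots> = (\<Sum>i\<in>UNIV. \<Sum>j\<in>UNIV. (if i = j then z i \<bullet> z j else 0) + e i j * (z i \<bullet> z j))"
    by (intro sum.cong refl) (simp add: e_def left_diff_distrib flip: sum_distrib_right)
  also have "\<dots> = (\<Sum>i\<in>UNIV. z i \<bullet> z i) + (\<Sum>i\<in>UNIV. \<Sum>j\<in>UNIV. e i j * (z i \<bullet> z j))"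
    by (simp add: sum.distrib)
  finally have eq: "(\<Sum>k\<in>UNIV. (\<Sum>j\<in>UNIV. of_real (Q $ k $ j) * z j) \<bullet> (\<Sum>j\<in>UNIV. of_real (Q $ k $ j) * z j))
    = (\<Sum>i\<in>UNIV. z i \<bullet> z i) + (\<Sum>i\<in>UNIV. \<Sum>j\<in>UNIV. e i j * (z i \<bullet> z j))" .
  have "(\<Sum>i\<in>UNIV. \<Sum>j\<in>UNIV. - (1 / (2 * n) * ((z i \<bullet> z i + z j \<bullet> z j) / 2)))
    \<le> (\<Sum>i\<in>UNIV. \<Sum>j\<in>UNIV. e i j * (z i \<bullet> z j))"
  proof (intro sum_mono)
    fix i j
    have "\<bar>z i \<bullet> z j\<bar> \<le> norm (z i) * norm (z j)" by (rule Cauchy_Schwarz_ineq2)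
    also have "\<dots> \<le> (z i \<bullet> z i + z j \<bullet> z j) / 2"
      using sum_squares_bound[of "norm (z i)" "norm (z j)"] by (simp add: dot_square_norm)
    finally have "\<bar>e i j * (z i \<bullet> z j)\<bar> \<le> 1 / (2 * n) * ((z i \<bullet> z i + z j \<bullet> z j) / 2)"
      unfolding abs_mult using gram[of i j] n by (intro mult_mono) (auto simp: e_def n_def)
    then show "- (1 / (2 * n) * ((z i \<bullet> z i + z j \<bullet> z j) / 2)) \<le> e i j * (z i \<bullet> z j)" by linarith
  qed
  moreover have "(\<Sum>i\<in>UNIV. \<Sum>j\<in>UNIV. - (1 / (2 * n) * ((z i \<bullet> z i + z j \<bullet> z j) / 2)))
    = - (1 / (2 * n) * (\<Sum>i\<in>UNIV. \<Sum>j\<in>UNIV. (z i \<bullet> z i + z j \<bullet> z j) / 2))"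
    by (simp only: sum_negf sum_distrib_left)
  moreover have "(\<Sum>i\<in>UNIV. \<Sum>j\<in>UNIV. (z i \<bullet> z i + z j \<bullet> z j) / 2) = n * (\<Sum>i\<in>UNIV. z i \<bullet> z i)"
    by (simp add: add_divide_distrib sum.distrib n_def flip: sum_divide_distrib sum_distrib_left)
  ultimately show ?thesis using n eq by simp
qed

text \<open>The Gram matrix of the columns does not see the rows directly, but its diagonal controls
  every single entry.\<close>

lemma row_norm_bound:
  fixes Q :: "real^'n::finite^'n"
  assumes gram: "\<And>i j. \<bar>(\<Sum>k\<in>UNIV. Q $ k $ i * Q $ k $ j) - (if i = j then 1 else 0)\<bar> \<le> 1 / (2 * CARD('n))"
  shows "norm (Q $ k) \<le> 2 * CARD('n)"
proof -
  have "\<bar>Q $ k $ j\<bar> \<le> 2" for j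
  proof -
    have "(Q $ k $ j)\<^sup>2 \<le> (\<Sum>k\<in>UNIV. (Q $ k $ j)\<^sup>2)" by (rule member_le_sum) auto
    also have "\<dots> \<le> 1 + 1 / (2 * CARD('n))" using gram[of j j] by (simp add: power2_eq_square)
    also have "\<dots> \<le> 1 + 1"
    proof -
      have "real CARD('n) \<ge> 1" using zero_less_card_finite[where 'a='n] by linarith
      then have "1 \<le> real (2 * CARD('n))" by linarith
      then have "1 / real (2 * CARD('n)) \<le> 1" by (subst divide_le_eq_1_pos) linarith+
      then show ?thesis by (rule add_left_mono)
    qed
    finally have "(Q $ k $ j)\<^sup>2 \<le> 2\<^sup>2" by simp
    then show ?thesis by (simp add: abs_le_square_iff[of _ 2, simplified])
  qed
  then have "(\<Sum>j\<in>UNIV. \<bar>Q $ k $ j\<bar>) \<le> (\<Sum>j\<in>(UNIV::'n set). 2)" by (intro sum_mono)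
  then show ?thesis using norm_le_l1_cart[of "Q $ k"] by simp
qed


section \<open>Representatives\<close>

lemma number_rel_refl: "moderate_number r \<Longrightarrow> number_rel r r"
  by (simp add: number_rel_def negligible_number_zero)

lemma represents_rep_gnum: "represents (rep_gnum x) x"
  using Quotient_rep_reflp[OF Quotient_gnum, of x] Quotient_abs_rep[OF Quotient_gnum, of x]
  by (simp add: represents_def number_rel_def)

lemma represents_exists: "\<exists>r. represents r x"
  using represents_rep_gnum by blast

lemma represents_const: "represents (\<lambda>_. a) (abs_gnum (\<lambda>_. a))"
  by (simp add: represents_def moderate_number_const)

lemma represents_zero: "represents (\<lambda>_. 0) 0"
  by (simp add: represents_def moderate_number_const zero_gnum_def)

lemma represents_one: "represents (\<lambda>_. 1) 1"
  by (simp add: represents_def moderate_number_const one_gnum_def)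

lemma represents_add:
  "represents r x \<Longrightarrow> represents s y \<Longrightarrow> represents (\<lambda>\<epsilon>. r \<epsilon> + s \<epsilon>) (x + y)"
  by (auto simp: represents_def moderate_number_add plus_gnum.abs_eq number_rel_refl)

lemma represents_mult:
  "represents r x \<Longrightarrow> represents s y \<Longrightarrow> represents (\<lambda>\<epsilon>. r \<epsilon> * s \<epsilon>) (x * y)"
  by (auto simp: represents_def moderate_number_mult times_gnum.abs_eq number_rel_refl)

lemma represents_sum:
  "(\<And>i. i \<in> I \<Longrightarrow> represents (r i) (x i)) \<Longrightarrow> represents (\<lambda>\<epsilon>. \<Sum>i\<in>I. r i \<epsilon>) (\<Sum>i\<in>I. x i)"
  by (induction I rule: infinite_finite_induct) (auto intro: represents_zero represents_add)

lemma moderate_number_norm: "moderate_number (\<lambda>\<epsilon>. norm (r \<epsilon>)) \<longleftrightarrow> moderate_number r"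
  by (simp add: moderate_number_def)

lemma moderate_number_of_real:
  "moderate_number (\<lambda>\<epsilon>. complex_of_real (r \<epsilon>)) \<longleftrightarrow> moderate_number r"
  by (simp add: moderate_number_def)

lemma represents_gcomplex: "represents r x \<Longrightarrow> represents (\<lambda>\<epsilon>. of_real (r \<epsilon>)) (gcomplex x)"
  by (auto simp: represents_def gcomplex.abs_eq number_rel_refl moderate_number_of_real)

lemma represents_gabs: "represents r x \<Longrightarrow> represents (\<lambda>\<epsilon>. norm (r \<epsilon>)) (gabs x)"
  by (auto simp: represents_def gabs.abs_eq number_rel_refl moderate_number_norm)

lemma represents_unique: "represents r x \<Longrightarrow> represents r y \<Longrightarrow> x = y"
  by (auto simp: represents_def)

lemma represents_negligible_diff:
  assumes "represents r x" "represents s x"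
  shows "negligible_number (\<lambda>\<epsilon>. r \<epsilon> - s \<epsilon>)"
proof -
  have "number_rel r s"
    using assms number_rel_refl Quotient_gnum
    unfolding represents_def Quotient_def by metis
  then show ?thesis by (simp add: number_rel_def)
qed

lemma negligible_eventually_le:
  assumes "negligible_number r" "a > 0"
  shows "eventually (\<lambda>\<epsilon>. norm (r \<epsilon>) \<le> a) (at_right 0)"
proof -
  have "(\<lambda>\<epsilon>. norm (r \<epsilon>)) \<in> O[at_right 0](\<lambda>\<epsilon>. \<epsilon> powr (- (- 2)))"
    using assms(1) unfolding negligible_number_def by simp
  then have "eventually (\<lambda>\<epsilon>. norm (norm (r \<epsilon>)) \<le> \<epsilon> powr (- (- 1))) (at_right 0)"
    by (rule eventually_le_powr_of_bigo) simp
  moreover have "eventually (\<lambda>\<epsilon>::real. \<epsilon> \<in> {0<..<a}) (at_right 0)"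
    by (rule eventually_at_right_real) (rule assms)
  ultimately show ?thesis by eventually_elim auto
qed

lemma represents_eventually_close:
  assumes "represents r x" "represents s x" "a > 0"
  shows "eventually (\<lambda>\<epsilon>. norm (r \<epsilon> - s \<epsilon>) \<le> a) (at_right 0)"
  by (rule negligible_eventually_le[OF represents_negligible_diff[OF assms(1,2)] assms(3)])

lemma gcomplex_mult: "gcomplex (x * y) = gcomplex x * gcomplex y"
proof -
  obtain r s where rs: "represents r x" "represents s y" using represents_exists by metis
  show ?thesis
    by (rule represents_unique[OF represents_gcomplex[OF represents_mult[OF rs]]])
      (use represents_mult[OF represents_gcomplex[OF rs(1)] represents_gcomplex[OF rs(2)]] in simp)
qed

lemma gcomplex_one: "gcomplex 1 = 1"
  by (rule represents_unique[OF represents_gcomplex[OF represents_one]])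
    (simp add: represents_one)

lemma gcomplex_zero: "gcomplex 0 = 0"
  by (rule represents_unique[OF represents_gcomplex[OF represents_zero]])
    (simp add: represents_zero)

lemma gcomplex_add: "gcomplex (x + y) = gcomplex x + gcomplex y"
proof -
  obtain r s where rs: "represents r x" "represents s y" using represents_exists by metis
  show ?thesis
    by (rule represents_unique[OF represents_gcomplex[OF represents_add[OF rs]]])
      (use represents_add[OF represents_gcomplex[OF rs(1)] represents_gcomplex[OF rs(2)]] in simp)
qed

lemma gcomplex_sum: "gcomplex (\<Sum>i\<in>I. x i) = (\<Sum>i\<in>I. gcomplex (x i))"
  by (induction I rule: infinite_finite_induct) (auto simp: gcomplex_zero gcomplex_add)

lemma gnum_inverse_unique:
  fixes x :: "'a::real_normed_field gnum"
  assumes "x * y = 1"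
  shows "inverse x = y"
proof -
  have "x dvd 1" using assms by (metis dvdI)
  from gnum_mult_inverse[OF this] have "y * (x * inverse x) = y" by simp
  then show ?thesis using assms by (metis mult.assoc mult.commute mult_1)
qed

text \<open>The product of the representatives differs from 1 by a negligible net. This turns
  invertibility of a class into a quantitative lower bound for small \<epsilon>, while for other
  \<epsilon> a representative may well vanish.\<close>

lemma represents_nonzero_bounds:
  fixes r s :: "real \<Rightarrow> real"
  assumes "represents r x" "represents s y" "x * y = 1"
  shows "eventually (\<lambda>\<epsilon>. 1 / 2 \<le> r \<epsilon> * s \<epsilon> \<and> r \<epsilon> * s \<epsilon> \<le> 2) (at_right 0)"
proof -
  have "represents (\<lambda>\<epsilon>. r \<epsilon> * s \<epsilon>) 1" using represents_mult[OF assms(1,2)] assms(3) by simp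
  from represents_eventually_close[OF this represents_one, of "1 / 2"]
  have "eventually (\<lambda>\<epsilon>. \<bar>r \<epsilon> * s \<epsilon> - 1\<bar> \<le> 1 / 2) (at_right 0)" by simp
  then show ?thesis by eventually_elim linarith
qed

lemma slow_scale_represents: "slow_scale x \<Longrightarrow> represents r x \<Longrightarrow> slow_net r"
  by (simp add: slow_scale_def slow_scale_imp_slow_net)

lemma log_type_represents: "log_type x \<Longrightarrow> represents r x \<Longrightarrow> slow_net r"
  by (simp add: log_type_def log_type_imp_slow_net)

section \<open>Representatives of elements of the Colombeau algebra\<close>

definition net_represents :: "(real \<Rightarrow> real^'n::finite \<Rightarrow> complex) \<Rightarrow> 'n colombeau \<Rightarrow> bool" where
  "net_represents v U \<longleftrightarrow> moderate_net v \<and> abs_colombeau v = U"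

lemma net_rel_refl: "moderate_net v \<Longrightarrow> net_rel v v"
  by (simp add: net_rel_def negligible_zero)

lemma net_represents_exists: "\<exists>v. net_represents v U"
  by (induction U rule: colombeau.abs_induct) (auto simp: net_represents_def net_rel_def)

lemma net_represents_zero: "net_represents (\<lambda>_ _. 0) 0"
  by (simp add: net_represents_def moderate_zero zero_colombeau_def)

lemma net_represents_add:
  "net_represents v U \<Longrightarrow> net_represents w W \<Longrightarrow> net_represents (\<lambda>\<epsilon> x. v \<epsilon> x + w \<epsilon> x) (U + W)"
  by (auto simp: net_represents_def moderate_add plus_colombeau.abs_eq net_rel_refl)

lemma net_represents_sum:
  "(\<And>i. i \<in> I \<Longrightarrow> net_represents (v i) (U i)) \<Longrightarrow>
    net_represents (\<lambda>\<epsilon> x. \<Sum>i\<in>I. v i \<epsilon> x) (\<Sum>i\<in>I. U i)"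
  by (induction I rule: infinite_finite_induct) (auto intro: net_represents_zero net_represents_add)

lemma net_represents_gscale:
  "represents a x \<Longrightarrow> net_represents v U \<Longrightarrow> net_represents (\<lambda>\<epsilon> x. a \<epsilon> * v \<epsilon> x) (gscale x U)"
  by (auto simp: net_represents_def represents_def moderate_scale gscale.abs_eq net_rel_refl
      number_rel_refl)

lemma net_represents_gD:
  "net_represents v U \<Longrightarrow> net_represents (\<lambda>\<epsilon> x. - \<i> * partial_deriv j (v \<epsilon>) x) (gD j U)"
  using moderate_scale[OF moderate_number_const[of "- \<i>"] moderate_partial_deriv[of v j]]
  by (auto simp: net_represents_def gD.abs_eq net_rel_refl)

lemma net_represents_unique: "net_represents v U \<Longrightarrow> net_represents v W \<Longrightarrow> U = W"
  by (auto simp: net_represents_def)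

lemma net_represents_negligible_diff:
  assumes "net_represents v U" "net_represents w U"
  shows "negligible_net (\<lambda>\<epsilon> x. v \<epsilon> x - w \<epsilon> x)"
proof -
  have "net_rel v w"
    using assms net_rel_refl Quotient_colombeau
    unfolding net_represents_def Quotient_def by metis
  then show ?thesis by (simp add: net_rel_def)
qed

lemma gscale_add: "gscale x (U + W) = gscale x U + gscale x W"
proof -
  obtain a v w where r: "represents a x" "net_represents v U" "net_represents w W"
    using represents_exists net_represents_exists by metis
  show ?thesis
    by (rule net_represents_unique[OF net_represents_gscale[OF r(1) net_represents_add[OF r(2,3)]]])
      (use net_represents_add[OF net_represents_gscale[OF r(1,2)] net_represents_gscale[OF r(1,3)]]
        in \<open>simp add: distrib_left\<close>)
qed

lemma gscale_zero: "gscale x 0 = 0"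
  using gscale_add[of x 0 0] by simp

lemma gscale_sum: "gscale x (\<Sum>i\<in>I. U i) = (\<Sum>i\<in>I. gscale x (U i))"
  by (induction I rule: infinite_finite_induct) (auto simp: gscale_zero gscale_add)

lemma gscale_gscale: "gscale x (gscale y U) = gscale (x * y) U"
proof -
  obtain a b v where r: "represents a x" "represents b y" "net_represents v U"
    using represents_exists net_represents_exists by metis
  show ?thesis
    by (rule net_represents_unique[OF net_represents_gscale[OF r(1) net_represents_gscale[OF r(2,3)]]])
      (use net_represents_gscale[OF represents_mult[OF r(1,2)] r(3)] in \<open>simp add: mult.assoc\<close>)
qed

lemma gscale_second_order_op:
  "gscale m (second_order_op A b c U) =
     (\<Sum>i\<in>UNIV. \<Sum>j\<in>UNIV. gscale (m * gcomplex (A $ i $ j)) (gD i (gD j U)))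
     + (\<Sum>j\<in>UNIV. gscale (m * b $ j) (gD j U)) + gscale (m * c) U"
  by (simp add: second_order_op_def gscale_add gscale_sum gscale_gscale)

section \<open>Regularity of representatives\<close>

lemma regular_net_add_negligible:
  assumes v: "regular_net v" and w: "negligible_net w"
  shows "regular_net (\<lambda>\<epsilon> x. v \<epsilon> x + w \<epsilon> x)"
  unfolding regular_net_def
proof (intro conjI allI impI)
  have s: "smooth_net v" "smooth_net w" using v w by (simp_all add: regular_net_def negligible_net_def)
  then show "smooth_net (\<lambda>\<epsilon> x. v \<epsilon> x + w \<epsilon> x)" by (rule smooth_net_add)
  fix K :: "(real^'a) set" assume K: "compact K \<and> K \<noteq> {}"
  then obtain p where p: "p \<ge> 0"
    "\<And>is. (\<lambda>\<epsilon>. sup_norm K (partials is (v \<epsilon>))) \<in> O[at_right 0](\<lambda>\<epsilon>. \<epsilon> powr (- p))"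
    using v unfolding regular_net_def by blast
  have "(\<lambda>\<epsilon>. sup_norm K (partials is (w \<epsilon>))) \<in> O[at_right 0](\<lambda>\<epsilon>. \<epsilon> powr 0)" for "is"
    using w K unfolding negligible_net_def by blast
  then have "(\<lambda>\<epsilon>. sup_norm K (partials is (w \<epsilon>))) \<in> O[at_right 0](\<lambda>\<epsilon>. \<epsilon> powr (- p))" for "is"
    by (rule landau_o.big_trans[OF _ bigo_powr_mono]) (use p in simp)
  then show "\<exists>p\<ge>0. \<forall>is. (\<lambda>\<epsilon>. sup_norm K (partials is (\<lambda>x. v \<epsilon> x + w \<epsilon> x))) \<in> O[at_right 0](\<lambda>\<epsilon>. \<epsilon> powr (- p))"
    using p s K by (intro exI[of _ p] conjI allI bigo_sup_norm_add) auto
qed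

lemma regular_net_scale:
  assumes a: "moderate_number a" and v: "regular_net v"
  shows "regular_net (\<lambda>\<epsilon> x. a \<epsilon> * v \<epsilon> x)"
  unfolding regular_net_def
proof (intro conjI allI impI)
  have s: "smooth_net v" using v by (simp add: regular_net_def)
  then show "smooth_net (\<lambda>\<epsilon> x. a \<epsilon> * v \<epsilon> x)" by (rule smooth_net_scale)
  fix K :: "(real^'a) set" assume K: "compact K \<and> K \<noteq> {}"
  then obtain p where p: "p \<ge> 0"
    "\<And>is. (\<lambda>\<epsilon>. sup_norm K (partials is (v \<epsilon>))) \<in> O[at_right 0](\<lambda>\<epsilon>. \<epsilon> powr (- p))"
    using v unfolding regular_net_def by blast
  obtain p' where p': "p' \<ge> 0" "(\<lambda>\<epsilon>. norm (a \<epsilon>)) \<in> O[at_right 0](\<lambda>\<epsilon>. \<epsilon> powr (- p'))"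
    using a unfolding moderate_number_def by blast
  have "(\<lambda>\<epsilon>. sup_norm K (partials is (\<lambda>x. a \<epsilon> * v \<epsilon> x))) \<in> O[at_right 0](\<lambda>\<epsilon>. \<epsilon> powr (- p' + - p))" for "is"
    using K by (intro bigo_sup_norm_scale s p p') auto
  then show "\<exists>p\<ge>0. \<forall>is. (\<lambda>\<epsilon>. sup_norm K (partials is (\<lambda>x. a \<epsilon> * v \<epsilon> x))) \<in> O[at_right 0](\<lambda>\<epsilon>. \<epsilon> powr (- p))"
    using p p' by (intro exI[of _ "p' + p"]) simp
qed

text \<open>Any two representatives differ by a negligible net, whose derivatives are bounded on
  compact sets for small \<epsilon> and thus fit under every exponent.\<close>

lemma G_infty_iff:
  assumes "net_represents v U"
  shows "U \<in> G_infty \<longleftrightarrow> regular_net v"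
proof
  assume "regular_net v"
  then show "U \<in> G_infty" using assms by (auto simp: G_infty_def net_represents_def)
next
  assume "U \<in> G_infty"
  then obtain w where w: "net_represents w U" "regular_net w"
    by (auto simp: G_infty_def net_represents_def)
  from regular_net_add_negligible[OF w(2) net_represents_negligible_diff[OF assms w(1)]]
  show "regular_net v" by simp
qed

lemma G_infty_gscale: "U \<in> G_infty \<Longrightarrow> gscale x U \<in> G_infty"
proof -
  assume U: "U \<in> G_infty"
  obtain a v where r: "represents a x" "net_represents v U"
    using represents_exists net_represents_exists by metis
  then show ?thesis
    using U regular_net_scale
    by (auto simp: G_infty_iff[OF r(2)] G_infty_iff[OF net_represents_gscale[OF r]] represents_def)
qed


section \<open>The normalized operator\<close>

lemma gabs_mult: "gabs (x * y) = gabs x * gabs y"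
proof -
  obtain r s where rs: "represents r x" "represents s y" using represents_exists by metis
  show ?thesis
    by (rule represents_unique[OF represents_gabs[OF represents_mult[OF rs]]])
      (use represents_mult[OF represents_gabs[OF rs(1)] represents_gabs[OF rs(2)]]
        in \<open>simp add: norm_mult\<close>)
qed

lemma gabs_one: "gabs 1 = 1"
  by (rule represents_unique[OF represents_gabs[OF represents_one]])
    (simp add: represents_one)

text \<open>Merges the two cases for \<gamma>: \<open>m\<close> is 1 or the inverse of
  \<open>gabs \<gamma>\<close>. In the second case \<open>\<rho>\<close> represents
  \<gamma>/|\<gamma>| and is eventually bounded by 2, hence slow; in the first it vanishes.\<close>

lemma normalizing_factor:
  assumes "\<gamma> = 0 \<or> \<gamma> dvd (1 :: complex gnum)"
  shows "\<exists>m r \<rho>. m dvd 1 \<and> (\<forall>(lam :: real gnum^'n) i. lam_tilde lam \<gamma> $ i = lam $ i * m) \<and> represents r m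
    \<and> eventually (\<lambda>\<epsilon>. r \<epsilon> > 0) (at_right 0) \<and> represents \<rho> (gcomplex m * \<gamma>) \<and> slow_net \<rho>"
proof (cases "\<gamma> = 0")
  case True
  have "represents (\<lambda>_. 0) (gcomplex 1 * \<gamma>)" using True represents_zero by simp
  then show ?thesis
    by (intro exI[of _ 1] exI[of _ "\<lambda>_. 1"] exI[of _ "\<lambda>_. 0"])
      (use True in \<open>simp add: lam_tilde_def represents_one slow_net_const\<close>)
next
  case False
  then obtain \<delta> where "\<gamma> * \<delta> = 1" using assms by (metis dvdE)
  then have "gabs \<gamma> * gabs \<delta> = 1" by (metis gabs_mult gabs_one)
  then have "gabs \<gamma> dvd 1" by (metis dvdI)
  define m where "m = inverse (gabs \<gamma>)"
  have m: "gabs \<gamma> * m = 1" using gnum_mult_inverse[OF \<open>gabs \<gamma> dvd 1\<close>] by (simp add: m_def)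
  obtain r g where r: "represents r m" "represents g \<gamma>" using represents_exists by metis
  have \<rho>: "represents (\<lambda>\<epsilon>. of_real (r \<epsilon>) * g \<epsilon>) (gcomplex m * \<gamma>)"
    by (intro represents_mult represents_gcomplex r)
  have ev: "eventually (\<lambda>\<epsilon>. 1 / 2 \<le> norm (g \<epsilon>) * r \<epsilon> \<and> norm (g \<epsilon>) * r \<epsilon> \<le> 2) (at_right 0)"
    by (rule represents_nonzero_bounds[OF represents_gabs[OF r(2)] r(1) m])
  \<comment> \<open>A norm is nonnegative, so a positive product with it forces
    \<open>r \<epsilon>\<close> to be positive.\<close>
  then have pos: "eventually (\<lambda>\<epsilon>. r \<epsilon> > 0) (at_right 0)"
  proof eventually_elim
    case (elim \<epsilon>)
    then have "norm (g \<epsilon>) * r \<epsilon> > 0" by linarith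
    then show ?case by (metis norm_ge_zero zero_less_mult_pos less_eq_real_def mult_zero_left)
  qed
  have "eventually (\<lambda>\<epsilon>. norm (of_real (r \<epsilon>) * g \<epsilon>) \<le> norm (2 :: real)) (at_right 0)"
    using ev pos by eventually_elim (simp add: norm_mult mult.commute)
  then have "slow_net (\<lambda>\<epsilon>. of_real (r \<epsilon>) * g \<epsilon>)"
    by (rule slow_net_mono[OF slow_net_const])
  moreover have "m dvd 1" using m by (metis dvdI mult.commute)
  moreover have "lam_tilde lam \<gamma> $ i = lam $ i * m" for lam :: "real gnum^'n" and i
    using False by (simp add: lam_tilde_def divide_gnum_def m_def)
  ultimately show ?thesis using r(1) pos \<rho> by blast
qed

section \<open>Coefficients expressed through the eigenvalues and \<open>Q\<close>\<close>

lemma matrix_diagonalization_entry: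
  fixes Q :: "real gnum^'n::finite^'n"
  shows "(transpose Q ** diag lam ** Q) $ i $ j = (\<Sum>k\<in>UNIV. Q $ k $ i * lam $ k * Q $ k $ j)"
proof -
  have "(transpose Q ** diag lam) $ i $ k = Q $ k $ i * lam $ k" for k
  proof -
    have "(transpose Q ** diag lam) $ i $ k = (\<Sum>l\<in>UNIV. if l = k then Q $ l $ i * lam $ l else 0)"
      by (simp add: matrix_matrix_mult_def transpose_def diag_def if_distrib cong: if_cong)
    then show ?thesis by simp
  qed
  then show ?thesis by (subst matrix_matrix_mult_def) simp
qed

lemma orthogonal_gram:
  fixes Q :: "real gnum^'n::finite^'n"
  assumes "orthogonal_matrix Q"
  shows "(\<Sum>k\<in>UNIV. Q $ k $ i * Q $ k $ j) = (if i = j then 1 else 0)"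
proof -
  have "(transpose Q ** Q) $ i $ j = mat 1 $ i $ j" using assms by (simp add: orthogonal_matrix_def)
  then show ?thesis by (simp add: matrix_matrix_mult_def transpose_def mat_def)
qed

lemma op_beta_inverse:
  fixes Q :: "real gnum^'n::finite^'n"
  assumes "orthogonal_matrix Q"
  shows "b $ j = (\<Sum>k\<in>UNIV. gcomplex (Q $ k $ j) * op_beta Q b $ k)"
proof -
  have "(\<Sum>k\<in>UNIV. gcomplex (Q $ k $ j) * op_beta Q b $ k)
    = (\<Sum>k\<in>UNIV. \<Sum>l\<in>UNIV. gcomplex (Q $ k $ j) * (gcomplex (Q $ k $ l) * b $ l))"
    by (simp add: op_beta_def sum_distrib_left)
  also have "\<dots> = (\<Sum>l\<in>UNIV. \<Sum>k\<in>UNIV. gcomplex (Q $ k $ j) * (gcomplex (Q $ k $ l) * b $ l))"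
    by (rule sum.swap)
  also have "\<dots> = (\<Sum>l\<in>UNIV. gcomplex (\<Sum>k\<in>UNIV. Q $ k $ j * Q $ k $ l) * b $ l)"
    by (simp add: gcomplex_sum gcomplex_mult sum_distrib_right mult.assoc)
  also have "\<dots> = (\<Sum>l\<in>UNIV. if j = l then b $ l else 0)"
    by (intro sum.cong) (auto simp: orthogonal_gram[OF assms] gcomplex_one gcomplex_zero)
  finally show ?thesis by simp
qed

text \<open>\<open>op_gamma\<close> divides by \<open>4 * gcomplex (lam $ j)\<close>, and division
  in this ring is meaningful only once the divisor is known to be invertible.\<close>

lemma four_times_quarter: "4 * abs_gnum (\<lambda>_. 1 / 4) = (1 :: complex gnum)"
proof -
  have "represents (\<lambda>_. (1 + 1 + 1 + 1) * (1 / 4)) ((1 + 1 + 1 + 1) * abs_gnum (\<lambda>_. 1 / 4 :: complex))"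
    by (intro represents_mult represents_add represents_one represents_const)
  then have "represents (\<lambda>_. 1) (4 * abs_gnum (\<lambda>_. 1 / 4 :: complex))" by simp
  then show ?thesis using represents_one by (rule represents_unique)
qed

text \<open>Rewrites the contributions of one \<open>\<beta>\<^sub>k\<close> in terms of the
  quotient \<open>x / gcomplex l\<close> and of the normalized eigenvalue \<open>l * m\<close>, the
  quantities whose growth the hypotheses control.\<close>

lemma square_divide_normalized:
  fixes x :: "complex gnum"
  assumes l: "l dvd 1"
  shows "gcomplex m * (x\<^sup>2 / (4 * gcomplex l))
      = (x / gcomplex l)\<^sup>2 * gcomplex (l * m) * abs_gnum (\<lambda>_. 1 / 4)"
    and "gcomplex m * x = (x / gcomplex l) * gcomplex (l * m)"
proof -
  define q :: "complex gnum" where "q = abs_gnum (\<lambda>_. 1 / 4)"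
  have q: "4 * q = 1" unfolding q_def by (rule four_times_quarter)
  obtain k where k: "gcomplex l * k = 1"
    using l by (metis dvdE gcomplex_mult gcomplex_one)
  have inv: "inverse (gcomplex l) = k" by (rule gnum_inverse_unique[OF k])
  have "(4 * gcomplex l) * (q * k) = (4 * q) * (gcomplex l * k)" by (simp only: mult_ac)
  then have inv4: "inverse (4 * gcomplex l) = q * k"
    using q k by (intro gnum_inverse_unique) simp
  have "(x * k)\<^sup>2 * (gcomplex l * gcomplex m) * q = (gcomplex l * k) * (gcomplex m * (x\<^sup>2 * (q * k)))"
    by (simp only: power2_eq_square mult_ac)
  then show "gcomplex m * (x\<^sup>2 / (4 * gcomplex l))
      = (x / gcomplex l)\<^sup>2 * gcomplex (l * m) * abs_gnum (\<lambda>_. 1 / 4)"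
    using k by (simp add: divide_gnum_def inv inv4 gcomplex_mult q_def)
  have "x * k * (gcomplex l * gcomplex m) = (gcomplex l * k) * (gcomplex m * x)"
    by (simp only: mult_ac)
  then show "gcomplex m * x = (x / gcomplex l) * gcomplex (l * m)"
    using k by (simp add: divide_gnum_def inv gcomplex_mult)
qed

text \<open>The second identity inverts \<open>op_beta\<close> by orthogonality of \<open>Q\<close>;
  the third undoes the completion of the square that defines \<gamma>.\<close>

lemma normalized_coefficients:
  fixes Q :: "real gnum^'n::finite^'n" and b :: "complex gnum^'n"
  assumes Q: "orthogonal_matrix Q" and A: "A = transpose Q ** diag lam ** Q"
    and lam: "\<And>k. lam $ k dvd 1"
  defines "\<theta> \<equiv> \<lambda>k. op_beta Q b $ k / gcomplex (lam $ k)"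
  shows "gcomplex m * gcomplex (A $ i $ j) = gcomplex (\<Sum>k\<in>UNIV. lam $ k * m * Q $ k $ i * Q $ k $ j)"
    and "gcomplex m * b $ j = (\<Sum>k\<in>UNIV. gcomplex (Q $ k $ j) * (\<theta> k * gcomplex (lam $ k * m)))"
    and "gcomplex m * c = gcomplex m * op_gamma Q lam b c
      + (\<Sum>k\<in>UNIV. (\<theta> k)\<^sup>2 * gcomplex (lam $ k * m) * abs_gnum (\<lambda>_. 1 / 4))"
proof -
  show "gcomplex m * gcomplex (A $ i $ j) = gcomplex (\<Sum>k\<in>UNIV. lam $ k * m * Q $ k $ i * Q $ k $ j)"
    unfolding A matrix_diagonalization_entry gcomplex_mult[symmetric] sum_distrib_left
    by (simp only: mult_ac)
  have "gcomplex m * b $ j = (\<Sum>k\<in>UNIV. gcomplex (Q $ k $ j) * (gcomplex m * op_beta Q b $ k))"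
    by (subst op_beta_inverse[OF Q]) (simp only: sum_distrib_left mult_ac)
  then show "gcomplex m * b $ j = (\<Sum>k\<in>UNIV. gcomplex (Q $ k $ j) * (\<theta> k * gcomplex (lam $ k * m)))"
    unfolding \<theta>_def square_divide_normalized(2)[OF lam, symmetric] .
  have "c = op_gamma Q lam b c + (\<Sum>k\<in>UNIV. (op_beta Q b $ k)\<^sup>2 / (4 * gcomplex (lam $ k)))"
    by (simp add: op_gamma_def)
  from arg_cong[OF this, of "\<lambda>x. gcomplex m * x"]
  have "gcomplex m * c = gcomplex m * op_gamma Q lam b c
      + (\<Sum>k\<in>UNIV. gcomplex m * ((op_beta Q b $ k)\<^sup>2 / (4 * gcomplex (lam $ k))))"
    by (simp only: distrib_left sum_distrib_left)
  then show "gcomplex m * c = gcomplex m * op_gamma Q lam b c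
      + (\<Sum>k\<in>UNIV. (\<theta> k)\<^sup>2 * gcomplex (lam $ k * m) * abs_gnum (\<lambda>_. 1 / 4))"
    unfolding \<theta>_def square_divide_normalized(1)[OF lam, symmetric] .
qed

text \<open>Exact for arbitrary vectors \<open>q k\<close>, orthogonal or not. Two factors
  \<open>- \<i>\<close> give the sign of the second order part; a single one leaves the
  \<open>\<i>\<close> in the first order part.\<close>

lemma second_order_in_directions:
  fixes u :: "real^'n::finite \<Rightarrow> complex" and \<mu> :: "'n \<Rightarrow> real" and q :: "'n \<Rightarrow> real^'n"
  assumes u: "smooth u"
  shows "(\<Sum>i\<in>UNIV. \<Sum>j\<in>UNIV. of_real (\<Sum>k\<in>UNIV. \<mu> k * q k $ i * q k $ j)
        * (- \<i> * partial_deriv i (\<lambda>x. - \<i> * partial_deriv j u x) x))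
      = - (\<Sum>k\<in>UNIV. \<mu> k *\<^sub>R dir_deriv (q k) (dir_deriv (q k) u) x)"
    and "(\<Sum>j\<in>UNIV. (\<Sum>k\<in>UNIV. of_real (q k $ j) * \<beta> k) * (- \<i> * partial_deriv j u x))
      = - (\<Sum>k\<in>UNIV. \<i> * \<beta> k * dir_deriv (q k) u x)"
proof -
  have s: "smooth (partial_deriv j u)" for j by (rule smooth_partial_deriv[OF u])
  have "dir_deriv (q k) (dir_deriv (q k) u) x
    = (\<Sum>i\<in>UNIV. \<Sum>j\<in>UNIV. of_real (q k $ i * q k $ j) * partial_deriv i (partial_deriv j u) x)" for k
    unfolding dir_deriv_def[abs_def]
    by (simp add: partial_deriv_sum smooth_scale s partial_deriv_scale sum_distrib_left mult.assoc)
  then have "(\<Sum>k\<in>UNIV. \<mu> k *\<^sub>R dir_deriv (q k) (dir_deriv (q k) u) x)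
    = (\<Sum>k\<in>UNIV. \<Sum>i\<in>UNIV. \<Sum>j\<in>UNIV. of_real (\<mu> k * q k $ i * q k $ j) * partial_deriv i (partial_deriv j u) x)"
    by (simp add: scaleR_conv_of_real sum_distrib_left mult.assoc)
  also have "\<dots> = (\<Sum>i\<in>UNIV. \<Sum>k\<in>UNIV. \<Sum>j\<in>UNIV. of_real (\<mu> k * q k $ i * q k $ j) * partial_deriv i (partial_deriv j u) x)"
    by (rule sum.swap)
  also have "\<dots> = (\<Sum>i\<in>UNIV. \<Sum>j\<in>UNIV. \<Sum>k\<in>UNIV. of_real (\<mu> k * q k $ i * q k $ j) * partial_deriv i (partial_deriv j u) x)"
    by (intro sum.cong refl sum.swap)
  also have "\<dots> = (\<Sum>i\<in>UNIV. \<Sum>j\<in>UNIV. of_real (\<Sum>k\<in>UNIV. \<mu> k * q k $ i * q k $ j)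
    * partial_deriv i (partial_deriv j u) x)"
    by (simp only: of_real_sum sum_distrib_right)
  also have "\<dots> = - (\<Sum>i\<in>UNIV. \<Sum>j\<in>UNIV. of_real (\<Sum>k\<in>UNIV. \<mu> k * q k $ i * q k $ j)
        * (- \<i> * partial_deriv i (\<lambda>x. - \<i> * partial_deriv j u x) x))"
    unfolding sum_negf[symmetric]
    by (intro sum.cong refl) (simp only: partial_deriv_scale[OF s], simp)
  finally show "(\<Sum>i\<in>UNIV. \<Sum>j\<in>UNIV. of_real (\<Sum>k\<in>UNIV. \<mu> k * q k $ i * q k $ j)
        * (- \<i> * partial_deriv i (\<lambda>x. - \<i> * partial_deriv j u x) x))
      = - (\<Sum>k\<in>UNIV. \<mu> k *\<^sub>R dir_deriv (q k) (dir_deriv (q k) u) x)" by simp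
  have "(\<Sum>j\<in>UNIV. (\<Sum>k\<in>UNIV. of_real (q k $ j) * \<beta> k) * (- \<i> * partial_deriv j u x))
    = (\<Sum>j\<in>UNIV. \<Sum>k\<in>UNIV. - \<i> * \<beta> k * (of_real (q k $ j) * partial_deriv j u x))"
    unfolding sum_distrib_right by (simp only: mult_ac)
  also have "\<dots> = (\<Sum>k\<in>UNIV. \<Sum>j\<in>UNIV. - \<i> * \<beta> k * (of_real (q k $ j) * partial_deriv j u x))"
    by (rule sum.swap)
  also have "\<dots> = (\<Sum>k\<in>UNIV. - \<i> * \<beta> k * dir_deriv (q k) u x)"
    unfolding dir_deriv_def sum_distrib_left ..
  finally show "(\<Sum>j\<in>UNIV. (\<Sum>k\<in>UNIV. of_real (q k $ j) * \<beta> k) * (- \<i> * partial_deriv j u x))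
      = - (\<Sum>k\<in>UNIV. \<i> * \<beta> k * dir_deriv (q k) u x)"
    by (simp add: sum_negf)
qed

text \<open>The proof works with one representative \<open>v\<close> of \<open>u\<close>, since
  regularity does not depend on the choice. The normalized eigenvalues are
  \<open>lam $ k * m\<close>; it remains to transfer the hypotheses from classes to nets and to
  verify the equation pointwise.\<close>

theorem proposition5p8:
  fixes A Q :: "real gnum^'n^'n" and lam :: "real gnum^'n"
    and b \<beta> :: "complex gnum^'n" and c \<gamma> :: "complex gnum"
    and f u :: "'n::finite colombeau"
  assumes "G_elliptic A"
    and "gen_eigenvalues A lam"
    and "orthogonal_matrix Q"
    and "A = transpose Q ** diag lam ** Q"
    and "\<beta> = op_beta Q b"
    and "\<gamma> = op_gamma Q lam b c"
    and "\<gamma> = 0 \<or> \<gamma> dvd 1"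
    and "f \<in> G_infty"
    and "second_order_op A b c u = f"
    and "\<And>j. log_type (\<beta> $ j / gcomplex (lam $ j))"
    and "\<And>i. slow_scale (lam_tilde lam \<gamma> $ i)"
    and "\<And>i. slow_scale (inverse (lam_tilde lam \<gamma> $ i))"
  shows "u \<in> G_infty"
proof -
  define \<theta> where "\<theta> k = op_beta Q b $ k / gcomplex (lam $ k)" for k
  obtain m r \<rho> where m: "m dvd 1" "\<And>i. lam_tilde lam \<gamma> $ i = lam $ i * m" "represents r m"
      "eventually (\<lambda>\<epsilon>. r \<epsilon> > 0) (at_right 0)"
    and \<rho>: "represents \<rho> (gcomplex m * \<gamma>)" "slow_net \<rho>"
    using normalizing_factor[OF assms(7), where 'n='n] by blast
  have lam: "lam $ k dvd 1" "gnonneg (lam $ k)" for k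
    using assms(1,2) unfolding G_elliptic_def by blast+
  \<comment> \<open>Representatives that are nonnegative on all of (0,1]; the sign of
    \<open>\<mu> \<epsilon> k\<close> will come from them.\<close>
  from lam(2) have "\<forall>k. \<exists>l. represents l (lam $ k) \<and> (\<forall>\<epsilon>\<in>{0<..1}. l \<epsilon> \<ge> 0)"
    by (simp add: gnonneg_def)
  from choice[OF this] obtain l where l: "\<And>k. represents (l k) (lam $ k)"
      "\<And>k \<epsilon>. \<epsilon> \<in> {0<..1} \<Longrightarrow> l k \<epsilon> \<ge> 0" by blast
  define s where "s k = rep_gnum (inverse (lam $ k * m))" for k
  define t where "t k = rep_gnum (\<theta> k)" for k
  define Qr where "Qr k j = rep_gnum (Q $ k $ j)" for k j
  have s: "represents (s k) (inverse (lam $ k * m))" and t: "represents (t k) (\<theta> k)"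
    and Qr: "represents (Qr k j) (Q $ k $ j)" for k j
    by (simp_all add: s_def t_def Qr_def represents_rep_gnum)
  obtain v where v: "net_represents v u" using net_represents_exists by blast

  define q where "q \<epsilon> = (\<chi> k j. Qr k j \<epsilon>)" for \<epsilon>
  define \<mu> where "\<mu> \<epsilon> k = l k \<epsilon> * r \<epsilon>" for \<epsilon> k
  define \<beta>t where "\<beta>t \<epsilon> k = t k \<epsilon> * of_real (\<mu> \<epsilon> k)" for \<epsilon> k
  define ct where "ct \<epsilon> = \<rho> \<epsilon> + (\<Sum>k\<in>UNIV. (t k \<epsilon>)\<^sup>2 * of_real (\<mu> \<epsilon> k) * (1 / 4))" for \<epsilon>
  \<comment> \<open>Assembled from the representatives chosen above, not from representatives of
    \<open>A\<close> and \<open>b\<close>, so that \<open>v\<close> solves the equation in the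
    directions \<open>q \<epsilon> $ k\<close> without any error term.\<close>
  define h where "h \<epsilon> x = (\<Sum>i\<in>UNIV. \<Sum>j\<in>UNIV. of_real (\<Sum>k\<in>UNIV. \<mu> \<epsilon> k * q \<epsilon> $ k $ i * q \<epsilon> $ k $ j)
        * (- \<i> * partial_deriv i (\<lambda>x. - \<i> * partial_deriv j (v \<epsilon>) x) x))
      + (\<Sum>j\<in>UNIV. (\<Sum>k\<in>UNIV. of_real (q \<epsilon> $ k $ j) * \<beta>t \<epsilon> k) * (- \<i> * partial_deriv j (v \<epsilon>) x))
      + ct \<epsilon> * v \<epsilon> x" for \<epsilon> x

  have q_rep: "represents (\<lambda>\<epsilon>. q \<epsilon> $ k $ j) (Q $ k $ j)" for k j
    using Qr by (simp add: q_def)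
  have \<mu>_rep: "represents (\<lambda>\<epsilon>. \<mu> \<epsilon> k) (lam $ k * m)" for k
    unfolding \<mu>_def by (intro represents_mult l m)
  have \<beta>t_rep: "represents (\<lambda>\<epsilon>. \<beta>t \<epsilon> k) (\<theta> k * gcomplex (lam $ k * m))" for k
    unfolding \<beta>t_def by (intro represents_mult represents_gcomplex t \<mu>_rep)
  have ct_rep: "represents ct (gcomplex m * c)"
    unfolding ct_def[abs_def] normalized_coefficients(3)[OF assms(3,4) lam(1), where b = b and c = c and m = m]
      \<theta>_def[symmetric] power2_eq_square
    by (intro represents_add represents_sum \<rho>(1)[unfolded assms(6)] represents_mult
        represents_gcomplex represents_const t \<mu>_rep)
  \<comment> \<open>By \<open>normalized_coefficients\<close>, the coefficients in \<open>h\<close>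
    represent those of the operator multiplied by \<open>gcomplex m\<close>. Hence \<open>h\<close>
    represents a multiple of \<open>f\<close>.\<close>
  have "net_represents h (gscale (gcomplex m) (second_order_op A b c u))"
    unfolding h_def[abs_def] gscale_second_order_op normalized_coefficients(1)[OF assms(3,4) lam(1), where m = m]
      normalized_coefficients(2)[OF assms(3,4) lam(1), where b = b and m = m]
      \<theta>_def[symmetric]
    by (intro net_represents_add net_represents_sum net_represents_gscale net_represents_gD
        represents_gcomplex represents_sum represents_mult[of _ "gcomplex _"]
        represents_mult q_rep \<mu>_rep \<beta>t_rep ct_rep v)
  moreover have "gscale (gcomplex m) (second_order_op A b c u) \<in> G_infty"
    using assms(8,9) by (simp add: G_infty_gscale)
  ultimately have "regular_net h" by (simp add: G_infty_iff)
  from regular_net_scale[OF moderate_number_const[of "- 1"] this]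
  have regh: "regular_net (\<lambda>\<epsilon> x. - h \<epsilon> x)" by simp

  have slow_\<mu>: "slow_net (\<lambda>\<epsilon>. \<mu> \<epsilon> k)" for k
    by (rule slow_scale_represents[OF assms(11)[of k, unfolded m(2)] \<mu>_rep])
  have "slow_net (s k)" for k
    by (rule slow_scale_represents[OF assms(12)[of k, unfolded m(2)] s])
  then have slow_2s: "slow_net (\<lambda>\<epsilon>. 2 * s k \<epsilon>)" for k
    by (intro slow_net_mult slow_net_const)
  have slow_t: "slow_net (t k)" for k
    by (rule log_type_represents[OF assms(10)[of k, unfolded assms(5)] t[unfolded \<theta>_def]])
  have slow_of_real: "slow_net (\<lambda>\<epsilon>. complex_of_real (\<mu> \<epsilon> k))" for k
    using slow_\<mu>[of k] by (simp add: slow_net_def)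
  have ev_prod: "eventually (\<lambda>\<epsilon>. 1 / 2 \<le> \<mu> \<epsilon> k * s k \<epsilon> \<and> \<mu> \<epsilon> k * s k \<epsilon> \<le> 2) (at_right 0)" for k
  proof (rule represents_nonzero_bounds[OF \<mu>_rep s gnum_mult_inverse])
    show "lam $ k * m dvd 1" using mult_dvd_mono[OF lam(1)[of k] m(1)] by simp
  qed
  \<comment> \<open>Nonnegativity comes from \<open>l\<close> and \<open>r\<close>; zero is excluded
    because the product with \<open>s k \<epsilon>\<close> is at least 1/2.\<close>
  have ev_pos: "eventually (\<lambda>\<epsilon>. \<mu> \<epsilon> k > 0) (at_right 0)" for k
    using ev_prod[of k] m(4) eventually_01
  proof eventually_elim
    case (elim \<epsilon>)
    then have "\<mu> \<epsilon> k \<ge> 0" using l(2)[of \<epsilon> k] by (simp add: \<mu>_def)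
    moreover have "\<mu> \<epsilon> k \<noteq> 0" using elim by auto
    ultimately show ?case by simp
  qed
  \<comment> \<open>The hypothesis speaks about \<open>s k\<close>, a representative of the inverse
    class. The pointwise inverse of \<open>\<mu> \<epsilon> k\<close> is compared with it through
    the upper bound \<open>2 * s k \<epsilon>\<close>.\<close>
  have slow_inv: "slow_net (\<lambda>\<epsilon>. inverse (\<mu> \<epsilon> k))" for k
  proof (rule slow_net_mono[OF slow_2s[of k]])
    show "eventually (\<lambda>\<epsilon>. norm (inverse (\<mu> \<epsilon> k)) \<le> norm (2 * s k \<epsilon>)) (at_right 0)"
      using ev_prod[of k] ev_pos[of k]
    proof eventually_elim
      case (elim \<epsilon>)
      then have "inverse (\<mu> \<epsilon> k) \<le> 2 * s k \<epsilon>" by (simp add: field_simps)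
      then show ?case using elim by simp
    qed
  qed
  have slow_\<beta>: "slow_net (\<lambda>\<epsilon>. - \<i> * \<beta>t \<epsilon> k)" for k
    unfolding \<beta>t_def by (intro slow_net_mult slow_net_const slow_t slow_of_real)
  have slow_c: "slow_net ct"
    unfolding ct_def[abs_def] power2_eq_square
    by (intro slow_net_add slow_net_sum slow_net_mult slow_net_const slow_t slow_of_real \<rho>)

  \<comment> \<open>Orthogonality of \<open>Q\<close> survives for representatives up to a
    negligible error, in particular up to any fixed tolerance for small \<epsilon>.\<close>
  have "eventually (\<lambda>\<epsilon>. \<bar>(\<Sum>k\<in>UNIV. q \<epsilon> $ k $ i * q \<epsilon> $ k $ j) - (if i = j then 1 else 0)\<bar>
      \<le> 1 / (2 * CARD('n))) (at_right 0)" for i j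
  proof -
    have 1: "represents (\<lambda>\<epsilon>. \<Sum>k\<in>UNIV. q \<epsilon> $ k $ i * q \<epsilon> $ k $ j) (if i = j then 1 else 0)"
      unfolding orthogonal_gram[OF assms(3), symmetric]
      by (intro represents_sum represents_mult q_rep)
    have 2: "represents (\<lambda>\<epsilon>. if i = j then 1 else 0) (if i = j then 1 else 0)"
      by (simp add: represents_one represents_zero)
    show ?thesis using represents_eventually_close[OF 1 2, of "1 / (2 * CARD('n))"] by simp
  qed
  then have gram: "eventually (\<lambda>\<epsilon>. \<forall>i j. \<bar>(\<Sum>k\<in>UNIV. q \<epsilon> $ k $ i * q \<epsilon> $ k $ j) - (if i = j then 1 else 0)\<bar>
      \<le> 1 / (2 * CARD('n))) (at_right 0)"
    by (intro eventually_all_finite)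
  have "regular_net v"
  proof (rule regular_net_of_elliptic_equation)
    show "slow_net (\<lambda>\<epsilon>. \<mu> \<epsilon> k)" "slow_net (\<lambda>\<epsilon>. inverse (\<mu> \<epsilon> k))" "slow_net (\<lambda>\<epsilon>. - \<i> * \<beta>t \<epsilon> k)"
      "slow_net ct" for k by (fact slow_\<mu> slow_inv slow_\<beta> slow_c)+
    show "eventually (\<lambda>\<epsilon>. \<forall>k. \<mu> \<epsilon> k > 0) (at_right 0)"
      by (intro eventually_all_finite ev_pos)
    show "eventually (\<lambda>\<epsilon>. \<forall>k. norm (q \<epsilon> $ k) \<le> 2 * CARD('n)) (at_right 0)"
      using gram by eventually_elim (use row_norm_bound in blast)
    show "eventually (\<lambda>\<epsilon>. \<forall>z :: 'n \<Rightarrow> complex. (\<Sum>j\<in>UNIV. z j \<bullet> z j)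
      \<le> 2 * (\<Sum>k\<in>UNIV. (\<Sum>j\<in>UNIV. of_real (q \<epsilon> $ k $ j) * z j) \<bullet> (\<Sum>j\<in>UNIV. of_real (q \<epsilon> $ k $ j) * z j)))
      (at_right 0)"
      using gram by eventually_elim (use sum_sq_le_frame in blast)
    show "moderate_net v" using v by (simp add: net_represents_def)
    show "regular_net (\<lambda>\<epsilon> x. - h \<epsilon> x)" by (rule regh)
    fix \<epsilon> :: real and x :: "real^'n" assume "\<epsilon> \<in> {0<..1}"
    then have "smooth (v \<epsilon>)" using v by (auto simp: net_represents_def moderate_net_def smooth_net_def)
    then have "h \<epsilon> x = - (\<Sum>k\<in>UNIV. \<mu> \<epsilon> k *\<^sub>R dir_deriv (q \<epsilon> $ k) (dir_deriv (q \<epsilon> $ k) (v \<epsilon>)) x)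
      - (\<Sum>k\<in>UNIV. \<i> * \<beta>t \<epsilon> k * dir_deriv (q \<epsilon> $ k) (v \<epsilon>) x) + ct \<epsilon> * v \<epsilon> x"
      by (simp only: h_def second_order_in_directions) simp
    \<comment> \<open>Solving for the principal part flips the sign of \<open>h\<close> but not of
      the first and zeroth order terms, since the second order part of \<open>h\<close> already
      carries a minus.\<close>
    then show "(\<Sum>k\<in>UNIV. \<mu> \<epsilon> k *\<^sub>R dir_deriv (q \<epsilon> $ k) (dir_deriv (q \<epsilon> $ k) (v \<epsilon>)) x)
      = (\<Sum>k\<in>UNIV. - \<i> * \<beta>t \<epsilon> k * dir_deriv (q \<epsilon> $ k) (v \<epsilon>) x) + ct \<epsilon> * v \<epsilon> x + - h \<epsilon> x"
      by (simp add: sum_negf)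
  qed
  then show ?thesis by (simp add: G_infty_iff[OF v])
qed

end
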